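(* Let $\Omega,\Gamma,B,D$, the parameters $b^\varepsilon,d^\varepsilon,h^\varepsilon,\varrho^\varepsilon$, the operator $\mathcal{A}^\varepsilon$ and the limits $q\in[0,\infty]$, $r\in[0,\infty)$ (assumed to exist) be as in the context. Let $\{\lambda_k^\varepsilon\}_{k\in\mathbb{N}}$ be the sequence of eigenvalues of $\mathcal{A}^\varepsilon$ written in ascending order and repeated according to multiplicity. If $q=0$, then for each $k\in\mathbb{N}$ one has $\lambda_k^\varepsilon\to0$ as $\varepsilon\to0$.
   Context: Notation: $n\ge2$; $x=(x',x_n)\in\mathbb{R}^n$ with $x'=(x_1,\dots,x_{n-1})\in\mathbb{R}^{n-1}$; $|\cdot|$ denotes $n$- or $(n-1)$-dimensional volume as appropriate; a domain is a connected open set; $\varepsilon>0$ is a small parameter. The domain: $\Omega\subset\{x_n<0\}$ is a bounded domain in $\mathbb{R}^n$ with Lipschitz boundary; $\Gamma=\partial\Omega\cap\{x_n=0\}$, and $\{x'\in\mathbb{R}^{n-1}:(x',0)\in\Gamma\}$ has non-empty interior in $\mathbb{R}^{n-1}$. Rooms and passages: $B\subset\mathbb{R}^n$ and $D\subset\mathbb{R}^{n-1}$ are bounded domains with Lipschitz boundaries such that $B\subset\{x:\ x'\in(-\frac12,\frac12)^{n-1},\ x_n>0\}$; for some $R\in(0,\frac12)$, $\{x:|x'|<R,\ x_n=0\}\subset\partial B$; and $0\in D\subset\{x'\in\mathbb{R}^{n-1}:|x'|<R\}$. The positive numbers $b^\varepsilon,d^\varepsilon,h^\varepsilon$ satisfy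 $d^\varepsilon\le b^\varepsilon\le\varepsilon$, $h^\varepsilon\to0$ as $\varepsilon\to0$, and $\varepsilon^{n-1}\mathbf{D}^\varepsilon\to0$ as $\varepsilon\to0$, where $\mathbf{D}^\varepsilon=|\ln d^\varepsilon|$ if $n=2$ and $\mathbf{D}^\varepsilon=(d^\varepsilon)^{2-n}$ if $n>2$. For $i\in\mathbb{Z}^{n-1}$ let $x^{i,\varepsilon}=(\varepsilon i,0)\in\mathbb{R}^n$ and $$B_i^\varepsilon=\Bigl\{x\in\mathbb{R}^n:\tfrac1{b^\varepsilon}\bigl(x-x^{i,\varepsilon}-(0,h^\varepsilon)\bigr)\in B\Bigr\},\qquad T_i^\varepsilon=\Bigl\{x\in\mathbb{R}^n:\tfrac1{d^\varepsilon}(x'-\varepsilon i)\in D,\ 0\le x_n\le h^\varepsilon\Bigr\}.$$ Let $\mathcal{I}^\varepsilon=\{i\in\mathbb{Z}^{n-1}:\ x^{i,\varepsilon}\in\Gamma,\ \mathrm{dist}(x^{i,\varepsilon},\partial\Omega\setminus\Gamma)\ge\varepsilon\frac{\sqrt n}2\}$ and $\Omega^\varepsilon=\Omega\cup\bigcup_{i\in\mathcal{I}^\varepsilon}(T_i^\varepsilon\cup B_i^\varepsilon)$. The operator $\mathcal{A}^\varepsilon$: let $\varrho^\varepsilon>0$ be constants, $\rho^\varepsilon=\varrho^\varepsilon$ on $\bigcup_{i\in\mathcal{I}^\varepsilon}B_i^\varepsilon$ and $\rho^\varepsilon=1$ on $\Omega\cup\bigcup_{i\in\mathcal{I}^\varepsilon}T_i^\varepsilon$.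 $\mathcal{H}^\varepsilon$ is $L_2(\Omega^\varepsilon)$ with scalar product $(u,v)_{\mathcal{H}^\varepsilon}=\int_{\Omega^\varepsilon}u\bar v\,\rho^\varepsilon\,\mathrm{d}x$, and $\mathcal{A}^\varepsilon$ is the self-adjoint operator in $\mathcal{H}^\varepsilon$ associated with the form $\eta^\varepsilon[u,v]=\int_{\Omega^\varepsilon}\nabla u\cdot\nabla\bar v\,\mathrm{d}x$, $\mathrm{dom}(\eta^\varepsilon)=H^1(\Omega^\varepsilon)$ (i.e. $-\frac1{\rho^\varepsilon}\Delta$ with Neumann boundary conditions). Its spectrum is purely discrete. The limits: $q^\varepsilon=\dfrac{(d^\varepsilon)^{n-1}|D|}{h^\varepsilon\varrho^\varepsilon(b^\varepsilon)^n|B|}$, $r^\varepsilon=\dfrac{\varrho^\varepsilon(b^\varepsilon)^n|B|}{\varepsilon^{n-1}}$; it is assumed that $q=\lim_{\varepsilon\to0}q^\varepsilon\in[0,\infty]$ and $r=\lim_{\varepsilon\to0}r^\varepsilon\in[0,\infty)$ exist. *)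

theory Defs
  imports "HOL-Analysis.Analysis"
begin

(* The space R^n, n >= 2, is rendered as (real^'m) * real with n - 1 = CARD('m) >= 1, so that
   x' = fst x and x_n = snd x; the product norm is the Euclidean norm of R^n. *)

definition domain :: "'a::topological_space set \<Rightarrow> bool" where
  "domain S \<longleftrightarrow> open S \<and> connected S"

text \<open>Near each boundary point the set is the region on one side of the graph of a Lipschitz
  function over the hyperplane orthogonal to a unit vector \<open>e\<close>; if the space has dimension one,
  this hyperplane is \<open>{0}\<close>.\<close>

definition lipschitz_boundary :: "'a::euclidean_space set \<Rightarrow> bool" where
  "lipschitz_boundary S \<longleftrightarrow>
     (\<forall>p\<in>frontier S. \<exists>e r L. \<exists>g :: 'a \<Rightarrow> real.
        norm e = 1 \<and> r > 0 \<and> L-lipschitz_on {y. y \<bullet> e = 0} g \<and>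
        (\<forall>x\<in>ball p r. x \<in> S \<longleftrightarrow> x \<bullet> e < g (x - (x \<bullet> e) *\<^sub>R e)))"

text \<open>Elements of \<open>L\<^sub>2\<close> are represented by functions; identification of functions that agree
  almost everywhere is made explicit where it matters (dimensions, resolvents).\<close>

definition L2 :: "'a::euclidean_space set \<Rightarrow> ('a \<Rightarrow> complex) set" where
  "L2 S = {u \<in> borel_measurable (lebesgue_on S).
             integrable (lebesgue_on S) (\<lambda>x. (cmod (u x))\<^sup>2)}"

definition partial :: "'a::euclidean_space \<Rightarrow> ('a \<Rightarrow> real) \<Rightarrow> 'a \<Rightarrow> real" where
  "partial b f x = frechet_derivative f (at x) b"

primrec C_k :: "nat \<Rightarrow> ('a::euclidean_space \<Rightarrow> real) \<Rightarrow> bool" where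
  "C_k 0 f \<longleftrightarrow> continuous_on UNIV f"
| "C_k (Suc k) f \<longleftrightarrow> (\<forall>x. f differentiable (at x)) \<and> (\<forall>b\<in>Basis. C_k k (partial b f))"

definition test_functions :: "'a::euclidean_space set \<Rightarrow> ('a \<Rightarrow> real) set" where
  "test_functions S = {\<phi>. (\<forall>k. C_k k \<phi>) \<and>
     compact (closure {x. \<phi> x \<noteq> 0}) \<and> closure {x. \<phi> x \<noteq> 0} \<subseteq> S}"

definition weak_partial ::
    "'a::euclidean_space set \<Rightarrow> 'a \<Rightarrow> ('a \<Rightarrow> complex) \<Rightarrow> ('a \<Rightarrow> complex) \<Rightarrow> bool" where
  "weak_partial S b u g \<longleftrightarrow> g \<in> L2 S \<and>
     (\<forall>\<phi>\<in>test_functions S.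
        (LINT x|lebesgue_on S. u x * complex_of_real (partial b \<phi> x)) =
        - (LINT x|lebesgue_on S. g x * complex_of_real (\<phi> x)))"

definition H1 :: "'a::euclidean_space set \<Rightarrow> ('a \<Rightarrow> complex) set" where
  "H1 S = {u \<in> L2 S. \<forall>b\<in>Basis. \<exists>g. weak_partial S b u g}"

text \<open>On an open set the choice is unique up to a null set.\<close>

definition wpartial :: "'a::euclidean_space set \<Rightarrow> 'a \<Rightarrow> ('a \<Rightarrow> complex) \<Rightarrow> 'a \<Rightarrow> complex" where
  "wpartial S b u = (SOME g. weak_partial S b u g)"

definition dirichlet_form ::
    "'a::euclidean_space set \<Rightarrow> ('a \<Rightarrow> complex) \<Rightarrow> ('a \<Rightarrow> complex) \<Rightarrow> complex" where
  "dirichlet_form S u v =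
     (LINT x|lebesgue_on S. (\<Sum>b\<in>Basis. wpartial S b u x * cnj (wpartial S b v x)))"

definition winner ::
    "'a::euclidean_space set \<Rightarrow> ('a \<Rightarrow> real) \<Rightarrow> ('a \<Rightarrow> complex) \<Rightarrow> ('a \<Rightarrow> complex) \<Rightarrow> complex" where
  "winner S \<rho> u v = (LINT x|lebesgue_on S. u x * cnj (v x) * complex_of_real (\<rho> x))"

definition wnorm :: "'a::euclidean_space set \<Rightarrow> ('a \<Rightarrow> real) \<Rightarrow> ('a \<Rightarrow> complex) \<Rightarrow> real" where
  "wnorm S \<rho> u = sqrt (Re (winner S \<rho> u u))"

text \<open>Unbounded operators are given by their graphs. The operator associated with the form
  (first representation theorem): \<open>u\<close> is in the domain with image \<open>w\<close> iff
  \<open>\<eta>[u,v] = (w,v)\<close> for all \<open>v\<close> in the form domain.\<close>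

definition neumann_operator ::
    "'a::euclidean_space set \<Rightarrow> ('a \<Rightarrow> real) \<Rightarrow> (('a \<Rightarrow> complex) \<times> ('a \<Rightarrow> complex)) set" where
  "neumann_operator S \<rho> = {(u, w). u \<in> H1 S \<and> w \<in> L2 S \<and>
     (\<forall>v\<in>H1 S. dirichlet_form S u v = winner S \<rho> w v)}"

text \<open>The lower bound says that \<open>A - z\<close> is injective with bounded inverse.\<close>

definition resolvent_set ::
    "'a::euclidean_space set \<Rightarrow> ('a \<Rightarrow> real) \<Rightarrow> (('a \<Rightarrow> complex) \<times> ('a \<Rightarrow> complex)) set
      \<Rightarrow> complex set" where
  "resolvent_set S \<rho> A = {z.
     (\<forall>f\<in>L2 S. \<exists>(u, w)\<in>A. AE x in lebesgue_on S. w x - z * u x = f x) \<and>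
     (\<exists>C. \<forall>(u, w)\<in>A. wnorm S \<rho> u \<le> C * wnorm S \<rho> (\<lambda>x. w x - z * u x))}"

definition op_spectrum ::
    "'a::euclidean_space set \<Rightarrow> ('a \<Rightarrow> real) \<Rightarrow> (('a \<Rightarrow> complex) \<times> ('a \<Rightarrow> complex)) set
      \<Rightarrow> complex set" where
  "op_spectrum S \<rho> A = - resolvent_set S \<rho> A"

definition eigenspace ::
    "'a::euclidean_space set \<Rightarrow> (('a \<Rightarrow> complex) \<times> ('a \<Rightarrow> complex)) set \<Rightarrow> complex
      \<Rightarrow> ('a \<Rightarrow> complex) set" where
  "eigenspace S A z = {u. \<exists>w. (u, w) \<in> A \<and> (AE x in lebesgue_on S. w x = z * u x)}"

text \<open>Existence of a basis of \<open>m\<close> elements, modulo equality almost everywhere.\<close>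

definition has_dim :: "'a::euclidean_space set \<Rightarrow> ('a \<Rightarrow> complex) set \<Rightarrow> nat \<Rightarrow> bool" where
  "has_dim S V m \<longleftrightarrow> (\<exists>e :: nat \<Rightarrow> 'a \<Rightarrow> complex.
     (\<forall>i<m. e i \<in> V) \<and>
     (\<forall>c. (AE x in lebesgue_on S. (\<Sum>i<m. c i * e i x) = 0) \<longrightarrow> (\<forall>i<m. c i = 0)) \<and>
     (\<forall>u\<in>V. \<exists>c. AE x in lebesgue_on S. u x = (\<Sum>i<m. c i * e i x)))"

text \<open>The spectrum consists of isolated eigenvalues of finite multiplicity.\<close>

definition purely_discrete ::
    "'a::euclidean_space set \<Rightarrow> ('a \<Rightarrow> real) \<Rightarrow> (('a \<Rightarrow> complex) \<times> ('a \<Rightarrow> complex)) set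
      \<Rightarrow> bool" where
  "purely_discrete S \<rho> A \<longleftrightarrow> (\<forall>z\<in>op_spectrum S \<rho> A.
     \<not> z islimpt op_spectrum S \<rho> A \<and> (\<exists>m>0. has_dim S (eigenspace S A z) m))"

text \<open>Ascending enumeration of all eigenvalues, each repeated according to its multiplicity;
  a number that is not an eigenvalue has multiplicity 0.\<close>

definition eigenvalue_sequence ::
    "'a::euclidean_space set \<Rightarrow> (('a \<Rightarrow> complex) \<times> ('a \<Rightarrow> complex)) set
      \<Rightarrow> (nat \<Rightarrow> real) \<Rightarrow> bool" where
  "eigenvalue_sequence S A ev \<longleftrightarrow> mono ev \<and>
     (\<forall>z. finite {k. complex_of_real (ev k) = z} \<and>
          has_dim S (eigenspace S A z) (card {k. complex_of_real (ev k) = z}))"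

definition flat_part :: "((real^'m) \<times> real) set \<Rightarrow> ((real^'m) \<times> real) set" where
  "flat_part \<Omega> = frontier \<Omega> \<inter> {x. snd x = 0}"

definition lattice_point :: "real \<Rightarrow> int^'m \<Rightarrow> real^'m" where
  "lattice_point \<epsilon> i = (\<chi> j. \<epsilon> * of_int (i $ j))"

definition room ::
    "((real^'m) \<times> real) set \<Rightarrow> real \<Rightarrow> real \<Rightarrow> real \<Rightarrow> int^'m \<Rightarrow> ((real^'m) \<times> real) set" where
  "room B b h \<epsilon> i = {x. (1 / b) *\<^sub>R (x - (lattice_point \<epsilon> i, 0) - (0, h)) \<in> B}"

definition passage ::
    "(real^'m) set \<Rightarrow> real \<Rightarrow> real \<Rightarrow> real \<Rightarrow> int^'m \<Rightarrow> ((real^'m) \<times> real) set" where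
  "passage D d h \<epsilon> i =
     {x. (1 / d) *\<^sub>R (fst x - lattice_point \<epsilon> i) \<in> D \<and> 0 \<le> snd x \<and> snd x \<le> h}"

definition indices :: "((real^'m) \<times> real) set \<Rightarrow> real \<Rightarrow> (int^'m) set" where
  "indices \<Omega> \<epsilon> = {i. (lattice_point \<epsilon> i, 0) \<in> flat_part \<Omega> \<and>
     infdist (lattice_point \<epsilon> i, 0) (frontier \<Omega> - flat_part \<Omega>)
       \<ge> \<epsilon> * sqrt (real (CARD('m) + 1)) / 2}"

definition rooms ::
    "((real^'m) \<times> real) set \<Rightarrow> ((real^'m) \<times> real) set \<Rightarrow> real \<Rightarrow> real \<Rightarrow> real
      \<Rightarrow> ((real^'m) \<times> real) set" where
  "rooms \<Omega> B b h \<epsilon> = (\<Union>i\<in>indices \<Omega> \<epsilon>. room B b h \<epsilon> i)"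

definition perturbed_domain ::
    "((real^'m) \<times> real) set \<Rightarrow> ((real^'m) \<times> real) set \<Rightarrow> (real^'m) set
      \<Rightarrow> real \<Rightarrow> real \<Rightarrow> real \<Rightarrow> real \<Rightarrow> ((real^'m) \<times> real) set" where
  "perturbed_domain \<Omega> B D b d h \<epsilon> =
     \<Omega> \<union> (\<Union>i\<in>indices \<Omega> \<epsilon>. passage D d h \<epsilon> i \<union> room B b h \<epsilon> i)"

definition weight ::
    "((real^'m) \<times> real) set \<Rightarrow> ((real^'m) \<times> real) set \<Rightarrow> real \<Rightarrow> real \<Rightarrow> real \<Rightarrow> real
      \<Rightarrow> (real^'m) \<times> real \<Rightarrow> real" where
  "weight \<Omega> B b h \<rho>0 \<epsilon> x = (if x \<in> rooms \<Omega> B b h \<epsilon> then \<rho>0 else 1)"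

definition bold_D :: "nat \<Rightarrow> real \<Rightarrow> real" where
  "bold_D n d = (if n = 2 then \<bar>ln d\<bar> else d powi (2 - int n))"

definition q_eps ::
    "((real^'m) \<times> real) set \<Rightarrow> (real^'m) set \<Rightarrow> real \<Rightarrow> real \<Rightarrow> real \<Rightarrow> real \<Rightarrow> real" where
  "q_eps B D b d h \<rho>0 =
     (d ^ CARD('m) * measure lebesgue D) /
     (h * \<rho>0 * b ^ (CARD('m) + 1) * measure lebesgue B)"

definition r_eps :: "((real^'m) \<times> real) set \<Rightarrow> real \<Rightarrow> real \<Rightarrow> real \<Rightarrow> real" where
  "r_eps B b \<rho>0 \<epsilon> = (\<rho>0 * b ^ (CARD('m) + 1) * measure lebesgue B) / \<epsilon> ^ CARD('m)"

end

theory Submission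
  imports Defs "HOL-Library.Function_Algebras" "HOL-Computational_Algebra.Polynomial"
    "HOL-Real_Asymp.Real_Asymp"
begin

text \<open>The eigenvalues are bounded from above by the variational principle. For each index \<open>i\<close> take the
  trial function that is \<open>1\<close> in the room \<open>i\<close>, decays linearly to \<open>0\<close> along its passage and vanishes
  elsewhere. Its Rayleigh quotient is at most the energy \<open>d\<^sup>n\<^sup>-\<^sup>1 |D| / h\<close> in the passage divided by the mass
  \<open>\<rho>0 b\<^sup>n |B|\<close> of the room, which is \<open>q_eps\<close>. Trial functions of different indices have disjoint
  supports, so the bound holds on their span, and near an interior point of the flat part of the
  boundary, which is a Lipschitz graph, the number of indices tends to infinity.

  The variational principle is proved without the spectral theorem. Let \<open>\<mu>\<close> be the infimum of the
  Rayleigh quotient over the orthogonal complement of all eigenvectors with eigenvalues at most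
  \<open>\<delta>\<close>, and assume \<open>\<mu> < \<delta>\<close>. If \<open>\<mu>\<close> is in the resolvent set, then the Cauchy-Schwarz inequality for
  the form shifted by \<open>\<mu>\<close> shows that the infimum is larger than \<open>\<mu>\<close>. Otherwise \<open>\<mu>\<close> is isolated in
  the spectrum and the gap around it leads to the same contradiction.\<close>

section \<open>Operators associated with a form\<close>

text \<open>Discreteness gives isolated spectral points and finite-dimensional eigenspaces, but no
  expansion in eigenvectors, so the lower bound on the complement of the low eigenvectors is where
  the work lies. At a bottom \<open>\<mu>\<close> in the spectrum \<open>A - \<mu>\<close> cannot be
  inverted. The way out is to square: with the centre of the gap above \<open>\<mu>\<close>
  subtracted, positivity of the square follows from resolvents on either side of the centre, and the
  size of the gap becomes a lower bound for the form of \<open>A - \<mu>\<close> on its range.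
  Elements of \<open>L2\<close> are functions, not classes. Hence forms are only semidefinite, the
  operator is a linear relation, and vectors are compared up to null vectors. Complex spaces are
  treated as real ones with the real parts of their forms, which keep norms, energies and Rayleigh
  quotients. The bound \<open>q_eps\<close> does not depend on the number of trial functions:
  \<open>k\<close> only decides how small \<open>\<epsilon>\<close> must be. Nonnegativity of the
  form supplies the lower bound 0 for the final squeeze.\<close>

locale psd_form =
  fixes W :: "'v::real_vector set" and f :: "'v \<Rightarrow> 'v \<Rightarrow> real"
  assumes subspace: "subspace W"
    and sym: "\<lbrakk>u \<in> W; v \<in> W\<rbrakk> \<Longrightarrow> f u v = f v u"
    and add_left: "\<lbrakk>u \<in> W; v \<in> W; w \<in> W\<rbrakk> \<Longrightarrow> f (u + v) w = f u w + f v w"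
    and scale_left: "\<lbrakk>u \<in> W; w \<in> W\<rbrakk> \<Longrightarrow> f (c *\<^sub>R u) w = c * f u w"
    and nonneg: "u \<in> W \<Longrightarrow> 0 \<le> f u u"
begin

lemma mem [simp]:
  "0 \<in> W" "\<lbrakk>u \<in> W; v \<in> W\<rbrakk> \<Longrightarrow> u + v \<in> W" "\<lbrakk>u \<in> W; v \<in> W\<rbrakk> \<Longrightarrow> u - v \<in> W"
  "u \<in> W \<Longrightarrow> c *\<^sub>R u \<in> W" "u \<in> W \<Longrightarrow> - u \<in> W"
  using subspace by (auto simp: subspace_0 subspace_add subspace_diff subspace_scale subspace_neg)

lemma minus_left: "\<lbrakk>u \<in> W; w \<in> W\<rbrakk> \<Longrightarrow> f (- u) w = - f u w"
  using scale_left[of u w "-1"] by simp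

lemma diff_left: "\<lbrakk>u \<in> W; v \<in> W; w \<in> W\<rbrakk> \<Longrightarrow> f (u - v) w = f u w - f v w"
  using add_left[of u "- v" w] by (simp add: minus_left)

lemma add_right: "\<lbrakk>u \<in> W; v \<in> W; w \<in> W\<rbrakk> \<Longrightarrow> f w (u + v) = f w u + f w v"
  by (simp add: sym[of w] add_left)

lemma diff_right: "\<lbrakk>u \<in> W; v \<in> W; w \<in> W\<rbrakk> \<Longrightarrow> f w (u - v) = f w u - f w v"
  by (simp add: sym[of w] diff_left)

lemma scale_right: "\<lbrakk>u \<in> W; w \<in> W\<rbrakk> \<Longrightarrow> f w (c *\<^sub>R u) = c * f w u"
  by (simp add: sym[of w] scale_left)

lemmas expand = add_left add_right diff_left diff_right scale_left scale_right

text \<open>Positivity of \<open>f\<close> along the line \<open>u + t *\<^sub>R v\<close>. In the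
  degenerate case \<open>f v v = 0\<close> an affine function of \<open>t\<close> stays nonnegative,
  so its slope vanishes.\<close>

lemma Cauchy_Schwarz:
  assumes "u \<in> W" "v \<in> W"
  shows "(f u v)\<^sup>2 \<le> f u u * f v v"
proof -
  have *: "0 \<le> f u u + 2 * t * f u v + t\<^sup>2 * f v v" for t
    using nonneg[of "u + t *\<^sub>R v"] assms
    by (simp add: expand sym[of v u] power2_eq_square algebra_simps)
  show ?thesis
  proof (cases "f v v = 0")
    case True
    have "f u v = 0"
    proof (rule ccontr)
      assume n: "f u v \<noteq> 0"
      \<comment> \<open>At the chosen \<open>t\<close> the affine function takes the value
        -1.\<close>
      show False
        using *[of "- (f u u + 1) / (2 * f u v)"] n True by (simp add: field_simps)
    qed
    then show ?thesis using True by simp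
  next
    case False
    then have p: "f v v > 0" using nonneg[OF assms(2)] by simp
    show ?thesis
      using *[of "- f u v / f v v"] p by (simp add: field_simps power2_eq_square)
  qed
qed

lemma null_left:
  assumes "u \<in> W" "v \<in> W" "f u u = 0"
  shows "f u v = 0"
  using Cauchy_Schwarz[OF assms(1,2)] assms(3) by simp

abbreviation nrm :: "'v \<Rightarrow> real" where "nrm u \<equiv> sqrt (f u u)"

lemma nrm_sq: "u \<in> W \<Longrightarrow> (nrm u)\<^sup>2 = f u u"
  by (simp add: nonneg)

lemma abs_le: "\<lbrakk>u \<in> W; v \<in> W\<rbrakk> \<Longrightarrow> \<bar>f u v\<bar> \<le> nrm u * nrm v"
  using Cauchy_Schwarz[of u v]
  by (metis real_sqrt_abs real_sqrt_le_mono real_sqrt_mult)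

lemma nrm_triangle:
  assumes "u \<in> W" "v \<in> W" shows "nrm (u + v) \<le> nrm u + nrm v"
proof (rule real_le_lsqrt)
  have "f (u + v) (u + v) = f u u + 2 * f u v + f v v"
    using assms by (simp add: expand sym[of v u])
  also have "\<dots> \<le> (nrm u)\<^sup>2 + 2 * (nrm u * nrm v) + (nrm v)\<^sup>2"
    using abs_le[OF assms] nrm_sq[OF assms(1)] nrm_sq[OF assms(2)] by linarith
  finally show "f (u + v) (u + v) \<le> (nrm u + nrm v)\<^sup>2"
    by (simp add: power2_sum)
qed (use assms in \<open>simp add: nonneg\<close>)

lemma nrm_scale: "u \<in> W \<Longrightarrow> nrm (c *\<^sub>R u) = \<bar>c\<bar> * nrm u"
  by (simp add: expand real_sqrt_mult power2_eq_square[symmetric] mult.assoc[symmetric])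

lemma nrm_triangle_diff:
  assumes "u \<in> W" "v \<in> W" shows "nrm (u - v) \<le> nrm u + nrm v"
  using nrm_triangle[of u "(-1) *\<^sub>R v"] nrm_scale[of v "-1"] assms by simp

end

text \<open>If \<open>N v\<close> is represented as \<open>G x v\<close> by some \<open>x\<close> of
  energy at most \<open>C * N v\<close>, Cauchy-Schwarz for \<open>G\<close> bounds the square of
  \<open>N v\<close> by \<open>C * N v * G v v\<close>, and one factor \<open>N v\<close> cancels.
  Solvability of an equation thus turns into coercivity.\<close>

lemma coercive_if_solvable:
  assumes "psd_form W G" and N: "\<And>v. v \<in> W \<Longrightarrow> 0 \<le> N v"
    and C: "0 \<le> C"
    and sol: "\<And>v. v \<in> W \<Longrightarrow> \<exists>x\<in>W. G x v = N v \<and> G x x \<le> C * N v"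
    and v: "v \<in> W"
  shows "N v \<le> C * G v v"
proof -
  interpret psd_form W G by fact
  obtain x where x: "x \<in> W" "G x v = N v" "G x x \<le> C * N v" using sol[OF v] by auto
  have "N v * N v \<le> G x x * G v v"
    using Cauchy_Schwarz[OF x(1) v] x(2) by (simp add: power2_eq_square)
  also have "\<dots> \<le> C * N v * G v v"
    using x(3) nonneg[OF v] by (simp add: mult_right_mono)
  finally have *: "N v * N v \<le> N v * (C * G v v)" by (simp add: mult_ac)
  show ?thesis
  proof (cases "N v = 0")
    case True
    then show ?thesis using C nonneg[OF v] by simp
  next
    case False
    then have "N v > 0" using N[OF v] by simp
    then show ?thesis using * by simp
  qed
qed

text \<open>Apply \<open>step\<close> to the infimum \<open>\<kappa>\<close> of the quotients
  \<open>F / N\<close>: coercivity of \<open>F - \<kappa> * N\<close> with a positive constant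
  \<open>C\<close> raises the lower bound of all quotients to \<open>\<kappa> + 1 / C\<close>, which
  is impossible for an infimum. The statement involves no linear structure, so it applies both to a
  form on a subspace and to the graph of an operator.\<close>

lemma bottom_not_attained:
  fixes F N :: "'v \<Rightarrow> real"
  assumes F: "\<And>v. v \<in> W \<Longrightarrow> 0 \<le> F v" and N: "\<And>v. v \<in> W \<Longrightarrow> 0 \<le> N v"
    and step: "\<And>\<kappa>. \<lbrakk>0 \<le> \<kappa>; \<kappa> < \<kappa>0; \<forall>v\<in>W. \<kappa> * N v \<le> F v\<rbrakk>
      \<Longrightarrow> \<exists>C. \<forall>v\<in>W. N v \<le> C * (F v - \<kappa> * N v)"
    and v: "v \<in> W"
  shows "\<kappa>0 * N v \<le> F v"
proof (rule ccontr)
  assume "\<not> \<kappa>0 * N v \<le> F v"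
  then have lt: "F v < \<kappa>0 * N v" by simp
  then have Nv: "N v > 0" using F[OF v] N[OF v] by (cases "N v = 0") auto
  define X where "X = {F w / N w |w. w \<in> W \<and> N w > 0}"
  have X: "F v / N v \<in> X" using Nv v by (auto simp: X_def)
  have X0: "\<And>x. x \<in> X \<Longrightarrow> 0 \<le> x" using F by (auto simp: X_def)
  then have bdd: "bdd_below X" by (auto simp: bdd_below_def)
  define \<kappa> where "\<kappa> = Inf X"
  have "\<kappa> \<le> F v / N v" unfolding \<kappa>_def using X bdd by (rule cInf_lower)
  also have "\<dots> < \<kappa>0" using lt Nv by (simp add: field_simps)
  finally have k: "\<kappa> < \<kappa>0" .
  have k0: "0 \<le> \<kappa>" unfolding \<kappa>_def using X X0 by (intro cInf_greatest) auto
  have le: "\<kappa> * N w \<le> F w" if w: "w \<in> W" for w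
  proof (cases "N w > 0")
    case True
    then have "\<kappa> \<le> F w / N w" unfolding \<kappa>_def using w bdd by (intro cInf_lower) (auto simp: X_def)
    then show ?thesis using True by (simp add: field_simps)
  next
    case False
    then have "N w = 0" using N[OF w] by simp
    then show ?thesis using F[OF w] by simp
  qed
  then obtain C where C: "\<And>w. w \<in> W \<Longrightarrow> N w \<le> C * (F w - \<kappa> * N w)" using step k k0 by blast
  \<comment> \<open>The maximum makes the constant positive, so that it can be divided by; the bound
    survives because \<open>F w - \<kappa> * N w\<close> is nonnegative.\<close>
  define C' where "C' = max C 1"
  have C': "C' > 0" "C \<le> C'" by (auto simp: C'_def)
  have "\<kappa> + 1 / C' \<le> x" if x: "x \<in> X" for x
  proof -
    obtain w where w: "w \<in> W" "N w > 0" "x = F w / N w" using x by (auto simp: X_def)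
    have "N w \<le> C' * (F w - \<kappa> * N w)"
      using C[OF w(1)] le[OF w(1)] C'(2) by (meson diff_ge_0_iff_ge mult_right_mono order_trans)
    moreover have "F w = x * N w" using w by simp
    ultimately have "N w * (1 + C' * \<kappa>) \<le> N w * (C' * x)" by (simp add: algebra_simps)
    then have "1 + C' * \<kappa> \<le> C' * x" using w(2) by simp
    then show ?thesis using C'(1) by (simp add: field_simps)
  qed
  then have "\<kappa> + 1 / C' \<le> \<kappa>" unfolding \<kappa>_def using X by (intro cInf_greatest) auto
  then show False using C' by simp
qed


text \<open>\<open>A\<close> is a graph whose images are determined only up to null vectors;
  \<open>A_null\<close> says that such changes stay in \<open>A\<close>. Completeness is asked only
  of sequences whose increments have norms of order \<open>2 ^ (- n)\<close>, which is what the
  geometric choice of parameters below produces.\<close>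

locale form_operator = H: psd_form H ip + V: psd_form V \<eta>
  for H V :: "'v::real_vector set" and ip \<eta> :: "'v \<Rightarrow> 'v \<Rightarrow> real" +
  fixes A :: "('v \<times> 'v) set"
  assumes V_sub: "V \<subseteq> H"
    and A_sub: "subspace A"
    and A_dom: "(u, w) \<in> A \<Longrightarrow> u \<in> V"
    and A_ran: "(u, w) \<in> A \<Longrightarrow> w \<in> H"
    and A_form: "\<lbrakk>(u, w) \<in> A; v \<in> V\<rbrakk> \<Longrightarrow> \<eta> u v = ip w v"
    and A_null: "\<lbrakk>(u, w) \<in> A; w' \<in> H; ip (w' - w) (w' - w) = 0\<rbrakk> \<Longrightarrow> (u, w') \<in> A"
    and complete: "\<lbrakk>\<And>n. f n \<in> H; \<And>n. ip (f (Suc n) - f n) (f (Suc n) - f n) \<le> C / 4 ^ n\<rbrakk>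
      \<Longrightarrow> \<exists>g\<in>H. (\<lambda>n. ip (f n - g) (f n - g)) \<longlonglongrightarrow> 0"
begin

lemma V_H [simp]: "u \<in> V \<Longrightarrow> u \<in> H" using V_sub by auto
lemma A_dom_H [simp]: "(u, w) \<in> A \<Longrightarrow> u \<in> H" using A_dom by auto

lemma A_symmetric: "\<lbrakk>(u, w) \<in> A; (v, y) \<in> A\<rbrakk> \<Longrightarrow> ip w v = ip y u"
  using A_form[of u w v] A_form[of v y u] A_dom V.sym by metis

text \<open>Only real points occur. The equation holds exactly, not up to a null vector, so that
  solutions can be combined inside \<open>A\<close> by linearity.\<close>

definition resolvent :: "real set" where
  "resolvent = {z. (\<forall>f\<in>H. \<exists>u. (u, z *\<^sub>R u + f) \<in> A) \<and>
     (\<exists>C. \<forall>u w. (u, w) \<in> A \<longrightarrow> H.nrm u \<le> C * H.nrm (w - z *\<^sub>R u))}"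

lemma resolvent_solve:
  assumes "z \<in> resolvent"
  obtains C where "C \<ge> 0"
    "\<And>f. f \<in> H \<Longrightarrow> \<exists>u. (u, z *\<^sub>R u + f) \<in> A \<and> H.nrm u \<le> C * H.nrm f"
    "\<And>u w. (u, w) \<in> A \<Longrightarrow> H.nrm u \<le> C * H.nrm (w - z *\<^sub>R u)"
proof -
  obtain C where C: "\<And>u w. (u, w) \<in> A \<Longrightarrow> H.nrm u \<le> C * H.nrm (w - z *\<^sub>R u)"
    using assms by (auto simp: resolvent_def)
  have C': "H.nrm u \<le> max C 0 * H.nrm (w - z *\<^sub>R u)" if "(u, w) \<in> A" for u w
  proof -
    have "w - z *\<^sub>R u \<in> H" using that A_ran by simp
    then have "C * H.nrm (w - z *\<^sub>R u) \<le> max C 0 * H.nrm (w - z *\<^sub>R u)"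
      by (intro mult_right_mono) (auto simp: H.nonneg)
    then show ?thesis using C[OF that] by linarith
  qed
  show ?thesis
  proof (rule that[of "max C 0"])
    fix f assume "f \<in> H"
    then obtain u where u: "(u, z *\<^sub>R u + f) \<in> A" using assms by (auto simp: resolvent_def)
    show "\<exists>u. (u, z *\<^sub>R u + f) \<in> A \<and> H.nrm u \<le> max C 0 * H.nrm f"
      using u C'[OF u] by auto
  qed (use C' in auto)
qed

text \<open>With \<open>T = A - (\<mu> + s)\<close>, the operator \<open>T\<^sup>2 - \<kappa>\<close> factors into the two invertible operators
  \<open>T - sqrt \<kappa>\<close> and \<open>T + sqrt \<kappa>\<close> as long as \<open>sqrt \<kappa> < s\<close>.\<close>

lemma resolvent_gap:
  assumes s: "s > 0" and res: "{\<mu><..<\<mu> + 2 * s} \<subseteq> resolvent" and vw: "(v, w) \<in> A"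
  shows "s\<^sup>2 * ip v v \<le> ip (w - (\<mu> + s) *\<^sub>R v) (w - (\<mu> + s) *\<^sub>R v)"
proof -
  \<comment> \<open>The centre of the gap, at distance \<open>s\<close> from both ends.\<close>
  define m where "m = \<mu> + s"
  define T where "T p = snd p - m *\<^sub>R fst p" for p :: "'v \<times> 'v"
  have fH: "p \<in> A \<Longrightarrow> fst p \<in> H" for p using A_dom[of "fst p" "snd p"] by simp
  have sH: "p \<in> A \<Longrightarrow> snd p \<in> H" for p using A_ran[of "fst p" "snd p"] by simp
  have TH: "p \<in> A \<Longrightarrow> T p \<in> H" for p by (simp add: T_def fH sH)
  have T_add: "T (p + q) = T p + T q" and T_scale: "T (c *\<^sub>R p) = c *\<^sub>R T p" for p q c
    by (auto simp: T_def algebra_simps)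
  have "s\<^sup>2 * ip (fst (v, w)) (fst (v, w)) \<le> ip (T (v, w)) (T (v, w))"
  \<comment> \<open>The vectors are the pairs in \<open>A\<close>: on them both \<open>fst\<close>
    and \<open>T\<close> are linear maps, although an element of the domain does not determine its
    image.\<close>
  proof (rule bottom_not_attained[where W = A and N = "\<lambda>p. ip (fst p) (fst p)" and F = "\<lambda>p. ip (T p) (T p)"])
    fix \<kappa> assume k: "0 \<le> \<kappa>" "\<kappa> < s\<^sup>2" "\<forall>p\<in>A. \<kappa> * ip (fst p) (fst p) \<le> ip (T p) (T p)"
    define \<beta> where "\<beta> = sqrt \<kappa>"
    have b: "0 \<le> \<beta>" "\<beta> < s" "\<kappa> = \<beta>\<^sup>2"
      using k s by (auto simp: \<beta>_def real_less_lsqrt)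
    have r: "m + \<beta> \<in> resolvent" "m - \<beta> \<in> resolvent"
      using b s by (auto intro!: subsetD[OF res] simp: m_def)
    obtain C1 where C1: "C1 \<ge> 0"
      "\<And>f. f \<in> H \<Longrightarrow> \<exists>u. (u, (m + \<beta>) *\<^sub>R u + f) \<in> A \<and> H.nrm u \<le> C1 * H.nrm f"
      using resolvent_solve[OF r(1)] by metis
    obtain C2 where C2: "C2 \<ge> 0"
      "\<And>f. f \<in> H \<Longrightarrow> \<exists>u. (u, (m - \<beta>) *\<^sub>R u + f) \<in> A \<and> H.nrm u \<le> C2 * H.nrm f"
      using resolvent_solve[OF r(2)] by metis
    define G where "G p q = ip (T p) (T q) - \<kappa> * ip (fst p) (fst q)" for p q
    have G: "psd_form A G"
    proof
      show "G p q = G q p" if "p \<in> A" "q \<in> A" for p q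
        using that by (simp add: G_def H.sym[of "T p"] H.sym[of "fst p"] TH fH)
      show "G (p + q) r = G p r + G q r" if "p \<in> A" "q \<in> A" "r \<in> A" for p q r
        using that by (simp add: G_def T_add H.add_left TH fH algebra_simps)
      show "G (c *\<^sub>R p) r = c * G p r" if "p \<in> A" "r \<in> A" for c p r
        using that by (simp add: G_def T_scale H.scale_left TH fH algebra_simps)
    qed (use A_sub k(3) in \<open>auto simp: G_def\<close>)
    have "ip (fst p) (fst p) \<le> (C1 * C2) * G p p" if p: "p \<in> A" for p
    proof (rule coercive_if_solvable[where W = A and N = "\<lambda>p. ip (fst p) (fst p)", OF G])
      fix p assume p: "p \<in> A"
      define v where "v = fst p"
      have v: "v \<in> H" using fH[OF p] by (simp add: v_def)
      \<comment> \<open>Here \<open>(T - \<beta>) y = v\<close> and then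
        \<open>(T + \<beta>) x = y\<close>, so \<open>(T\<^sup>2 - \<kappa>) x = v\<close>. By
        symmetry of \<open>A\<close> the pair of \<open>x\<close> represents the functional
        \<open>ip v (fst q)\<close> with respect to \<open>G\<close>.\<close>
      obtain y where y: "(y, (m + \<beta>) *\<^sub>R y + v) \<in> A" "H.nrm y \<le> C1 * H.nrm v"
        using C1(2)[OF v] by auto
      have yH: "y \<in> H" using y(1) by simp
      obtain x where x: "(x, (m - \<beta>) *\<^sub>R x + y) \<in> A" "H.nrm x \<le> C2 * H.nrm y"
        using C2(2)[OF yH] by auto
      have xH: "x \<in> H" using x(1) by simp
      have G': "G (x, (m - \<beta>) *\<^sub>R x + y) q = ip v (fst q)" if q: "q \<in> A" for q
      proof -
        obtain u z where qq: "q = (u, z)" by force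
        have uH: "u \<in> H" "z \<in> H" using fH[OF q] sH[OF q] qq by auto
        have 1: "ip z y = ip ((m + \<beta>) *\<^sub>R y + v) u" using A_symmetric[OF q[unfolded qq] y(1)] .
        have 2: "ip z x = ip ((m - \<beta>) *\<^sub>R x + y) u" using A_symmetric[OF q[unfolded qq] x(1)] .
        have "G (x, (m - \<beta>) *\<^sub>R x + y) q
            = ip (y - \<beta> *\<^sub>R x) (z - m *\<^sub>R u) - \<beta>\<^sup>2 * ip x u"
          by (simp add: G_def T_def qq b(3) algebra_simps)
        also have "\<dots> = ip v u"
        proof -
          have e: "ip z y = (m + \<beta>) * ip y u + ip v u" "ip z x = (m - \<beta>) * ip x u + ip y u"
            using 1 2 uH xH yH v by (simp_all add: H.expand)
          have "ip (y - \<beta> *\<^sub>R x) (z - m *\<^sub>R u)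
              = ip z y - m * ip y u - \<beta> * ip z x + \<beta> * m * ip x u"
            using uH xH yH by (simp add: H.expand H.sym[of _ z] algebra_simps)
          then show ?thesis unfolding e by (simp add: power2_eq_square algebra_simps)
        qed
        finally show ?thesis by (simp add: qq)
      qed
      have "G (x, (m - \<beta>) *\<^sub>R x + y) (x, (m - \<beta>) *\<^sub>R x + y) = ip v x" using G'[OF x(1)] by simp
      also have "\<dots> \<le> H.nrm v * H.nrm x" using H.abs_le[OF v xH] by linarith
      also have "\<dots> \<le> H.nrm v * (C2 * (C1 * H.nrm v))"
        using x(2) y(2) C2(1) v by (intro mult_left_mono order_trans[OF x(2)]) (auto simp: H.nonneg)
      also have "\<dots> = C1 * C2 * (H.nrm v)\<^sup>2" by (simp add: power2_eq_square)
      also have "\<dots> = C1 * C2 * ip v v" using H.nrm_sq[OF v] by simp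
      finally show "\<exists>x\<in>A. G x p = ip (fst p) (fst p) \<and> G x x \<le> C1 * C2 * ip (fst p) (fst p)"
        using G'[OF p] x(1) v_def by blast
    qed (use C1 C2 p fH in \<open>auto simp: H.nonneg\<close>)
    then show "\<exists>C. \<forall>p\<in>A. ip (fst p) (fst p) \<le> C * (ip (T p) (T p) - \<kappa> * ip (fst p) (fst p))"
      by (intro exI[of _ "C1 * C2"] ballI) (simp only: G_def)
  qed (use vw fH TH in \<open>auto simp: H.nonneg\<close>)
  then show ?thesis by (simp add: T_def m_def)
qed

section \<open>The orthogonal complement of the low eigenvectors\<close>

definition eigen_orth :: "real \<Rightarrow> 'v set" where
  "eigen_orth \<delta> = {u \<in> H. \<forall>\<nu> e. \<nu> \<le> \<delta> \<longrightarrow> (e, \<nu> *\<^sub>R e) \<in> A \<longrightarrow> ip u e = 0}"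

lemma eigen_orth_subspace: "subspace (eigen_orth \<delta>)"
proof -
  have "ip 0 e = 0" if "e \<in> H" for e using H.scale_left[of 0 e 0] that by simp
  then show ?thesis by (auto simp: subspace_def eigen_orth_def H.expand)
qed

lemma eigen_orth_H: "u \<in> eigen_orth \<delta> \<Longrightarrow> u \<in> H" by (simp add: eigen_orth_def)

text \<open>Testing the equation with an eigenvector \<open>e\<close> for \<open>\<nu>\<close> gives
  \<open>(z - \<nu>) * ip u e = 0\<close>. If \<open>\<nu> = z\<close>, the resolvent bound makes
  \<open>e\<close> a null vector.\<close>

lemma eigen_orth_resolvent:
  assumes z: "z \<in> resolvent" and f: "f \<in> eigen_orth \<delta>" and u: "(u, z *\<^sub>R u + f) \<in> A"
  shows "u \<in> eigen_orth \<delta>"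
  unfolding eigen_orth_def
proof (intro CollectI conjI allI impI)
  show uH: "u \<in> H" using u by simp
  fix \<nu> e assume n: "\<nu> \<le> \<delta>" and e: "(e, \<nu> *\<^sub>R e) \<in> A"
  have eH: "e \<in> H" using e by simp
  have fH: "f \<in> H" "ip f e = 0" using f n e by (auto simp: eigen_orth_def)
  show "ip u e = 0"
  proof (cases "\<nu> = z")
    case True
    obtain C where "\<And>u w. (u, w) \<in> A \<Longrightarrow> H.nrm u \<le> C * H.nrm (w - z *\<^sub>R u)"
      using resolvent_solve[OF z] by metis
    from this[OF e] have "H.nrm e \<le> C * H.nrm 0" using True by simp
    moreover have "ip 0 0 = 0" using H.scale_left[of 0 0 0] by simp
    ultimately have "ip e e = 0" using H.nonneg[OF eH] by simp
    then show ?thesis using H.null_left[OF eH uH] H.sym[OF eH uH] by simp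
  next
    case False
    have "ip (z *\<^sub>R u + f) e = ip (\<nu> *\<^sub>R e) u" by (rule A_symmetric[OF u e])
    then have "(z - \<nu>) * ip u e = 0"
      using eH uH fH by (simp add: H.expand H.sym[of e u] algebra_simps)
    then show ?thesis using False by simp
  qed
qed


text \<open>With \<open>T = A - \<mu>\<close>, the vectors \<open>v n = \<tau> n (T + \<tau> n)\<inverse> u\<close> converge to the projection of \<open>u\<close> onto
  the kernel of \<open>T\<close>; it vanishes by orthogonality. Thus \<open>u\<close> is the limit of the vectors \<open>u - v n\<close> in
  the range of \<open>T\<close>, where the gap of the spectrum gives the lower bound.\<close>

lemma isolated_bottom_coercive:
  assumes t: "t > 0" "\<And>z. \<lbrakk>z \<noteq> \<mu>; \<bar>z - \<mu>\<bar> < t\<rbrakk> \<Longrightarrow> z \<in> resolvent"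
    and mu: "\<mu> \<le> \<delta>" and pos: "\<And>v. v \<in> V \<inter> eigen_orth \<delta> \<Longrightarrow> \<mu> * ip v v \<le> \<eta> v v"
    and u: "u \<in> V \<inter> eigen_orth \<delta>"
  shows "t / 2 * ip u u \<le> \<eta> u u - \<mu> * ip u u"
proof -
  define K where "K = V \<inter> eigen_orth \<delta>"
  \<comment> \<open>The form of \<open>A - \<mu>\<close>; the hypothesis \<open>pos\<close> makes it
    semidefinite on \<open>K\<close>, so that its own Cauchy-Schwarz inequality is
    available.\<close>
  define a where "a v w = \<eta> v w - \<mu> * ip v w" for v w
  have K_sub: "subspace K"
    unfolding K_def by (intro subspace_inter V.subspace eigen_orth_subspace)
  have KV: "v \<in> K \<Longrightarrow> v \<in> V" and KO: "v \<in> K \<Longrightarrow> v \<in> eigen_orth \<delta>" for v by (auto simp: K_def)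
  have KH: "v \<in> K \<Longrightarrow> v \<in> H" for v using KV by simp
  interpret K: psd_form K a
  proof
    show "a v w = a w v" if "v \<in> K" "w \<in> K" for v w
      using that by (simp add: a_def V.sym[of v] H.sym[of v] KV KH)
    show "a (v + w) x = a v x + a w x" if "v \<in> K" "w \<in> K" "x \<in> K" for v w x
      using that by (simp add: a_def V.add_left H.add_left KV KH algebra_simps)
    show "a (c *\<^sub>R v) x = c * a v x" if "v \<in> K" "x \<in> K" for c v x
      using that by (simp add: a_def V.scale_left H.scale_left KV KH algebra_simps)
    show "0 \<le> a v v" if "v \<in> K" for v using pos[of v] that by (simp add: a_def K_def)
  qed (fact K_sub)
  \<comment> \<open>Now \<open>2 * s = t / 2\<close>, and the gap of this length above
    \<open>\<mu>\<close> lies in the punctured neighbourhood of resolvent points.\<close>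
  define s where "s = t / 4"
  have s: "s > 0" using t by (simp add: s_def)
  have a_A: "a v x = ip (w - \<mu> *\<^sub>R v) x" if "(v, w) \<in> A" "x \<in> V" for v w x
    using that by (simp add: a_def A_form A_ran H.expand)
  \<comment> \<open>Expand the inequality for the centre \<open>\<mu> + s\<close>: the terms
    \<open>s\<^sup>2 * ip v v\<close> cancel and \<open>2 * s * ip y v\<close> remains, where
    \<open>ip y v = a v v\<close>.\<close>
  have gap: "2 * s * a v v \<le> ip (w - \<mu> *\<^sub>R v) (w - \<mu> *\<^sub>R v)" if vw: "(v, w) \<in> A" for v w
  proof -
    define y where "y = w - \<mu> *\<^sub>R v"
    have H: "v \<in> H" "w \<in> H" "v \<in> V" using vw A_ran A_dom by auto
    have yH: "y \<in> H" using H by (simp add: y_def)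
    have "s\<^sup>2 * ip v v \<le> ip (w - (\<mu> + s) *\<^sub>R v) (w - (\<mu> + s) *\<^sub>R v)"
      by (rule resolvent_gap[OF s _ vw]) (use t in \<open>auto simp: s_def\<close>)
    also have "w - (\<mu> + s) *\<^sub>R v = y - s *\<^sub>R v" by (simp add: y_def algebra_simps)
    also have "ip (y - s *\<^sub>R v) (y - s *\<^sub>R v) = ip y y - 2 * s * ip y v + s\<^sup>2 * ip v v"
      using yH H by (simp add: H.expand H.sym[of v y] power2_eq_square algebra_simps)
    finally show ?thesis using a_A[OF vw H(3)] by (simp add: y_def)
  qed
  \<comment> \<open>Cauchy-Schwarz for \<open>a\<close> bounds the square of
    \<open>ip y y = a v y\<close>, and \<open>gap\<close> bounds the factor \<open>a v v\<close> by
    \<open>ip y y / (2 * s)\<close>.\<close>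
  have range_gap: "2 * s * ip y y \<le> a y y"
    if vw: "(v, w) \<in> A" "v \<in> K" and y: "y = w - \<mu> *\<^sub>R v" "y \<in> K" for v w y
  proof -
    have n: "0 \<le> ip y y" "0 \<le> a y y" using y(2) by (auto simp: H.nonneg KH K.nonneg)
    have "(ip y y)\<^sup>2 = (a v y)\<^sup>2" using a_A[OF vw(1) KV[OF y(2)]] y(1) by simp
    also have "\<dots> \<le> a v v * a y y" by (rule K.Cauchy_Schwarz[OF vw(2) y(2)])
    finally have "2 * s * (ip y y)\<^sup>2 \<le> 2 * s * a v v * a y y" using s by (simp add: mult.assoc)
    also have "\<dots> \<le> ip y y * a y y"
      using gap[OF vw(1)] y(1) n by (intro mult_right_mono) auto
    finally have *: "ip y y * (2 * s * ip y y) \<le> ip y y * a y y" by (simp add: power2_eq_square mult_ac)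
    show ?thesis using * n by (cases "ip y y = 0") auto
  qed
  have uK: "u \<in> K" using u by (simp add: K_def)
  have uH: "u \<in> H" using KH[OF uK] .
  \<comment> \<open>\<open>Suc n\<close> keeps \<open>\<tau> n\<close> strictly below
    \<open>t\<close>, so every \<open>\<mu> - \<tau> n\<close> is a resolvent point; the halving
    yields the geometric increments asked for by \<open>complete\<close>.\<close>
  define \<tau> where "\<tau> n = t / 2 ^ Suc n" for n :: nat
  have tau: "\<tau> n > 0" "\<tau> n < t" for n
  proof -
    have "(1::real) < 2 ^ Suc n" by (rule one_less_power) auto
    then show "\<tau> n > 0" "\<tau> n < t" using t(1) by (auto simp: \<tau>_def divide_less_eq mult_less_cancel_left1)
  qed
  have "\<exists>v. (v, (\<mu> - \<tau> n) *\<^sub>R v + \<tau> n *\<^sub>R u) \<in> A \<and> v \<in> K" for n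
  proof -
    have r: "\<mu> - \<tau> n \<in> resolvent" using tau[of n] by (intro t(2)) auto
    have f: "\<tau> n *\<^sub>R u \<in> eigen_orth \<delta>"
      using KO[OF uK] eigen_orth_subspace subspace_scale by blast
    obtain v where v: "(v, (\<mu> - \<tau> n) *\<^sub>R v + \<tau> n *\<^sub>R u) \<in> A"
      using r eigen_orth_H[OF f] by (auto simp: resolvent_def)
    then show ?thesis using eigen_orth_resolvent[OF r f v] A_dom[OF v] by (auto simp: K_def)
  qed
  then obtain v where vA: "\<And>n. (v n, (\<mu> - \<tau> n) *\<^sub>R v n + \<tau> n *\<^sub>R u) \<in> A" and vK: "\<And>n. v n \<in> K"
    by metis
  have vH [simp]: "v n \<in> H" for n using KH[OF vK] .
  \<comment> \<open>In terms of \<open>T\<close> this reads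
    \<open>T (v n) = \<tau> n *\<^sub>R (u - v n)\<close>.\<close>
  have B: "(\<mu> - \<tau> n) *\<^sub>R v n + \<tau> n *\<^sub>R u - \<mu> *\<^sub>R v n = \<tau> n *\<^sub>R (u - v n)" for n
    by (simp add: algebra_simps)
  have av: "a (v n) x = \<tau> n * ip (u - v n) x" if "x \<in> V" for n x
    using a_A[OF vA that, of n] that uH by (simp add: B H.scale_left)
  \<comment> \<open>The product with \<open>\<tau> n\<close> is \<open>a (v n) (v n)\<close>, which
    is nonnegative. Hence \<open>u - v n\<close> is no longer than \<open>u\<close>.\<close>
  have ipv: "0 \<le> ip (u - v n) (v n)" for n
    using K.nonneg[OF vK, of n] av[OF KV[OF vK], of n n] tau[of n] by (simp add: zero_le_mult_iff)
  have uv: "ip (u - v n) (u - v n) \<le> ip u u" for n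
    using ipv[of n] H.nonneg[of "v n"] uH H.sym[of "v n" u] by (simp add: H.expand)
  have uv_nrm: "H.nrm (u - v n) \<le> H.nrm u" for n using uv by simp
  define M where "M = H.nrm u"
  have M0: "0 \<le> M" by (simp add: M_def H.nonneg uH)
  have diff: "ip (v m - v n) (v m - v n) \<le> (M * (\<tau> m + \<tau> n) / (2 * s))\<^sup>2" for m n
  proof -
    \<comment> \<open>\<open>T\<close> maps \<open>v n / \<tau> n\<close> to \<open>u - v n\<close>,
      so it maps \<open>x\<close> to \<open>v m - v n\<close>: the differences lie in the range,
      where \<open>range_gap\<close> holds.\<close>
    define x where "x = (1 / \<tau> n) *\<^sub>R v n - (1 / \<tau> m) *\<^sub>R v m"
    define w where "w = (1 / \<tau> n) *\<^sub>R ((\<mu> - \<tau> n) *\<^sub>R v n + \<tau> n *\<^sub>R u)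
        - (1 / \<tau> m) *\<^sub>R ((\<mu> - \<tau> m) *\<^sub>R v m + \<tau> m *\<^sub>R u)"
    have xw: "(x, w) \<in> A"
      using subspace_diff[OF A_sub subspace_scale[OF A_sub vA[of n], of "1 / \<tau> n"]
          subspace_scale[OF A_sub vA[of m], of "1 / \<tau> m"]]
      by (simp add: x_def w_def)
    have xK: "x \<in> K" by (simp add: x_def vK)
    have *: "v m - v n = w - \<mu> *\<^sub>R x"
    proof -
      have e: "(1 / \<tau> k) *\<^sub>R ((\<mu> - \<tau> k) *\<^sub>R v k + \<tau> k *\<^sub>R u) = (\<mu> * (1 / \<tau> k)) *\<^sub>R v k - v k + u" for k
      proof -
        have "(1 / \<tau> k) * (\<mu> - \<tau> k) = \<mu> * (1 / \<tau> k) - 1" using tau[of k] by (simp add: field_simps)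
        then show ?thesis
          using tau[of k] by (simp only: scaleR_add_right scaleR_scaleR) (simp add: scaleR_diff_left)
      qed
      show ?thesis
        unfolding w_def x_def e scaleR_diff_right[of \<mu>] scaleR_scaleR by simp
    qed
    define d where "d = v m - v n"
    have dK: "d \<in> K" by (simp add: d_def vK)
    have dH: "d \<in> H" by (rule KH[OF dK])
    have "2 * s * ip d d \<le> a d d"
      using range_gap[OF xw xK *] dK by (simp add: d_def)
    also have "a d d = a (v m) d - a (v n) d"
      using K.diff_left[OF vK vK dK, of m n] by (simp add: d_def)
    also have "\<dots> = \<tau> m * ip (u - v m) d - \<tau> n * ip (u - v n) d"
      using av[OF KV[OF dK]] by simp
    also have "\<dots> \<le> \<tau> m * (M * H.nrm d) + \<tau> n * (M * H.nrm d)"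
    proof -
      have b: "\<bar>ip (u - v k) d\<bar> \<le> M * H.nrm d" for k
        using H.abs_le[of "u - v k" d] uv_nrm[of k] uH dH H.nonneg[OF dH] unfolding M_def
        by (smt (verit) H.mem(3) mult_right_mono real_sqrt_ge_zero vH)
      have "\<tau> m * ip (u - v m) d \<le> \<tau> m * (M * H.nrm d)"
        using b[of m] tau[of m] by (intro mult_left_mono) auto
      moreover have "- (\<tau> n * ip (u - v n) d) \<le> \<tau> n * (M * H.nrm d)"
        using b[of n] tau[of n] mult_left_mono[of "- ip (u - v n) d" "M * H.nrm d" "\<tau> n"] by auto
      ultimately show ?thesis by linarith
    qed
    finally have "2 * s * (H.nrm d)\<^sup>2 \<le> M * (\<tau> m + \<tau> n) * H.nrm d"
      using H.nrm_sq[OF dH] by (simp add: algebra_simps)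
    then have "H.nrm d * (2 * s * H.nrm d) \<le> H.nrm d * (M * (\<tau> m + \<tau> n))"
      by (simp add: power2_eq_square mult_ac)
    moreover have "0 \<le> H.nrm d" using H.nonneg[OF dH] by simp
    moreover have "0 \<le> M * (\<tau> m + \<tau> n)" using M0 tau[of m] tau[of n] by simp
    ultimately have "2 * s * H.nrm d \<le> M * (\<tau> m + \<tau> n)" by (cases "H.nrm d = 0") auto
    then have "H.nrm d \<le> M * (\<tau> m + \<tau> n) / (2 * s)" using s by (simp add: field_simps)
    then have "(H.nrm d)\<^sup>2 \<le> (M * (\<tau> m + \<tau> n) / (2 * s))\<^sup>2"
      using \<open>0 \<le> H.nrm d\<close> by (rule power_mono)
    then show ?thesis using H.nrm_sq[OF dH] by (simp add: d_def)
  qed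
  have "\<exists>g\<in>H. (\<lambda>n. ip (v n - g) (v n - g)) \<longlonglongrightarrow> 0"
  proof (rule complete)
    fix n
    have "\<tau> (Suc n) + \<tau> n \<le> 2 * t / 2 ^ n" using t(1) by (simp add: \<tau>_def field_simps)
    then have "M * (\<tau> (Suc n) + \<tau> n) / (2 * s) \<le> M * (2 * t / 2 ^ n) / (2 * s)"
      using M0 s by (intro divide_right_mono mult_left_mono) auto
    moreover have "0 \<le> M * (\<tau> (Suc n) + \<tau> n) / (2 * s)" using M0 s tau[of n] tau[of "Suc n"] by simp
    ultimately have "(M * (\<tau> (Suc n) + \<tau> n) / (2 * s))\<^sup>2 \<le> (M * (2 * t / 2 ^ n) / (2 * s))\<^sup>2"
      by (intro power_mono)
    also have "\<dots> = (M * (2 * t) / (2 * s))\<^sup>2 / 4 ^ n"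
      by (simp add: power_divide power_mult_distrib power2_eq_square mult_ac flip: power_mult_distrib)
    finally show "ip (v (Suc n) - v n) (v (Suc n) - v n) \<le> (M * (2 * t) / (2 * s))\<^sup>2 / 4 ^ n"
      using diff[of "Suc n" n] by linarith
  qed simp
  then obtain g where gH: "g \<in> H" and g: "(\<lambda>n. ip (v n - g) (v n - g)) \<longlonglongrightarrow> 0" by auto
  have gn: "(\<lambda>n. H.nrm (v n - g)) \<longlonglongrightarrow> 0" using tendsto_real_sqrt[OF g] by simp
  have tau0: "\<tau> \<longlonglongrightarrow> 0"
  proof -
    have "(\<lambda>n. t / 2 * (1 / 2) ^ n) \<longlonglongrightarrow> t / 2 * 0"
      by (intro tendsto_mult tendsto_const LIMSEQ_power_zero) auto
    then show ?thesis by (simp add: \<tau>_def[abs_def] power_divide)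
  qed
  have ip_lim: "(\<lambda>n. ip (v n) e) \<longlonglongrightarrow> ip g e" if eH: "e \<in> H" for e
  proof (rule Lim_transform_bound[where g = "\<lambda>n. H.nrm (v n - g) * H.nrm e", THEN LIM_zero_cancel])
    show "\<forall>\<^sub>F n in sequentially. norm (ip (v n) e - ip g e) \<le> norm (H.nrm (v n - g) * H.nrm e)"
    proof (rule always_eventually, rule allI)
      fix n
      have "ip (v n) e - ip g e = ip (v n - g) e" using eH gH by (simp add: H.expand)
      then show "norm (ip (v n) e - ip g e) \<le> norm (H.nrm (v n - g) * H.nrm e)"
        using H.abs_le[of "v n - g" e] eH gH by simp
    qed
    show "(\<lambda>n. H.nrm (v n - g) * H.nrm e) \<longlonglongrightarrow> 0"
      using tendsto_mult_right[OF gn, of "H.nrm e"] by simp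
  qed
  text \<open>The limit is an eigenvector for \<open>\<mu>\<close>, because the inverse of \<open>A - z\<close> is bounded.\<close>
  define z where "z = \<mu> - t / 2"
  have "z \<in> resolvent" using t by (auto simp: z_def)
  then obtain C where C: "C \<ge> 0"
    "\<And>f. f \<in> H \<Longrightarrow> \<exists>u. (u, z *\<^sub>R u + f) \<in> A \<and> H.nrm u \<le> C * H.nrm f"
    "\<And>u w. (u, w) \<in> A \<Longrightarrow> H.nrm u \<le> C * H.nrm (w - z *\<^sub>R u)"
    using resolvent_solve by metis
  \<comment> \<open>\<open>(A - z) (v n)\<close> tends to \<open>(\<mu> - z) *\<^sub>R g\<close>, so
    the solution \<open>x\<close> for this limit should agree with \<open>g\<close> up to a null
    vector.\<close>
  obtain x where x: "(x, z *\<^sub>R x + (\<mu> - z) *\<^sub>R g) \<in> A" using C(2)[of "(\<mu> - z) *\<^sub>R g"] gH by auto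
  have xH: "x \<in> H" using x by simp
  have bound: "H.nrm (v n - x) \<le> C * (\<bar>\<mu> - z\<bar> * H.nrm (v n - g) + \<tau> n * M)" for n
  proof -
    have "(v n - x, (\<mu> - \<tau> n) *\<^sub>R v n + \<tau> n *\<^sub>R u - (z *\<^sub>R x + (\<mu> - z) *\<^sub>R g)) \<in> A"
      using subspace_diff[OF A_sub vA[of n] x] by simp
    from C(3)[OF this] have "H.nrm (v n - x)
        \<le> C * H.nrm ((\<mu> - \<tau> n) *\<^sub>R v n + \<tau> n *\<^sub>R u - (z *\<^sub>R x + (\<mu> - z) *\<^sub>R g) - z *\<^sub>R (v n - x))" .
    also have "(\<mu> - \<tau> n) *\<^sub>R v n + \<tau> n *\<^sub>R u - (z *\<^sub>R x + (\<mu> - z) *\<^sub>R g) - z *\<^sub>R (v n - x)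
        = (\<mu> - z) *\<^sub>R (v n - g) + \<tau> n *\<^sub>R (u - v n)" by (simp add: algebra_simps)
    also have "H.nrm \<dots> \<le> \<bar>\<mu> - z\<bar> * H.nrm (v n - g) + \<tau> n * H.nrm (u - v n)"
      using H.nrm_triangle[of "(\<mu> - z) *\<^sub>R (v n - g)" "\<tau> n *\<^sub>R (u - v n)"] gH uH tau[of n]
      by (simp add: H.nrm_scale)
    also have "\<dots> \<le> \<bar>\<mu> - z\<bar> * H.nrm (v n - g) + \<tau> n * M"
      using uv_nrm[of n] tau[of n] by (simp add: M_def)
    finally show ?thesis using C(1) by (simp add: mult_left_mono)
  qed
  have vx: "(\<lambda>n. H.nrm (v n - x)) \<longlonglongrightarrow> 0"
  proof (rule tendsto_sandwich[OF _ _ tendsto_const])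
    show "\<forall>\<^sub>F n in sequentially. H.nrm (v n - x) \<le> C * (\<bar>\<mu> - z\<bar> * H.nrm (v n - g) + \<tau> n * M)"
      using bound by simp
    have "(\<lambda>n. C * (\<bar>\<mu> - z\<bar> * H.nrm (v n - g) + \<tau> n * M)) \<longlonglongrightarrow> C * (\<bar>\<mu> - z\<bar> * 0 + 0 * M)"
      by (intro tendsto_intros gn tau0)
    then show "(\<lambda>n. C * (\<bar>\<mu> - z\<bar> * H.nrm (v n - g) + \<tau> n * M)) \<longlonglongrightarrow> 0" by simp
  qed (use xH in \<open>simp add: H.nonneg\<close>)
  have "H.nrm (x - g) \<le> 0"
  proof (rule tendsto_lowerbound[of "\<lambda>n. H.nrm (v n - g) + H.nrm (v n - x)"])
    show "(\<lambda>n. H.nrm (v n - g) + H.nrm (v n - x)) \<longlonglongrightarrow> 0" using tendsto_add[OF gn vx] by simp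
    show "\<forall>\<^sub>F n in sequentially. H.nrm (x - g) \<le> H.nrm (v n - g) + H.nrm (v n - x)"
      using H.nrm_triangle_diff[of "v n - g" "v n - x" for n] xH gH
      by (intro always_eventually allI) (simp add: algebra_simps)
  qed simp
  then have xg: "ip (x - g) (x - g) = 0" using H.nonneg[of "x - g"] xH gH by simp
  \<comment> \<open>As \<open>x\<close> and \<open>g\<close> differ by a null vector, the image of
    \<open>x\<close> in the graph may be replaced by \<open>\<mu> *\<^sub>R x\<close>.\<close>
  have "(x, \<mu> *\<^sub>R x) \<in> A"
  proof (rule A_null[OF x])
    have "\<mu> *\<^sub>R x - (z *\<^sub>R x + (\<mu> - z) *\<^sub>R g) = (\<mu> - z) *\<^sub>R (x - g)" by (simp add: algebra_simps)
    then show "ip (\<mu> *\<^sub>R x - (z *\<^sub>R x + (\<mu> - z) *\<^sub>R g)) (\<mu> *\<^sub>R x - (z *\<^sub>R x + (\<mu> - z) *\<^sub>R g)) = 0"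
      using xg xH gH by (simp only: H.expand H.mem) simp
  qed (use xH in simp)
  \<comment> \<open>\<open>x\<close> is an eigenvector for \<open>\<mu> \<le> \<delta>\<close>,
    hence orthogonal to all \<open>v n\<close> and to their limit \<open>g\<close>. Since
    \<open>g\<close> agrees with \<open>x\<close> up to a null vector, \<open>g\<close> itself is
    null.\<close>
  then have "ip (v n) x = 0" for n using KO[OF vK, of n] mu by (auto simp: eigen_orth_def)
  then have "ip g x = 0" using ip_lim[OF xH] by (simp add: LIMSEQ_const_iff)
  moreover have "ip (x - g) g = 0" using H.null_left[OF _ gH xg] xH gH by simp
  ultimately have "ip g g = 0" using xH gH by (simp add: H.expand H.sym[of x g])
  \<comment> \<open>Again \<open>u - v n\<close> is the image of \<open>v n / \<tau> n\<close> under
    \<open>T\<close>. The terms subtracted in the expansion are nonnegative, so the bound by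
    \<open>a u u\<close> passes to the limit.\<close>
  have "2 * s * ip (u - v n) (u - v n) \<le> a u u + \<tau> n * ip u u" for n
  proof -
    have y: "u - v n \<in> K" using uK vK by simp
    have "2 * s * ip (u - v n) (u - v n) \<le> a (u - v n) (u - v n)"
    proof (rule range_gap[OF _ _ _ y])
      show "((1 / \<tau> n) *\<^sub>R v n, (1 / \<tau> n) *\<^sub>R ((\<mu> - \<tau> n) *\<^sub>R v n + \<tau> n *\<^sub>R u)) \<in> A"
        using subspace_scale[OF A_sub vA[of n], of "1 / \<tau> n"] by simp
      have "(1 / \<tau> n) * (\<mu> - \<tau> n) = \<mu> * (1 / \<tau> n) - 1" using tau[of n] by (simp add: field_simps)
      then have "(1 / \<tau> n) *\<^sub>R ((\<mu> - \<tau> n) *\<^sub>R v n + \<tau> n *\<^sub>R u) = (\<mu> * (1 / \<tau> n)) *\<^sub>R v n - v n + u"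
        using tau[of n] by (simp only: scaleR_add_right scaleR_scaleR) (simp add: scaleR_diff_left)
      then show "u - v n = (1 / \<tau> n) *\<^sub>R ((\<mu> - \<tau> n) *\<^sub>R v n + \<tau> n *\<^sub>R u) - \<mu> *\<^sub>R (1 / \<tau> n) *\<^sub>R v n"
        unfolding scaleR_scaleR by simp
    qed (simp add: vK)
    also have "a (u - v n) (u - v n) = a u u - a (v n) u - a (v n) (u - v n)"
      using uK vK[of n] by (simp add: K.expand K.sym[of u "v n"])
    also have "\<dots> = a u u - \<tau> n * (ip (u - v n) (u - v n) + ip (u - v n) (v n)) - \<tau> n * ip (u - v n) (u - v n)"
      using av[of u n] av[of "u - v n" n] uK vK[of n] KV uH by (simp add: H.expand)
    also have "\<dots> \<le> a u u + \<tau> n * ip u u"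
    proof -
      have "0 \<le> \<tau> n * (ip (u - v n) (u - v n) + ip (u - v n) (v n))"
        "0 \<le> \<tau> n * ip (u - v n) (u - v n)" "0 \<le> \<tau> n * ip u u"
        using ipv[of n] tau[of n] H.nonneg[of "u - v n"] H.nonneg[of u] uH by auto
      then show ?thesis by linarith
    qed
    finally show ?thesis .
  qed
  moreover have "(\<lambda>n. 2 * s * ip (u - v n) (u - v n)) \<longlonglongrightarrow> 2 * s * ip u u"
  proof -
    have gu: "ip g w = 0" if "w \<in> H" for w using H.null_left[OF gH that \<open>ip g g = 0\<close>] .
    have "ip (u - v n) (u - v n) = ip u u - 2 * ip (v n) u + ip (v n - g) (v n - g)" for n
      using uH gH gu[of "v n"] gu[of g] by (simp add: H.expand H.sym[of u "v n"] H.sym[of "v n" g])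
    moreover have "(\<lambda>n. 2 * s * (ip u u - 2 * ip (v n) u + ip (v n - g) (v n - g)))
        \<longlonglongrightarrow> 2 * s * (ip u u - 2 * ip g u + 0)"
      by (intro tendsto_intros ip_lim g uH)
    ultimately show ?thesis using gu[OF uH] by simp
  qed
  moreover have "(\<lambda>n. a u u + \<tau> n * ip u u) \<longlonglongrightarrow> a u u + 0 * ip u u"
    by (intro tendsto_intros tau0)
  ultimately have "2 * s * ip u u \<le> a u u + 0 * ip u u" by (blast intro: LIMSEQ_le)
  then show ?thesis by (simp add: s_def a_def)
qed

theorem form_ge_on_eigen_orth:
  assumes isolated: "\<And>\<mu>. \<lbrakk>\<mu> < \<delta>; \<mu> \<notin> resolvent\<rbrakk>
      \<Longrightarrow> \<exists>t>0. \<forall>z. z \<noteq> \<mu> \<longrightarrow> \<bar>z - \<mu>\<bar> < t \<longrightarrow> z \<in> resolvent"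
    and u: "u \<in> V \<inter> eigen_orth \<delta>"
  shows "\<delta> * ip u u \<le> \<eta> u u"
proof (rule bottom_not_attained[OF _ _ _ u])
  fix \<mu> assume m: "\<mu> < \<delta>" "\<forall>v\<in>V \<inter> eigen_orth \<delta>. \<mu> * ip v v \<le> \<eta> v v"
  define W where "W = V \<inter> eigen_orth \<delta>"
  show "\<exists>C. \<forall>v\<in>V \<inter> eigen_orth \<delta>. ip v v \<le> C * (\<eta> v v - \<mu> * ip v v)"
  proof (cases "\<mu> \<in> resolvent")
    \<comment> \<open>In the regular case the solution of \<open>(A - \<mu>) x = v\<close> is the
      representer asked for by \<open>coercive_if_solvable\<close>; it stays in \<open>W\<close>
      because the resolvent preserves the complement.\<close>
    case True
    then obtain C where C: "C \<ge> 0"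
      "\<And>f. f \<in> H \<Longrightarrow> \<exists>u. (u, \<mu> *\<^sub>R u + f) \<in> A \<and> H.nrm u \<le> C * H.nrm f"
      using resolvent_solve by metis
    have WV: "v \<in> W \<Longrightarrow> v \<in> V" and WO: "v \<in> W \<Longrightarrow> v \<in> eigen_orth \<delta>" for v by (auto simp: W_def)
    have WH: "v \<in> W \<Longrightarrow> v \<in> H" for v using WV by simp
    define a where "a v w = \<eta> v w - \<mu> * ip v w" for v w
    have a: "psd_form W a"
    proof
      show "subspace W" unfolding W_def by (intro subspace_inter V.subspace eigen_orth_subspace)
      show "a v w = a w v" if "v \<in> W" "w \<in> W" for v w
        using that by (simp add: a_def V.sym[of v] H.sym[of v] WV WH)
      show "a (v + w) x = a v x + a w x" if "v \<in> W" "w \<in> W" "x \<in> W" for v w x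
        using that by (simp add: a_def V.add_left H.add_left WV WH algebra_simps)
      show "a (c *\<^sub>R v) x = c * a v x" if "v \<in> W" "x \<in> W" for c v x
        using that by (simp add: a_def V.scale_left H.scale_left WV WH algebra_simps)
      show "0 \<le> a v v" if "v \<in> W" for v using m(2) that by (simp add: a_def W_def)
    qed
    have "ip v v \<le> C * a v v" if v: "v \<in> W" for v
    proof (rule coercive_if_solvable[OF a _ C(1) _ v])
      fix v assume v: "v \<in> W"
      obtain x where x: "(x, \<mu> *\<^sub>R x + v) \<in> A" "H.nrm x \<le> C * H.nrm v" using C(2)[OF WH[OF v]] by auto
      have xW: "x \<in> W" using eigen_orth_resolvent[OF True WO[OF v] x(1)] A_dom[OF x(1)] by (simp add: W_def)
      have e: "a x w = ip v w" if "w \<in> W" for w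
        using that A_form[OF x(1) WV[OF that]] WH[OF xW] WH[OF v] WH[OF that] by (simp add: a_def H.expand)
      have "a x x \<le> H.nrm v * H.nrm x" using e[OF xW] H.abs_le[OF WH[OF v] WH[OF xW]] by simp
      also have "\<dots> \<le> H.nrm v * (C * H.nrm v)"
        using x(2) by (intro mult_left_mono) (auto simp: H.nonneg WH[OF v])
      also have "\<dots> = C * ip v v" using H.nrm_sq[OF WH[OF v]] by (simp add: power2_eq_square)
      finally show "\<exists>x\<in>W. a x v = ip v v \<and> a x x \<le> C * ip v v" using e[OF v] xW by auto
    qed (simp add: H.nonneg WH)
    then show ?thesis by (auto simp: W_def a_def)
  next
    case False
    then obtain t where t: "t > 0" "\<forall>z. z \<noteq> \<mu> \<longrightarrow> \<bar>z - \<mu>\<bar> < t \<longrightarrow> z \<in> resolvent"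
      using isolated m(1) by metis
    have "ip v v \<le> 2 / t * (\<eta> v v - \<mu> * ip v v)" if "v \<in> V \<inter> eigen_orth \<delta>" for v
      using isolated_bottom_coercive[of t \<mu> \<delta> v] t m that by (simp add: field_simps)
    then show ?thesis by blast
  qed
qed (auto simp: H.nonneg V.nonneg)

end

section \<open>Square-integrable functions\<close>

text \<open>The pointwise real structure lets the abstract locales be applied to function spaces
  and, through the product type, to graphs of operators.\<close>

instantiation "fun" :: (type, real_vector) real_vector
begin

definition scaleR_fun :: "real \<Rightarrow> ('a \<Rightarrow> 'b) \<Rightarrow> 'a \<Rightarrow> 'b" where
  "scaleR_fun c f = (\<lambda>x. c *\<^sub>R f x)"

instance
  by standard (auto simp: scaleR_fun_def fun_eq_iff algebra_simps)

end

lemma scaleR_fun_apply [simp]: "(c *\<^sub>R f) x = c *\<^sub>R f x"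
  by (simp add: scaleR_fun_def)

text \<open>The series of increments is dominated by a geometric series, whose tail from
  \<open>n\<close> on is \<open>c * q ^ n / (1 - q)\<close>.\<close>

lemma telescope_bound:
  fixes a :: "nat \<Rightarrow> 'b::banach"
  assumes a: "\<And>n. norm (a (Suc n) - a n) \<le> c * q ^ n" and q: "0 \<le> q" "q < 1"
  shows "convergent a" "norm (lim a - a n) \<le> c * q ^ n / (1 - q)"
proof -
  have geo: "(\<lambda>k. c * q ^ (k + m)) sums (c * q ^ m / (1 - q))" for m
    using sums_mult[OF geometric_sums[of q], of "c * q ^ m"] q
    by (simp add: power_add mult_ac)
  have summ: "summable (\<lambda>k. norm (a (Suc (k + m)) - a (k + m)))" for m
    by (rule summable_comparison_test'[OF sums_summable[OF geo[of m]], of 0]) (use a[of "_ + m"] in auto)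
  have "(\<lambda>n. \<Sum>k<n. a (Suc k) - a k) \<longlonglongrightarrow> (\<Sum>k. a (Suc k) - a k)"
    using summable_LIMSEQ[OF summable_norm_cancel[OF summ[of 0]]] by simp
  then have "(\<lambda>n. (\<Sum>k<n. a (Suc k) - a k) + a 0) \<longlonglongrightarrow> (\<Sum>k. a (Suc k) - a k) + a 0"
    by (intro tendsto_intros)
  then show conv: "convergent a" by (auto simp: sum_lessThan_telescope convergent_def)
  have "(\<lambda>k. a (k + n)) \<longlonglongrightarrow> lim a"
    using conv by (intro LIMSEQ_ignore_initial_segment) (simp add: convergent_LIMSEQ_iff)
  then have "(\<lambda>k. a (Suc (k + n)) - a (k + n)) sums (lim a - a n)"
    using telescope_sums[of "\<lambda>k. a (k + n)"] by simp
  then have "norm (lim a - a n) \<le> (\<Sum>k. norm (a (Suc (k + n)) - a (k + n)))"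
    using summable_norm[OF summ[of n]] by (simp add: sums_iff)
  also have "\<dots> \<le> (\<Sum>k. c * q ^ (k + n))"
    by (rule suminf_le[OF a summ sums_summable[OF geo]])
  also have "\<dots> = c * q ^ n / (1 - q)" using geo[of n] by (simp add: sums_iff)
  finally show "norm (lim a - a n) \<le> c * q ^ n / (1 - q)" .
qed

lemma norm_add_sq_le: "(norm (x + y))\<^sup>2 \<le> 2 * (norm x)\<^sup>2 + 2 * (norm y)\<^sup>2"
  for x y :: "'b::real_normed_vector"
proof -
  have "(norm (x + y))\<^sup>2 \<le> (norm x + norm y)\<^sup>2" by (intro power_mono norm_triangle_ineq) auto
  also have "\<dots> \<le> 2 * (norm x)\<^sup>2 + 2 * (norm y)\<^sup>2"
    using zero_le_power2[of "norm x - norm y"] by (simp add: power2_sum power2_diff)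
  finally show ?thesis .
qed

text \<open>The weights \<open>2 ^ n\<close> make the squared increments summable almost everywhere at a geometric rate,
  so neither Minkowski's inequality nor a subsequence is needed.\<close>

lemma square_integrable_complete:
  fixes f :: "nat \<Rightarrow> 'a \<Rightarrow> complex"
  assumes meas [measurable]: "\<And>n. f n \<in> borel_measurable M"
    and int: "\<And>n. integrable M (\<lambda>x. (cmod (f n x))\<^sup>2)"
    and bound: "\<And>n. (LINT x|M. (cmod (f (Suc n) x - f n x))\<^sup>2) \<le> C / 4 ^ n"
  shows "\<exists>g\<in>borel_measurable M. integrable M (\<lambda>x. (cmod (g x))\<^sup>2) \<and>
    (\<forall>n. integrable M (\<lambda>x. (cmod (f n x - g x))\<^sup>2)) \<and>
    (\<lambda>n. LINT x|M. (cmod (f n x - g x))\<^sup>2) \<longlonglongrightarrow> 0"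
proof -
  have int_diff: "integrable M (\<lambda>x. (cmod (u x - v x))\<^sup>2)"
    if [measurable]: "u \<in> borel_measurable M" "v \<in> borel_measurable M" and
      i: "integrable M (\<lambda>x. (cmod (u x))\<^sup>2)" "integrable M (\<lambda>x. (cmod (v x))\<^sup>2)" for u v
  proof (rule Bochner_Integration.integrable_bound[OF Bochner_Integration.integrable_add
        [OF integrable_mult_right[OF i(1), of 2] integrable_mult_right[OF i(2), of 2]]])
    show "AE x in M. norm ((cmod (u x - v x))\<^sup>2) \<le> norm (2 * (cmod (u x))\<^sup>2 + 2 * (cmod (v x))\<^sup>2)"
      using norm_add_sq_le[of "u _" "- v _"] by (intro AE_I2) simp
  qed simp
  define d where "d n x = 2 ^ n * (cmod (f (Suc n) x - f n x))\<^sup>2" for n x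
  have d_int: "integrable M (d n)" for n
    unfolding d_def using int_diff[OF meas meas int int] by simp
  have d0: "0 \<le> d n x" for n x by (simp add: d_def)
  \<comment> \<open>The weight uses up half of the decay: \<open>2 ^ n / 4 ^ n = (1 / 2) ^ n\<close>
    is still summable.\<close>
  have d_le: "(LINT x|M. d n x) \<le> C * (1 / 2) ^ n" for n
  proof -
    have "(LINT x|M. d n x) = 2 ^ n * (LINT x|M. (cmod (f (Suc n) x - f n x))\<^sup>2)" by (simp add: d_def)
    also have "\<dots> \<le> 2 ^ n * (C / 4 ^ n)" by (intro mult_left_mono bound) auto
    also have "\<dots> = C * (1 / 2) ^ n"
    proof -
      have "(4::real) ^ n = 2 ^ n * 2 ^ n" by (simp flip: power_mult_distrib)
      then show ?thesis by (simp add: power_divide)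
    qed
    finally show ?thesis .
  qed
  have geo: "summable (\<lambda>n. C * (1 / 2 :: real) ^ n)" by (intro summable_mult summable_geometric) simp
  have summ: "summable (\<lambda>n. LINT x|M. norm (d n x))"
    by (rule summable_comparison_test'[OF geo, of 0])
      (use d_le d0 in \<open>simp add: abs_of_nonneg integral_nonneg_AE\<close>)
  have AE_summ: "AE x in M. summable (\<lambda>n. norm (d n x))"
  proof -
    have [measurable]: "d n \<in> borel_measurable M" for n using d_int by simp
    have "(\<integral>\<^sup>+x. (\<Sum>n. ennreal (d n x)) \<partial>M) = (\<Sum>n. \<integral>\<^sup>+x. ennreal (d n x) \<partial>M)"
      by (rule nn_integral_suminf) simp
    also have "\<dots> = (\<Sum>n. ennreal (LINT x|M. norm (d n x)))"
      using d0 by (simp add: nn_integral_eq_integral[OF d_int])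
    also have "\<dots> \<noteq> \<infinity>"
      unfolding infinity_ennreal_def by (rule ennreal_suminf_neq_top[OF summ]) (simp add: integral_nonneg_AE)
    finally have *: "(\<integral>\<^sup>+x. (\<Sum>n. ennreal (d n x)) \<partial>M) \<noteq> \<infinity>" .
    have "AE x in M. (\<Sum>n. ennreal (d n x)) \<noteq> \<infinity>"
      by (rule nn_integral_PInf_AE[OF _ *]) measurable
    then show ?thesis
    proof (rule eventually_mono)
      fix x assume "(\<Sum>n. ennreal (d n x)) \<noteq> \<infinity>"
      then have "summable (\<lambda>n. d n x)" using d0 by (intro summable_suminf_not_top) auto
      then show "summable (\<lambda>n. norm (d n x))" using d0 by simp
    qed
  qed
  \<comment> \<open>One integrable function that bounds every \<open>d n\<close> almost everywhere
    and thus controls all increments at once.\<close>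
  define G where "G x = (\<Sum>n. d n x)" for x
  have G_int: "integrable M G"
    unfolding G_def using d_int AE_summ summ by (rule integrable_suminf)
  define g where "g x = lim (\<lambda>n. f n x)" for x
  have g_meas [measurable]: "g \<in> borel_measurable M" unfolding g_def by measurable
  \<comment> \<open>The ratio in the resulting pointwise bound: \<open>d m x \<le> G x\<close>
    limits the increment to \<open>sqrt (G x) * q ^ m\<close>.\<close>
  define q where "q = sqrt (1 / 2)"
  have q: "0 \<le> q" "q < 1" "q\<^sup>2 = 1 / 2" by (auto simp: q_def real_less_lsqrt)
  define K where "K = (1 / (1 - q))\<^sup>2"
  have le: "AE x in M. (cmod (f n x - g x))\<^sup>2 \<le> K * (1 / 2) ^ n * G x" for n
    using AE_summ
  proof (rule eventually_mono)
    fix x assume s: "summable (\<lambda>n. norm (d n x))"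
    have s': "summable (\<lambda>n. d n x)" using s d0 by simp
    have dG: "d m x \<le> G x" for m
      unfolding G_def using sum_le_suminf[OF s', of "{m}"] d0 by simp
    have G0: "0 \<le> G x" using dG[of 0] d0[of 0 x] by linarith
    have st: "norm (f (Suc m) x - f m x) \<le> sqrt (G x) * q ^ m" for m
    proof (rule power2_le_imp_le)
      have "(norm (f (Suc m) x - f m x))\<^sup>2 \<le> G x / 2 ^ m"
        using dG[of m] by (simp add: d_def field_simps)
      also have "\<dots> = (sqrt (G x) * q ^ m)\<^sup>2"
      proof -
        have "(q ^ m)\<^sup>2 = (1 / 2) ^ m" using q(3) by (metis power_even_eq power_mult mult.commute)
        then show ?thesis using G0 by (simp add: power_mult_distrib power_divide)
      qed
      finally show "(norm (f (Suc m) x - f m x))\<^sup>2 \<le> (sqrt (G x) * q ^ m)\<^sup>2" .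
    qed (use q G0 in simp)
    have "norm (f n x - g x) \<le> sqrt (G x) * q ^ n / (1 - q)"
      using telescope_bound(2)[OF st q(1,2), of n] by (simp add: g_def norm_minus_commute)
    then have "(norm (f n x - g x))\<^sup>2 \<le> (sqrt (G x) * q ^ n / (1 - q))\<^sup>2" by (intro power_mono) auto
    also have "\<dots> = K * (1 / 2) ^ n * G x"
    proof -
      have "(q ^ n)\<^sup>2 = (1 / 2) ^ n" using q(3) by (metis power_even_eq power_mult mult.commute)
      then show ?thesis using G0 by (simp add: power_mult_distrib power_divide K_def mult_ac)
    qed
    finally show "(cmod (f n x - g x))\<^sup>2 \<le> K * (1 / 2) ^ n * G x" .
  qed
  have fg_int: "integrable M (\<lambda>x. (cmod (f n x - g x))\<^sup>2)" for n
  proof (rule Bochner_Integration.integrable_bound[OF integrable_mult_right[OF G_int, of "K * (1 / 2) ^ n"]])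
    show "AE x in M. norm ((cmod (f n x - g x))\<^sup>2) \<le> norm (K * (1 / 2) ^ n * G x)"
      using le[of n] by (rule eventually_mono) (simp add: abs_of_nonneg)
  qed simp
  \<comment> \<open>Square integrability of \<open>g\<close> is obtained from
    \<open>g = f 0 - (f 0 - g)\<close>.\<close>
  have "integrable M (\<lambda>x. (cmod (f 0 x - (f 0 x - g x)))\<^sup>2)"
    by (rule int_diff[OF _ _ int fg_int]) auto
  then have g_int: "integrable M (\<lambda>x. (cmod (g x))\<^sup>2)" by simp
  have "(\<lambda>n. LINT x|M. (cmod (f n x - g x))\<^sup>2) \<longlonglongrightarrow> 0"
  proof (rule tendsto_sandwich[OF _ _ tendsto_const])
    show "\<forall>\<^sub>F n in sequentially. (LINT x|M. (cmod (f n x - g x))\<^sup>2) \<le> K * (1 / 2) ^ n * integral\<^sup>L M G"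
    proof (rule always_eventually, rule allI)
      fix n
      have "(LINT x|M. (cmod (f n x - g x))\<^sup>2) \<le> (LINT x|M. K * (1 / 2) ^ n * G x)"
        by (rule integral_mono_AE[OF fg_int _ le]) (use G_int in simp)
      then show "(LINT x|M. (cmod (f n x - g x))\<^sup>2) \<le> K * (1 / 2) ^ n * integral\<^sup>L M G" by simp
    qed
    have "(\<lambda>n. K * (1 / 2) ^ n * integral\<^sup>L M G) \<longlonglongrightarrow> K * 0 * integral\<^sup>L M G"
      by (intro tendsto_intros LIMSEQ_power_zero) auto
    then show "(\<lambda>n. K * (1 / 2) ^ n * integral\<^sup>L M G) \<longlonglongrightarrow> 0" by simp
  qed simp
  then show ?thesis using g_meas g_int fg_int by blast
qed

section \<open>Calculus of test functions\<close>

lemma partial_eqI: "(f has_derivative f') (at x) \<Longrightarrow> partial b f x = f' b"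
  by (simp add: partial_def frechet_derivative_at[symmetric])

lemma partial_has_derivative: "f differentiable (at x) \<Longrightarrow> (f has_derivative (\<lambda>h. frechet_derivative f (at x) h)) (at x)"
  using frechet_derivative_works by force

lemma partial_tendsto:
  assumes "f differentiable (at x)"
  shows "((\<lambda>t. (f (x + t *\<^sub>R b) - f x) / t) \<longlongrightarrow> partial b f x) (at 0)"
proof -
  have "((\<lambda>t. f (x + t *\<^sub>R b)) has_derivative (\<lambda>t. frechet_derivative f (at x) (t *\<^sub>R b))) (at 0)"
    by (rule has_derivative_compose[of "\<lambda>t. x + t *\<^sub>R b" "\<lambda>t. t *\<^sub>R b" 0 UNIV f])
      (auto intro!: derivative_eq_intros partial_has_derivative assms)
  moreover have "(\<lambda>t. frechet_derivative f (at x) (t *\<^sub>R b)) = (*) (partial b f x)"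
    using linear_frechet_derivative[OF assms] by (auto simp: partial_def linear_cmul)
  ultimately have "((\<lambda>t. f (x + t *\<^sub>R b)) has_real_derivative partial b f x) (at 0)"
    by (simp add: has_field_derivative_def)
  then show ?thesis by (simp add: has_field_derivative_iff)
qed

text \<open>Off the closed support the function vanishes on a whole neighbourhood, so its
  derivatives vanish as well.\<close>

lemma outside_support:
  assumes x: "x \<notin> closure {x. f x \<noteq> 0}"
  shows "f x = 0" "partial b f x = 0"
proof -
  have zero: "f y = 0" if "y \<notin> closure {x. f x \<noteq> 0}" for y
    using that closure_subset[of "{x. f x \<noteq> 0}"] by auto
  from zero[OF x] show "f x = 0" .
  have "(f has_derivative (\<lambda>_. 0)) (at x)"
  proof (rule has_derivative_transform_within_open[OF has_derivative_const])
    show "open (- closure {x. f x \<noteq> 0})" by (rule open_Compl) (rule closed_closure)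
    show "x \<in> - closure {x. f x \<noteq> 0}" using x by simp
    show "0 = f y" if "y \<in> - closure {x. f x \<noteq> 0}" for y
      using zero[OF ComplD[OF that]] by (rule sym)
  qed
  from partial_eqI[OF this] show "partial b f x = 0" .
qed

lemma C_k_continuous: "C_k k f \<Longrightarrow> continuous_on UNIV f"
  by (cases k) (auto intro!: continuous_at_imp_continuous_on differentiable_imp_continuous_within)

lemma C_k_Suc_D: "C_k (Suc k) f \<Longrightarrow> C_k k f"
proof (induction k arbitrary: f)
  case 0
  then show ?case using C_k_continuous[OF 0] by simp
next
  case (Suc k)
  then show ?case by simp
qed

lemma C_k_const: "C_k k (\<lambda>x. c)"
proof (induction k arbitrary: c)
  case (Suc k)
  have "partial b (\<lambda>x. c) = (\<lambda>x. 0)" for b :: 'a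
    by (rule ext, subst partial_eqI[OF has_derivative_const]) simp
  then show ?case using Suc by simp
qed simp

lemma C_k_add: "\<lbrakk>C_k k f; C_k k g\<rbrakk> \<Longrightarrow> C_k k (\<lambda>x. f x + g x)"
proof (induction k arbitrary: f g)
  case (Suc k)
  have "partial b (\<lambda>x. f x + g x) = (\<lambda>x. partial b f x + partial b g x)" for b
    using Suc.prems
    by (auto simp: fun_eq_iff partial_def[symmetric]
        intro!: partial_eqI[OF has_derivative_add[OF partial_has_derivative partial_has_derivative], THEN trans])
  then show ?case using Suc by (auto intro!: differentiable_add)
qed (auto intro: continuous_intros)

lemma C_k_mult: "\<lbrakk>C_k k f; C_k k g\<rbrakk> \<Longrightarrow> C_k k (\<lambda>x. f x * g x)"
proof (induction k arbitrary: f g)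
  case (Suc k)
  have "partial b (\<lambda>x. f x * g x) = (\<lambda>x. f x * partial b g x + partial b f x * g x)" for b
    using Suc.prems
    by (auto simp: fun_eq_iff partial_def[symmetric]
        intro!: partial_eqI[OF has_derivative_mult[OF partial_has_derivative partial_has_derivative], THEN trans])
  moreover have "C_k k f" "C_k k g" using Suc.prems C_k_Suc_D by blast+
  ultimately show ?case using Suc by (auto intro!: differentiable_mult C_k_add)
qed (auto intro: continuous_intros)

lemma C_k_prod: "(\<And>i. i \<in> I \<Longrightarrow> C_k k (f i)) \<Longrightarrow> C_k k (\<lambda>x. \<Prod>i\<in>I. f i x)"
  by (induction I rule: infinite_finite_induct) (auto intro: C_k_mult C_k_const)

text \<open>A sequence \<open>P\<close> of successive derivatives takes the place of one function,
  so that the induction on \<open>k\<close> can shift \<open>n\<close> by one whenever a partial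
  derivative is taken.\<close>

lemma C_k_affine:
  fixes P :: "nat \<Rightarrow> real \<Rightarrow> real"
  assumes P: "\<And>n x. (P n has_real_derivative P (Suc n) x) (at x)"
  shows "C_k k (\<lambda>x. P n (x \<bullet> v + c))"
proof (induction k arbitrary: n)
  case 0
  have c: "continuous_on UNIV (P n)"
    by (rule DERIV_continuous_on[of UNIV "P n" "P (Suc n)"]) (simp add: P)
  show ?case
    unfolding C_k.simps by (rule continuous_on_compose2[OF c]) (auto intro!: continuous_intros)
next
  case (Suc k)
  have d: "((\<lambda>x. P n (x \<bullet> v + c)) has_derivative (\<lambda>h. (h \<bullet> v) * P (Suc n) (x \<bullet> v + c))) (at x)" for x
  proof -
    have "((\<lambda>x. x \<bullet> v + c) has_derivative (\<lambda>h. h \<bullet> v)) (at x)"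
      by (auto intro!: derivative_eq_intros)
    from has_derivative_compose[OF this, of "P n" "\<lambda>h. h * P (Suc n) (x \<bullet> v + c)"] show ?thesis
      using P[of n "x \<bullet> v + c"] by (simp add: has_field_derivative_def mult_commute_abs)
  qed
  have "partial b (\<lambda>x. P n (x \<bullet> v + c)) = (\<lambda>x. (b \<bullet> v) * P (Suc n) (x \<bullet> v + c))" for b
    using partial_eqI[OF d] by auto
  then show ?case using Suc d by (auto simp: differentiable_def intro!: C_k_mult C_k_const)
qed

section \<open>Smooth bump functions of boxes\<close>

definition exp_flat :: "real poly \<Rightarrow> real \<Rightarrow> real" where
  "exp_flat Q t = (if t > 0 then poly Q (1 / t) * exp (- (1 / t)) else 0)"

text \<open>With \<open>y = 1 / t\<close>, the derivative of \<open>poly Q y * exp (- y)\<close> in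
  \<open>t\<close> is \<open>y\<^sup>2 * (poly Q y - poly (pderiv Q) y) * exp (- y)\<close>. The
  polynomial factor is what makes this class of functions closed under differentiation.\<close>

definition exp_flat_deriv :: "real poly \<Rightarrow> real poly" where
  "exp_flat_deriv Q = [:0, 0, 1:] * (Q - pderiv Q)"

text \<open>The additional power \<open>k\<close> carries the induction on the coefficients of
  \<open>Q\<close>: each step moves one factor \<open>y\<close> from the polynomial into the
  power.\<close>

lemma poly_times_exp_tendsto: "((\<lambda>y. y ^ k * poly Q y * exp (- y)) \<longlongrightarrow> 0) at_top" for Q :: "real poly"
proof (induction Q arbitrary: k)
  case (pCons a Q)
  have "((\<lambda>y. a * (y ^ k / exp y) + y ^ Suc k * poly Q y * exp (- y)) \<longlongrightarrow> a * 0 + 0) at_top"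
    by (intro tendsto_intros tendsto_power_div_exp_0 pCons.IH)
  then show ?case by (simp add: exp_minus field_simps)
qed simp

lemma exp_flat_has_derivative:
  "(exp_flat Q has_real_derivative exp_flat (exp_flat_deriv Q) t) (at t)"
proof -
  consider "t > 0" | "t < 0" | "t = 0" by linarith
  then show ?thesis
  proof cases
    case 1
    have "((\<lambda>t. poly Q (1 / t) * exp (- (1 / t))) has_real_derivative exp_flat (exp_flat_deriv Q) t) (at t)"
      using 1
      by (auto intro!: derivative_eq_intros DERIV_chain2[OF poly_DERIV]
          simp: exp_flat_def exp_flat_deriv_def field_simps power2_eq_square)
    then show ?thesis
      by (rule has_field_derivative_transform_within_open[of _ _ _ "{0<..}"])
        (use 1 in \<open>auto simp: exp_flat_def\<close>)
  next
    case 2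
    have "((\<lambda>t. 0) has_real_derivative exp_flat (exp_flat_deriv Q) t) (at t)"
      using 2 by (simp add: exp_flat_def)
    then show ?thesis
      by (rule has_field_derivative_transform_within_open[of _ _ _ "{..<0}"])
        (use 2 in \<open>auto simp: exp_flat_def\<close>)
  next
    case 3
    have "((\<lambda>h. exp_flat Q h / h) \<longlongrightarrow> 0) (at_right 0)"
    proof -
      \<comment> \<open>Substitute \<open>y = 1 / h\<close>; the division by \<open>h\<close>
        contributes the single power of \<open>y\<close>.\<close>
      have "((\<lambda>h. (inverse h) ^ 1 * poly Q (inverse h) * exp (- inverse h)) \<longlongrightarrow> 0) (at_right (0::real))"
        by (rule filterlim_compose[OF poly_times_exp_tendsto filterlim_inverse_at_top_right])
      then show ?thesis
        by (rule Lim_transform_eventually)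
          (auto simp: exp_flat_def field_simps eventually_at_right[of 0 1] intro!: exI[of _ 1])
    qed
    moreover have "((\<lambda>h. exp_flat Q h / h) \<longlongrightarrow> 0) (at_left 0)"
      by (rule Lim_transform_eventually[OF tendsto_const])
        (auto simp: exp_flat_def eventually_at_left[of "-1" 0] intro!: exI[of _ "-1"])
    ultimately have "((\<lambda>h. exp_flat Q h / h) \<longlongrightarrow> 0) (at 0)"
      by (simp add: filterlim_split_at)
    then show ?thesis using 3 by (simp add: has_field_derivative_iff exp_flat_def)
  qed
qed

text \<open>The shift \<open>- 1\<close> keeps the closed support at distance at least
  \<open>1 / (n + 1)\<close> from the faces. Inside the box the arguments tend to infinity, where
  \<open>exp_flat 1\<close> tends to 1, so the bumps converge to the indicator of the box.\<close>

definition bump :: "'a::euclidean_space \<Rightarrow> 'a \<Rightarrow> nat \<Rightarrow> 'a \<Rightarrow> real" where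
  "bump a b n x = (\<Prod>i\<in>Basis. exp_flat 1 (real (Suc n) * (x \<bullet> i - a \<bullet> i) - 1)
      * exp_flat 1 (real (Suc n) * (b \<bullet> i - x \<bullet> i) - 1))"

lemma exp_flat_1_range: "0 \<le> exp_flat 1 t" "exp_flat 1 t \<le> 1"
  by (auto simp: exp_flat_def)

lemma C_k_exp_flat: "C_k k (\<lambda>x. exp_flat Q (x \<bullet> v + c))"
proof -
  define P where "P n = exp_flat ((exp_flat_deriv ^^ n) Q)" for n
  have "(P n has_real_derivative P (Suc n) x) (at x)" for n x
    by (simp add: P_def exp_flat_has_derivative)
  from C_k_affine[of P k 0 v c, OF this] show ?thesis by (simp add: P_def)
qed

lemma C_k_bump: "C_k k (bump a b n)"
proof -
  have "C_k k (\<lambda>x. exp_flat 1 (real (Suc n) * (x \<bullet> i - a \<bullet> i) - 1))"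
    "C_k k (\<lambda>x. exp_flat 1 (real (Suc n) * (b \<bullet> i - x \<bullet> i) - 1))" for i
    using C_k_exp_flat[of k 1 "real (Suc n) *\<^sub>R i" "- real (Suc n) * (a \<bullet> i) - 1"]
      C_k_exp_flat[of k 1 "(- real (Suc n)) *\<^sub>R i" "real (Suc n) * (b \<bullet> i) - 1"]
    by (simp_all add: algebra_simps)
  then show ?thesis unfolding bump_def[abs_def] by (intro C_k_prod C_k_mult)
qed

lemma bump_range: "0 \<le> bump a b n x" "bump a b n x \<le> 1"
  unfolding bump_def
  by (auto intro!: prod_nonneg prod_le_1 mult_nonneg_nonneg mult_le_one simp: exp_flat_1_range)

lemma bump_nonzero:
  assumes "bump a b n x \<noteq> 0"
  shows "x \<in> cbox (a + (\<Sum>i\<in>Basis. (1 / real (Suc n)) *\<^sub>R i)) (b - (\<Sum>i\<in>Basis. (1 / real (Suc n)) *\<^sub>R i))"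
proof -
  have "a \<bullet> i + 1 / real (Suc n) \<le> x \<bullet> i \<and> x \<bullet> i \<le> b \<bullet> i - 1 / real (Suc n)" if "i \<in> Basis" for i
  proof -
    have "exp_flat 1 (real (Suc n) * (x \<bullet> i - a \<bullet> i) - 1) \<noteq> 0"
      "exp_flat 1 (real (Suc n) * (b \<bullet> i - x \<bullet> i) - 1) \<noteq> 0"
      using assms that by (auto simp: bump_def)
    then have "real (Suc n) * (x \<bullet> i - a \<bullet> i) > 1" "real (Suc n) * (b \<bullet> i - x \<bullet> i) > 1"
      by (auto simp: exp_flat_def split: if_splits)
    then show ?thesis by (simp add: field_simps)
  qed
  then show ?thesis
    by (auto simp: mem_box inner_simps inner_sum_left inner_Basis if_distrib sum.delta cong: if_cong)
qed

lemma bump_test_function: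
  assumes "box a b \<subseteq> S"
  shows "bump a b n \<in> test_functions S"
proof -
  let ?d = "(\<Sum>i\<in>Basis. (1 / real (Suc n)) *\<^sub>R i)"
  have c: "closure {x. bump a b n x \<noteq> 0} \<subseteq> cbox (a + ?d) (b - ?d)"
    using bump_nonzero by (intro closure_minimal) auto
  have "cbox (a + ?d) (b - ?d) \<subseteq> box a b"
  proof
    fix x assume x: "x \<in> cbox (a + ?d) (b - ?d)"
    have "a \<bullet> i < x \<bullet> i \<and> x \<bullet> i < b \<bullet> i" if i: "i \<in> Basis" for i
    proof -
      have "?d \<bullet> i = 1 / real (Suc n)"
        using i by (simp add: inner_sum_left inner_Basis if_distrib sum.delta cong: if_cong)
      moreover have "a \<bullet> i + ?d \<bullet> i \<le> x \<bullet> i" "x \<bullet> i \<le> b \<bullet> i - ?d \<bullet> i"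
        using x i by (simp_all only: mem_box inner_simps)
      moreover have "0 < 1 / real (Suc n)" by simp
      ultimately show ?thesis by linarith
    qed
    then show "x \<in> box a b" by (simp add: mem_box)
  qed
  then have "closure {x. bump a b n x \<noteq> 0} \<subseteq> S" using c assms by blast
  moreover have "compact (closure {x. bump a b n x \<noteq> 0})"
    using c by (meson bounded_cbox bounded_subset compact_eq_bounded_closed closed_closure)
  ultimately show ?thesis by (auto simp: test_functions_def C_k_bump)
qed

lemma bump_outside: "x \<notin> box a b \<Longrightarrow> bump a b n x = 0"
  using bump_test_function[of a b "box a b" n] closure_subset[of "{x. bump a b n x \<noteq> 0}"]
  by (auto simp: test_functions_def)

lemma bump_tendsto: "(\<lambda>n. bump a b n x) \<longlonglongrightarrow> indicator (box a b) x"
proof (cases "x \<in> box a b")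
  case True
  have e: "(\<lambda>n. exp_flat 1 (real (Suc n) * s - 1)) \<longlonglongrightarrow> 1" if "s > 0" for s
  proof -
    have f: "filterlim (\<lambda>n. real (Suc n) * s - 1) at_top sequentially"
      using that by real_asymp
    have "((\<lambda>t. exp_flat 1 t) \<longlongrightarrow> 1) at_top"
    proof (rule Lim_transform_eventually)
      show "((\<lambda>t::real. exp (- (1 / t))) \<longlongrightarrow> 1) at_top" by real_asymp
      show "\<forall>\<^sub>F t in at_top. exp (- (1 / t)) = exp_flat 1 t"
        using eventually_gt_at_top[of 0] by eventually_elim (simp add: exp_flat_def)
    qed
    then show ?thesis using f by (rule filterlim_compose)
  qed
  have "(\<lambda>n. bump a b n x) \<longlonglongrightarrow> (\<Prod>i\<in>(Basis::'a set). 1 * 1)"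
    unfolding bump_def using True by (intro tendsto_intros e) (auto simp: mem_box)
  then show ?thesis using True by simp
qed (simp add: bump_outside)

section \<open>The fundamental lemma of the calculus of variations\<close>

text \<open>Open boxes form an intersection-stable generator of the Borel sets, so vanishing
  integrals extend from boxes to all Borel sets; the total integral serves for complements. The sets
  where a Borel representative \<open>k\<close> is positive or negative must then be null.\<close>

lemma box_integrals_zero_AE:
  fixes h :: "'a::euclidean_space \<Rightarrow> real"
  assumes h: "integrable lebesgue h" and zero: "(LINT x|lebesgue. h x) = 0"
    and box: "\<And>a b. (LINT x|lebesgue. indicator (box a b) x * h x) = 0"
  shows "AE x in lebesgue. h x = 0"
proof -
  obtain k where k [measurable]: "k \<in> borel_measurable lborel" and hk: "AE x in lborel. h x = k x"
    using completion_ex_borel_measurable_real[of h lborel] h by auto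
  have hk': "AE x in lebesgue. h x = k x" using hk by (rule AE_completion)
  have km [measurable]: "k \<in> borel_measurable lebesgue" using k by (rule measurable_completion)
  have hm [measurable]: "h \<in> borel_measurable lebesgue" using h by simp
  have "integrable lebesgue k" using integrable_cong_AE[OF hm km hk'] h by simp
  then have k_int: "integrable lborel k" by (simp add: integrable_completion)
  have eq: "(LINT x:A|lborel. k x) = (LINT x|lebesgue. indicator A x * h x)" if [measurable]: "A \<in> sets borel" for A
  proof -
    have [measurable]: "A \<in> sets lebesgue" by simp
    have "(LINT x|lborel. indicator A x * k x) = (LINT x|lebesgue. indicator A x * k x)"
      by (rule integral_completion[symmetric]) measurable
    also have "\<dots> = (LINT x|lebesgue. indicator A x * h x)"
      by (rule integral_cong_AE) (use hk' in \<open>auto elim!: eventually_mono\<close>)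
    finally show ?thesis by (simp add: set_lebesgue_integral_def)
  qed
  have si: "set_integrable lborel A k" if "A \<in> sets borel" for A
    unfolding set_integrable_def by (rule integrable_mult_indicator) (use k_int that in auto)
  have all: "(LINT x:A|lborel. k x) = 0" if "A \<in> sets borel" for A
  proof -
    have "Int_stable (range (\<lambda>(a, b). box a b :: 'a set))"
      by (auto simp: Int_stable_def box_Int_box)
    moreover have "range (\<lambda>(a, b). box a b :: 'a set) \<subseteq> Pow UNIV" by auto
    moreover have "A \<in> sigma_sets UNIV (range (\<lambda>(a, b). box a b :: 'a set))"
      using that unfolding borel_eq_box by simp
    ultimately show ?thesis
    proof (induction rule: sigma_sets_induct_disjoint)
      case (basic A)
      then show ?case using eq box by auto
    next
      case empty
      show ?case by (simp add: set_lebesgue_integral_def)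
    next
      case (compl A)
      then have A: "A \<in> sets borel" unfolding borel_eq_box by simp
      have "(UNIV - A) \<inter> A = {}" "UNIV - A \<union> A = UNIV" by auto
      then have "(LINT x:UNIV - A|lborel. k x) + (LINT x:A|lborel. k x) = (LINT x:UNIV|lborel. k x)"
        using set_integral_Un[of "UNIV - A" A lborel k] si[of "UNIV - A"] si[OF A] A by simp
      then show ?case using compl eq[of UNIV] zero by simp
    next
      case (union A)
      then have A: "A i \<in> sets borel" for i unfolding borel_eq_box by auto
      have "(LINT x:(\<Union>i. A i)|lborel. k x) = (\<Sum>i. LINT x:A i|lborel. k x)"
        using A union(1) by (intro lebesgue_integral_countable_add si)
          (auto simp: disjoint_family_on_def)
      then show ?case using union by simp
    qed
  qed
  have "AE x in lborel. indicator {x. 0 < k x} x * k x = 0"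
  proof (subst integral_nonneg_eq_0_iff_AE[symmetric])
    show "integrable lborel (\<lambda>x. indicator {x. 0 < k x} x * k x)"
      using si[of "{x. 0 < k x}"] by (simp add: set_integrable_def)
    show "(LINT x|lborel. indicator {x. 0 < k x} x * k x) = 0"
      using all[of "{x. 0 < k x}"] by (simp add: set_lebesgue_integral_def)
  qed (auto simp: indicator_def)
  moreover have "AE x in lborel. - (indicator {x. k x < 0} x * k x) = 0"
  proof (subst integral_nonneg_eq_0_iff_AE[symmetric])
    show "integrable lborel (\<lambda>x. - (indicator {x. k x < 0} x * k x))"
      using si[of "{x. k x < 0}"] by (simp add: set_integrable_def)
    show "(LINT x|lborel. - (indicator {x. k x < 0} x * k x)) = 0"
      using all[of "{x. k x < 0}"] by (simp add: set_lebesgue_integral_def)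
  qed (auto simp: indicator_def)
  ultimately have "AE x in lborel. h x = 0" using hk
    by eventually_elim (auto simp: indicator_def split: if_splits)
  then show ?thesis by (rule AE_completion)
qed

text \<open>On a set of finite measure \<open>cmod (g x)\<close> is dominated by its square plus
  1.\<close>

lemma L2_integrable_bounded:
  assumes g: "g \<in> L2 S" and B: "bounded B" "B \<in> sets borel" and S: "S \<in> sets lebesgue"
  shows "integrable (lebesgue_on S) (\<lambda>x. indicator B x *\<^sub>R g x)"
proof -
  have [measurable]: "g \<in> borel_measurable (lebesgue_on S)" and g2: "integrable (lebesgue_on S) (\<lambda>x. (cmod (g x))\<^sup>2)"
    using g by (auto simp: L2_def)
  have [measurable]: "B \<inter> S \<in> sets (lebesgue_on S)"
    using B S by (subst sets_restrict_space_iff) auto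
  have Bm: "(\<lambda>x. indicator B x :: real) \<in> borel_measurable (lebesgue_on S)"
    by (intro measurable_restrict_space1 borel_measurable_indicator) (use B in simp)
  have fin: "emeasure (lebesgue_on S) (B \<inter> S) < \<infinity>"
  proof -
    have "emeasure (lebesgue_on S) (B \<inter> S) = emeasure lebesgue (B \<inter> S)"
      using B S by (subst emeasure_restrict_space) auto
    also have "\<dots> \<le> emeasure lebesgue B"
      by (rule emeasure_mono) (use B in auto)
    also have "\<dots> < \<infinity>" using B emeasure_bounded_finite[of B] by simp
    finally show ?thesis .
  qed
  have iB: "integrable (lebesgue_on S) (\<lambda>x. indicator (B \<inter> S) x :: real)"
    using fin by (intro integrable_real_indicator) auto
  show ?thesis
  proof (rule Bochner_Integration.integrable_bound[OF Bochner_Integration.integrable_add[OF g2 iB]])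
    show "AE x in lebesgue_on S. norm (indicator B x *\<^sub>R g x) \<le> norm ((cmod (g x))\<^sup>2 + indicator (B \<inter> S) x)"
    proof (rule AE_I2)
      fix x assume "x \<in> space (lebesgue_on S)"
      then have "x \<in> S" by (simp add: space_restrict_space)
      moreover have "cmod (g x) \<le> (cmod (g x))\<^sup>2 + 1"
        using zero_le_power2[of "cmod (g x) - 1"] zero_le_power2[of "cmod (g x)"]
        unfolding power2_diff by (smt (verit) one_power2)
      ultimately show "norm (indicator B x *\<^sub>R g x) \<le> norm ((cmod (g x))\<^sup>2 + indicator (B \<inter> S) x)"
        by (auto simp: indicator_def)
    qed
  qed (use Bm in measurable)
qed

text \<open>Bumps converge to indicators of boxes inside \<open>S\<close>, so dominated convergence
  turns orthogonality to test functions into vanishing box integrals. Countably many boxes exhaust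
  \<open>U\<close>, and the rest of \<open>S\<close> is negligible.\<close>

lemma orth_test_functions_AE_zero:
  assumes g: "g \<in> L2 S" and S: "S \<in> sets lebesgue" and U: "open U" "U \<subseteq> S" "negligible (S - U)"
    and orth: "\<And>\<phi>. \<phi> \<in> test_functions S \<Longrightarrow> (LINT x|lebesgue_on S. g x * complex_of_real (\<phi> x)) = 0"
  shows "AE x in lebesgue_on S. g x = 0"
proof -
  have gm [measurable]: "g \<in> borel_measurable (lebesgue_on S)" using g by (simp add: L2_def)
  have box0: "(LINT x|lebesgue_on S. indicator (box a b) x *\<^sub>R g x) = 0" if ab: "box a b \<subseteq> S" for a b
  proof -
    have "(\<lambda>n. LINT x|lebesgue_on S. g x * complex_of_real (bump a b n x))
        \<longlonglongrightarrow> (LINT x|lebesgue_on S. indicator (box a b) x *\<^sub>R g x)"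
    proof (rule integral_dominated_convergence[where w = "\<lambda>x. norm (indicator (box a b) x *\<^sub>R g x)"])
      have i: "integrable (lebesgue_on S) (\<lambda>x. indicator (box a b) x *\<^sub>R g x)"
        by (rule L2_integrable_bounded[OF g _ _ S]) (auto simp: bounded_box)
      then show "(\<lambda>x. indicator (box a b) x *\<^sub>R g x) \<in> borel_measurable (lebesgue_on S)"
        and "integrable (lebesgue_on S) (\<lambda>x. norm (indicator (box a b) x *\<^sub>R g x))"
        by (rule borel_measurable_integrable, rule integrable_norm)
      show "(\<lambda>x. g x * complex_of_real (bump a b n x)) \<in> borel_measurable (lebesgue_on S)" for n
      proof -
        have "bump a b n \<in> borel_measurable borel"
          using C_k_continuous[OF C_k_bump] by (rule borel_measurable_continuous_onI)
        then have [measurable]: "bump a b n \<in> borel_measurable (lebesgue_on S)"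
          by (intro measurable_restrict_space1 measurable_completion) simp
        show ?thesis by measurable
      qed
      show "AE x in lebesgue_on S. (\<lambda>n. g x * complex_of_real (bump a b n x)) \<longlonglongrightarrow> indicator (box a b) x *\<^sub>R g x"
      proof (rule AE_I2)
        fix x
        have "(\<lambda>n. g x * complex_of_real (bump a b n x)) \<longlonglongrightarrow> g x * complex_of_real (indicator (box a b) x)"
          by (intro tendsto_intros bump_tendsto)
        then show "(\<lambda>n. g x * complex_of_real (bump a b n x)) \<longlonglongrightarrow> indicator (box a b) x *\<^sub>R g x"
          by (simp add: scaleR_conv_of_real mult.commute)
      qed
      show "AE x in lebesgue_on S. norm (g x * complex_of_real (bump a b n x)) \<le> norm (indicator (box a b) x *\<^sub>R g x)" for n
        using bump_outside[of _ a b n] bump_range[of a b n]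
        by (intro AE_I2) (auto simp: norm_mult indicator_def intro: mult_left_le)
    qed
    then show ?thesis using orth[OF bump_test_function[OF ab]] by (simp add: LIMSEQ_const_iff)
  qed
  have boxAE: "AE x in lebesgue. x \<in> box a b \<longrightarrow> g x = 0" if ab: "box a b \<subseteq> S" for a b
  proof -
    define h where "h x = indicator (box a b) x *\<^sub>R g x" for x
    have hS: "indicator S x *\<^sub>R h x = h x" for x using ab by (auto simp: h_def indicator_def)
    have "integrable (lebesgue_on S) h"
      unfolding h_def by (rule L2_integrable_bounded[OF g _ _ S]) (auto simp: bounded_box)
    then have hi: "integrable lebesgue h"
      using S by (simp add: integrable_restrict_space hS)
    \<comment> \<open>Two boxes meet in a box, so restricting \<open>g\<close> to
      \<open>box a b\<close> keeps all box integrals zero.\<close>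
    have z: "(LINT x|lebesgue. indicator (box c d) x *\<^sub>R h x) = 0" for c d
    proof -
      obtain a' b' where e: "box c d \<inter> box a b = box a' b'"
        using box_Int_box[of c d a b] by blast
      have "(LINT x|lebesgue. indicator (box c d) x *\<^sub>R h x)
          = (LINT x|lebesgue. indicator S x *\<^sub>R (indicator (box a' b') x *\<^sub>R g x))"
        using ab by (intro Bochner_Integration.integral_cong) (auto simp: h_def indicator_def e[symmetric])
      also have "\<dots> = (LINT x|lebesgue_on S. indicator (box a' b') x *\<^sub>R g x)"
        using S by (simp add: integral_restrict_space)
      also have "\<dots> = 0" using e ab by (intro box0) auto
      finally show ?thesis .
    qed
    have tot: "(LINT x|lebesgue. h x) = 0"
    proof -
      have "(LINT x|lebesgue. h x) = (LINT x|lebesgue. indicator (box a b) x *\<^sub>R h x)"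
        by (intro Bochner_Integration.integral_cong) (auto simp: h_def indicator_def)
      then show ?thesis using z[of a b] by simp
    qed
    have ib: "integrable lebesgue (\<lambda>x. indicator (box c d) x *\<^sub>R h x)" for c d
      using hi by (intro integrable_mult_indicator) auto
    have "AE x in lebesgue. Re (h x) = 0"
    proof (rule box_integrals_zero_AE)
      show "(LINT x|lebesgue. indicator (box c d) x * Re (h x)) = 0" for c d
        using arg_cong[OF z[of c d], of Re] integral_Re[OF ib[of c d]] by simp
    qed (use hi tot integral_Re[OF hi] in auto)
    moreover have "AE x in lebesgue. Im (h x) = 0"
    proof (rule box_integrals_zero_AE)
      show "(LINT x|lebesgue. indicator (box c d) x * Im (h x)) = 0" for c d
        using arg_cong[OF z[of c d], of Im] integral_Im[OF ib[of c d]] by simp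
    qed (use hi tot integral_Im[OF hi] in auto)
    ultimately show ?thesis
      by eventually_elim (auto simp: h_def complex_eq_iff)
  qed
  obtain \<D> where D: "countable \<D>" "\<D> \<subseteq> Pow U" "\<And>X. X \<in> \<D> \<Longrightarrow> \<exists>a b. X = box a b" "\<Union>\<D> = U"
    using open_countable_Union_open_box[OF U(1)] by metis
  have "AE x in lebesgue. \<forall>X\<in>\<D>. x \<in> X \<longrightarrow> g x = 0"
  proof (subst AE_ball_countable[OF D(1)], rule ballI)
    fix X assume X: "X \<in> \<D>"
    obtain a b where ab: "X = box a b" using D(3)[OF X] by auto
    have "box a b \<subseteq> S" using X D(2) U(2) ab by auto
    from boxAE[OF this] show "AE x in lebesgue. x \<in> X \<longrightarrow> g x = 0" by (simp add: ab)
  qed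
  moreover have "AE x in lebesgue. x \<notin> S - U"
    by (rule AE_not_in) (use U(3) in \<open>simp add: negligible_iff_null_sets\<close>)
  ultimately have "AE x in lebesgue. x \<in> S \<longrightarrow> g x = 0"
    by eventually_elim (use D(4) in auto)
  then show ?thesis using S by (simp add: AE_restrict_space_iff)
qed

section \<open>The variational principle for the Neumann operator\<close>

text \<open>Elimination: equation \<open>p\<close> is solved for an unknown \<open>i0\<close> with
  nonzero coefficient and substituted into the others, which removes one equation and one
  unknown.\<close>

lemma homogeneous_system:
  fixes a :: "'p \<Rightarrow> 'i \<Rightarrow> 'k::field"
  assumes "finite P" "finite I" "card P < card I"
  shows "\<exists>c. (\<exists>i\<in>I. c i \<noteq> 0) \<and> (\<forall>p\<in>P. (\<Sum>i\<in>I. c i * a p i) = 0)"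
  using assms
proof (induction P arbitrary: I a rule: finite_induct)
  case empty
  then obtain i where "i \<in> I" by fastforce
  then show ?case by (intro exI[of _ "\<lambda>_. 1"]) auto
next
  case (insert p P)
  show ?case
  proof (cases "\<forall>i\<in>I. a p i = 0")
    case True
    have "card P < card I" using insert by simp
    then show ?thesis using insert.IH[OF insert.prems(1), of a] True by auto
  next
    case False
    then obtain i0 where i0: "i0 \<in> I" "a p i0 \<noteq> 0" by auto
    define I' where "I' = I - {i0}"
    have I': "finite I'" "I = insert i0 I'" "i0 \<notin> I'" "card P < card I'"
      using insert i0 by (auto simp: I'_def)
    obtain c where c: "\<exists>i\<in>I'. c i \<noteq> 0"
      "\<forall>q\<in>P. (\<Sum>i\<in>I'. c i * (a q i - a q i0 * a p i / a p i0)) = 0"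
      using insert.IH[OF I'(1,4), of "\<lambda>q i. a q i - a q i0 * a p i / a p i0"] by auto
    \<comment> \<open>The value of the eliminated unknown that satisfies equation
      \<open>p\<close>.\<close>
    define s where "s = - (\<Sum>i\<in>I'. c i * a p i) / a p i0"
    define c' where "c' = c(i0 := s)"
    have sum: "(\<Sum>i\<in>I. c' i * a q i) = s * a q i0 + (\<Sum>i\<in>I'. c i * a q i)" for q
    proof -
      have "(\<Sum>i\<in>I'. c' i * a q i) = (\<Sum>i\<in>I'. c i * a q i)"
        using I'(3) by (intro sum.cong) (auto simp: c'_def)
      then show ?thesis using I'(1,3) by (subst I'(2)) (simp add: c'_def)
    qed
    have "(\<Sum>i\<in>I. c' i * a q i) = 0" if "q \<in> insert p P" for q
    proof (cases "q = p")
      case True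
      then show ?thesis using i0(2) by (simp add: sum s_def)
    next
      case False
      then have "0 = (\<Sum>i\<in>I'. c i * (a q i - a q i0 * a p i / a p i0))" using c(2) that by auto
      also have "\<dots> = (\<Sum>i\<in>I'. c i * a q i - (a q i0 / a p i0) * (c i * a p i))"
        by (intro sum.cong) (auto simp: algebra_simps)
      also have "\<dots> = (\<Sum>i\<in>I'. c i * a q i) - (a q i0 / a p i0) * (\<Sum>i\<in>I'. c i * a p i)"
        by (simp add: sum_subtractf sum_distrib_left)
      finally show ?thesis by (simp add: sum s_def)
    qed
    moreover have "\<exists>i\<in>I. c' i \<noteq> 0" using c(1) I' by (auto simp: c'_def)
    ultimately show ?thesis by blast
  qed
qed

text \<open>An open subset of full measure is what the fundamental lemma asks of \<open>S\<close>.
  The two-sided bounds of the weight make the weighted norm equivalent to the plain one.\<close>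

locale weighted_domain =
  fixes S :: "'a::euclidean_space set" and \<rho> :: "'a \<Rightarrow> real" and c1 c2 :: real
  assumes S_sets: "S \<in> sets lebesgue"
    and interior_conull: "\<exists>U. open U \<and> U \<subseteq> S \<and> negligible (S - U)"
    and weight_meas [measurable]: "\<rho> \<in> borel_measurable (lebesgue_on S)"
    and weight_bounds: "0 < c1" "\<And>x. c1 \<le> \<rho> x" "\<And>x. \<rho> x \<le> c2"
begin

lemma weight_pos: "0 < \<rho> x" using weight_bounds(1) weight_bounds(2)[of x] by linarith

lemma L2_measurable: "u \<in> L2 S \<Longrightarrow> u \<in> borel_measurable (lebesgue_on S)" by (simp add: L2_def)

lemma L2_integrable: "u \<in> L2 S \<Longrightarrow> integrable (lebesgue_on S) (\<lambda>x. (cmod (u x))\<^sup>2)" by (simp add: L2_def)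

lemma L2_lincomb:
  assumes u: "u \<in> L2 S" and v: "v \<in> L2 S"
  shows "(\<lambda>x. a * u x + b * v x) \<in> L2 S"
proof -
  note [measurable] = L2_measurable[OF u] L2_measurable[OF v]
  have "integrable (lebesgue_on S) (\<lambda>x. (cmod (a * u x + b * v x))\<^sup>2)"
  proof (rule Bochner_Integration.integrable_bound[OF Bochner_Integration.integrable_add
        [OF integrable_mult_right[OF L2_integrable[OF u], of "2 * (cmod a)\<^sup>2"]
          integrable_mult_right[OF L2_integrable[OF v], of "2 * (cmod b)\<^sup>2"]]])
    show "AE x in lebesgue_on S. norm ((cmod (a * u x + b * v x))\<^sup>2)
        \<le> norm (2 * (cmod a)\<^sup>2 * (cmod (u x))\<^sup>2 + 2 * (cmod b)\<^sup>2 * (cmod (v x))\<^sup>2)"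
      by (rule AE_I2, use norm_add_sq_le[of "a * u x" "b * v x" for x] in \<open>simp add: norm_mult power_mult_distrib mult.assoc\<close>)
  qed measurable
  then show ?thesis by (simp add: L2_def)
qed

lemma L2_zero: "(\<lambda>x. 0) \<in> L2 S" by (simp add: L2_def)

lemma L2_sum:
  assumes "\<And>i. i \<in> I \<Longrightarrow> u i \<in> L2 S"
  shows "(\<lambda>x. \<Sum>i\<in>I. c i * u i x) \<in> L2 S"
  using assms
proof (induction I rule: infinite_finite_induct)
  case (insert i I)
  then show ?case using L2_lincomb[of "u i" "\<lambda>x. \<Sum>i\<in>I. c i * u i x" "c i" 1] by simp
qed (simp_all add: L2_zero)

lemma product_integrable:
  assumes u: "u \<in> L2 S" and v: "v \<in> L2 S"
  shows "integrable (lebesgue_on S) (\<lambda>x. u x * v x)"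
proof -
  note [measurable] = L2_measurable[OF u] L2_measurable[OF v]
  show ?thesis
  proof (rule Bochner_Integration.integrable_bound[OF Bochner_Integration.integrable_add
        [OF L2_integrable[OF u] L2_integrable[OF v]]])
    have "cmod (u x) * cmod (v x) \<le> (cmod (u x))\<^sup>2 + (cmod (v x))\<^sup>2" for x
      using zero_le_power2[of "cmod (u x) - cmod (v x)"] zero_le_power2[of "cmod (u x)"]
        zero_le_power2[of "cmod (v x)"] unfolding power2_diff by linarith
    then show "AE x in lebesgue_on S. norm (u x * v x) \<le> norm ((cmod (u x))\<^sup>2 + (cmod (v x))\<^sup>2)"
      by (intro AE_I2) (simp add: norm_mult)
  qed measurable
qed

lemma L2_cnj: "u \<in> L2 S \<Longrightarrow> (\<lambda>x. cnj (u x)) \<in> L2 S"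
proof -
  assume u: "u \<in> L2 S"
  have "cnj \<in> borel_measurable borel"
    by (intro borel_measurable_continuous_onI continuous_on_cnj continuous_on_id)
  then have "(\<lambda>x. cnj (u x)) \<in> borel_measurable (lebesgue_on S)"
    using L2_measurable[OF u] by (rule measurable_compose[rotated])
  then show ?thesis using u by (simp add: L2_def)
qed

lemma L2_weight:
  assumes u: "u \<in> L2 S" shows "(\<lambda>x. u x * complex_of_real (\<rho> x)) \<in> L2 S"
proof -
  note [measurable] = L2_measurable[OF u]
  have "integrable (lebesgue_on S) (\<lambda>x. (cmod (u x * complex_of_real (\<rho> x)))\<^sup>2)"
  proof (rule Bochner_Integration.integrable_bound[OF integrable_mult_right[OF L2_integrable[OF u], of "c2\<^sup>2"]])
    have "(cmod (u x))\<^sup>2 * (\<rho> x)\<^sup>2 \<le> c2\<^sup>2 * (cmod (u x))\<^sup>2" for x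
      using weight_pos[of x] weight_bounds(3)[of x]
      by (subst mult.commute) (intro mult_right_mono power_mono, auto)
    then show "AE x in lebesgue_on S. norm ((cmod (u x * complex_of_real (\<rho> x)))\<^sup>2) \<le> norm (c2\<^sup>2 * (cmod (u x))\<^sup>2)"
      by (intro AE_I2) (simp add: norm_mult power_mult_distrib)
  qed measurable
  then show ?thesis by (simp add: L2_def)
qed

lemma winner_integrable:
  assumes "u \<in> L2 S" "v \<in> L2 S"
  shows "integrable (lebesgue_on S) (\<lambda>x. u x * cnj (v x) * complex_of_real (\<rho> x))"
  using product_integrable[OF L2_weight[OF assms(1)] L2_cnj[OF assms(2)]] by (simp add: mult_ac)

lemma winner_lincomb_left:
  assumes "u \<in> L2 S" "v \<in> L2 S" "w \<in> L2 S"
  shows "winner S \<rho> (\<lambda>x. a * u x + b * v x) w = a * winner S \<rho> u w + b * winner S \<rho> v w"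
proof -
  have "winner S \<rho> (\<lambda>x. a * u x + b * v x) w = (LINT x|lebesgue_on S.
      a * (u x * cnj (w x) * complex_of_real (\<rho> x)) + b * (v x * cnj (w x) * complex_of_real (\<rho> x)))"
    unfolding winner_def by (intro Bochner_Integration.integral_cong) (auto simp: algebra_simps)
  then show ?thesis using winner_integrable[OF assms(1,3)] winner_integrable[OF assms(2,3)]
    by (simp add: winner_def)
qed

lemma winner_sum_left:
  assumes "finite I" "\<And>i. i \<in> I \<Longrightarrow> u i \<in> L2 S" "w \<in> L2 S"
  shows "winner S \<rho> (\<lambda>x. \<Sum>i\<in>I. c i * u i x) w = (\<Sum>i\<in>I. c i * winner S \<rho> (u i) w)"
  using assms
proof (induction I rule: finite_induct)
  case empty
  then show ?case by (simp add: winner_def)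
next
  case (insert i I)
  then show ?case using winner_lincomb_left[OF _ L2_sum, of "u i" I u w "c i" 1 c] by simp
qed

lemma winner_cnj: "winner S \<rho> u v = cnj (winner S \<rho> v u)"
proof -
  have "cnj (winner S \<rho> v u) = (LINT x|lebesgue_on S. cnj (v x * cnj (u x) * complex_of_real (\<rho> x)))"
    unfolding winner_def by (rule Bochner_Integration.integral_cnj[symmetric])
  then show ?thesis by (simp add: winner_def mult_ac)
qed

lemma winner_sum_right:
  assumes "finite I" "\<And>i. i \<in> I \<Longrightarrow> u i \<in> L2 S" "w \<in> L2 S"
  shows "winner S \<rho> w (\<lambda>x. \<Sum>i\<in>I. c i * u i x) = (\<Sum>i\<in>I. cnj (c i) * winner S \<rho> w (u i))"
proof -
  have "winner S \<rho> w (\<lambda>x. \<Sum>i\<in>I. c i * u i x) = cnj (\<Sum>i\<in>I. c i * winner S \<rho> (u i) w)"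
    by (subst winner_cnj) (use winner_sum_left[OF assms] in simp)
  then show ?thesis by (simp add: winner_cnj[of w])
qed

lemma winner_cong_AE:
  assumes u: "u \<in> L2 S" "u' \<in> L2 S" and v: "v \<in> L2 S" "v' \<in> L2 S"
    and "AE x in lebesgue_on S. u x = u' x" "AE x in lebesgue_on S. v x = v' x"
  shows "winner S \<rho> u v = winner S \<rho> u' v'"
  unfolding winner_def
proof (rule integral_cong_AE)
  show "AE x in lebesgue_on S. u x * cnj (v x) * complex_of_real (\<rho> x) = u' x * cnj (v' x) * complex_of_real (\<rho> x)"
    using assms(5,6) by eventually_elim simp
qed (use winner_integrable u v in auto)

abbreviation ip :: "('a \<Rightarrow> complex) \<Rightarrow> ('a \<Rightarrow> complex) \<Rightarrow> real" where
  "ip u v \<equiv> Re (winner S \<rho> u v)"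

lemma ip_self: "ip u u = (LINT x|lebesgue_on S. (cmod (u x))\<^sup>2 * \<rho> x)"
proof -
  have "winner S \<rho> u u = (LINT x|lebesgue_on S. complex_of_real ((cmod (u x))\<^sup>2 * \<rho> x))"
    unfolding winner_def
    by (intro Bochner_Integration.integral_cong) (auto simp: complex_norm_square simp del: of_real_power)
  then show ?thesis by (simp only: integral_complex_of_real Re_complex_of_real)
qed

lemma weighted_sq_integrable: "u \<in> L2 S \<Longrightarrow> integrable (lebesgue_on S) (\<lambda>x. (cmod (u x))\<^sup>2 * \<rho> x)"
proof -
  assume u: "u \<in> L2 S"
  have "integrable (lebesgue_on S) (\<lambda>x. Re (u x * cnj (u x) * complex_of_real (\<rho> x)))"
    using winner_integrable[OF u u] by (rule integrable_Re)
  moreover have e: "Re (u x * cnj (u x) * complex_of_real (\<rho> x)) = (cmod (u x))\<^sup>2 * \<rho> x" for x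
    by (simp add: complex_mult_cnj cmod_power2 del: of_real_add)
  ultimately show ?thesis by (simp only: e)
qed

lemma ip_nonneg: "0 \<le> ip u u"
  unfolding ip_self using weight_pos by (intro integral_nonneg_AE AE_I2) (simp add: less_imp_le)

lemma ip_null_iff:
  assumes "u \<in> L2 S" shows "ip u u = 0 \<longleftrightarrow> (AE x in lebesgue_on S. u x = 0)"
proof -
  have "ip u u = 0 \<longleftrightarrow> (AE x in lebesgue_on S. (cmod (u x))\<^sup>2 * \<rho> x = 0)"
    unfolding ip_self using weight_pos weighted_sq_integrable[OF assms]
    by (intro integral_nonneg_eq_0_iff_AE AE_I2) (auto simp: less_imp_le)
  then show ?thesis using weight_pos by (simp add: less_imp_neq[symmetric])
qed

text \<open>The artificial coefficients bring the pointwise operations into the shape of the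
  linear-combination lemmas, from which linearity of the spaces and forms is read off.\<close>

lemma fun_add_eq: "u + v = (\<lambda>x. 1 * u x + 1 * v x)" for u v :: "'a \<Rightarrow> complex"
  by (simp add: fun_eq_iff)

lemma fun_diff_eq: "u - v = (\<lambda>x. 1 * u x + (-1) * v x)" for u v :: "'a \<Rightarrow> complex"
  by (simp add: fun_eq_iff)

lemma fun_scaleR_eq: "c *\<^sub>R u = (\<lambda>x. complex_of_real c * u x + 0 * u x)" for u :: "'a \<Rightarrow> complex"
  by (simp add: fun_eq_iff scaleR_conv_of_real)

lemma L2_subspace: "subspace (L2 S)"
  unfolding subspace_def
  using L2_zero L2_lincomb[of _ _ 1 1] L2_lincomb[of u u "complex_of_real c" 0 for u c]
  by (simp add: fun_add_eq fun_scaleR_eq zero_fun_def)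

lemma psd_L2: "psd_form (L2 S) ip"
proof
  show "ip (u + v) w = ip u w + ip v w" if "u \<in> L2 S" "v \<in> L2 S" "w \<in> L2 S" for u v w
    unfolding fun_add_eq winner_lincomb_left[OF that] by simp
  show "ip (c *\<^sub>R u) w = c * ip u w" if "u \<in> L2 S" "w \<in> L2 S" for u w c
    unfolding fun_scaleR_eq winner_lincomb_left[OF that(1,1,2)] by simp
  show "ip u v = ip v u" for u v by (subst winner_cnj) simp
qed (simp_all add: L2_subspace ip_nonneg)

lemma test_function_L2:
  assumes p: "\<phi> \<in> test_functions S"
  shows "(\<lambda>x. complex_of_real (\<phi> x)) \<in> L2 S" "b \<in> Basis \<Longrightarrow> (\<lambda>x. complex_of_real (partial b \<phi> x)) \<in> L2 S"
proof -
  define K where "K = closure {x. \<phi> x \<noteq> 0}"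
  have K: "compact K" using p by (simp add: test_functions_def K_def)
  have *: "(\<lambda>x. complex_of_real (f x)) \<in> L2 S" if f: "continuous_on UNIV f" "\<And>x. x \<notin> K \<Longrightarrow> f x = 0" for f
  proof -
    have fm [measurable]: "f \<in> borel_measurable borel" using f(1) by (rule borel_measurable_continuous_onI)
    have "integrable lborel (\<lambda>x. indicator K x *\<^sub>R (f x)\<^sup>2)"
      by (rule borel_integrable_compact[OF K]) (intro continuous_intros continuous_on_subset[OF f(1)], auto)
    moreover have e: "indicator K x *\<^sub>R (f x)\<^sup>2 = (f x)\<^sup>2" for x using f(2)[of x] by (auto simp: indicator_def)
    ultimately have "integrable lborel (\<lambda>x. (f x)\<^sup>2)" by (simp only: e)
    then have "integrable lebesgue (\<lambda>x. (f x)\<^sup>2)" by (subst integrable_completion) auto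
    then have "integrable lebesgue (\<lambda>x. indicator S x *\<^sub>R (f x)\<^sup>2)" by (rule integrable_mult_indicator[OF S_sets])
    then have "integrable (lebesgue_on S) (\<lambda>x. (f x)\<^sup>2)"
      using S_sets by (subst integrable_restrict_space) simp_all
    moreover have "f \<in> borel_measurable (lebesgue_on S)"
      by (intro measurable_restrict_space1 measurable_completion) simp
    ultimately show ?thesis by (simp add: L2_def)
  qed
  have C: "C_k 2 \<phi>" using p by (auto simp: test_functions_def)
  note out = outside_support[of _ \<phi>, folded K_def]
  show "(\<lambda>x. complex_of_real (\<phi> x)) \<in> L2 S"
    using C_k_continuous[OF C] out(1) by (rule *)
  assume b: "b \<in> Basis"
  have "C_k (Suc 0) (partial b \<phi>)" using C b by (simp add: numeral_2_eq_2)
  then show "(\<lambda>x. complex_of_real (partial b \<phi> x)) \<in> L2 S"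
    using C_k_continuous out(2) by (intro *) blast+
qed

text \<open>Two weak derivatives differ by a function orthogonal to all test functions. The choice
  hidden in \<open>wpartial\<close> is therefore harmless.\<close>

lemma weak_partial_unique:
  assumes "weak_partial S b u g" "weak_partial S b u g'"
  shows "AE x in lebesgue_on S. g x = g' x"
proof -
  obtain U where U: "open U" "U \<subseteq> S" "negligible (S - U)" using interior_conull by auto
  have g: "g \<in> L2 S" "g' \<in> L2 S" using assms by (auto simp: weak_partial_def)
  have "AE x in lebesgue_on S. (\<lambda>x. 1 * g x + (-1) * g' x) x = 0"
  proof (rule orth_test_functions_AE_zero[OF L2_lincomb[OF g] S_sets U])
    fix \<phi> assume p: "\<phi> \<in> test_functions S"
    have "(LINT x|lebesgue_on S. g x * complex_of_real (\<phi> x)) = (LINT x|lebesgue_on S. g' x * complex_of_real (\<phi> x))"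
      using assms p unfolding weak_partial_def by (metis neg_equal_iff_equal)
    then show "(LINT x|lebesgue_on S. (1 * g x + (-1) * g' x) * complex_of_real (\<phi> x)) = 0"
      using product_integrable[OF g(1) test_function_L2(1)[OF p]] product_integrable[OF g(2) test_function_L2(1)[OF p]]
      by (simp add: algebra_simps)
  qed
  then show ?thesis by (simp add: algebra_simps)
qed

lemma weak_partial_lincomb:
  assumes u: "u \<in> L2 S" "v \<in> L2 S" and w: "weak_partial S b u g" "weak_partial S b v g'" and b: "b \<in> Basis"
  shows "weak_partial S b (\<lambda>x. a * u x + c * v x) (\<lambda>x. a * g x + c * g' x)"
proof -
  have g: "g \<in> L2 S" "g' \<in> L2 S" using w by (auto simp: weak_partial_def)
  have "(LINT x|lebesgue_on S. (a * u x + c * v x) * complex_of_real (partial b \<phi> x)) =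
      - (LINT x|lebesgue_on S. (a * g x + c * g' x) * complex_of_real (\<phi> x))"
    if p: "\<phi> \<in> test_functions S" for \<phi>
  proof -
    have lin: "(LINT x|lebesgue_on S. (a * s x + c * t x) * r x)
        = a * (LINT x|lebesgue_on S. s x * r x) + c * (LINT x|lebesgue_on S. t x * r x)"
      if "s \<in> L2 S" "t \<in> L2 S" "r \<in> L2 S" for s t r
    proof -
      have "(LINT x|lebesgue_on S. (a * s x + c * t x) * r x)
          = (LINT x|lebesgue_on S. a * (s x * r x) + c * (t x * r x))"
        by (intro Bochner_Integration.integral_cong) (auto simp: algebra_simps)
      then show ?thesis using product_integrable[OF that(1,3)] product_integrable[OF that(2,3)] by simp
    qed
    show ?thesis
      using w p unfolding lin[OF u test_function_L2(2)[OF p b]] lin[OF g test_function_L2(1)[OF p]]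
      by (simp add: weak_partial_def)
  qed
  then show ?thesis using L2_lincomb[OF g] by (simp add: weak_partial_def)
qed

section \<open>The space \<open>H1\<close> and the Dirichlet form\<close>

lemma H1_L2: "u \<in> H1 S \<Longrightarrow> u \<in> L2 S" by (simp add: H1_def)

lemma wpartial: "\<lbrakk>u \<in> H1 S; b \<in> Basis\<rbrakk> \<Longrightarrow> weak_partial S b u (wpartial S b u)"
  unfolding wpartial_def by (rule someI_ex[of "weak_partial S b u"]) (auto simp: H1_def)

lemma wpartial_L2: "\<lbrakk>u \<in> H1 S; b \<in> Basis\<rbrakk> \<Longrightarrow> wpartial S b u \<in> L2 S"
  using wpartial by (auto simp: weak_partial_def)

lemma H1_lincomb: "\<lbrakk>u \<in> H1 S; v \<in> H1 S\<rbrakk> \<Longrightarrow> (\<lambda>x. a * u x + c * v x) \<in> H1 S"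
  using L2_lincomb weak_partial_lincomb unfolding H1_def by blast

lemma H1_zero: "(\<lambda>x. 0) \<in> H1 S"
proof -
  have "weak_partial S b (\<lambda>x. 0) (\<lambda>x. 0)" for b by (simp add: weak_partial_def L2_zero)
  then show ?thesis using L2_zero by (auto simp: H1_def)
qed

lemma weak_partial_sum:
  assumes "finite I" "\<And>i. i \<in> I \<Longrightarrow> u i \<in> L2 S" "\<And>i. i \<in> I \<Longrightarrow> weak_partial S b (u i) (g i)" "b \<in> Basis"
  shows "weak_partial S b (\<lambda>x. \<Sum>i\<in>I. c i * u i x) (\<lambda>x. \<Sum>i\<in>I. c i * g i x)"
  using assms
proof (induction I rule: finite_induct)
  case empty
  show ?case by (simp add: weak_partial_def L2_zero)
next
  case (insert i I)
  then show ?case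
    using weak_partial_lincomb[where u = "u i" and v = "\<lambda>x. \<Sum>i\<in>I. c i * u i x" and b = b and a = "c i"
        and c = 1 and g = "g i" and g' = "\<lambda>x. \<Sum>i\<in>I. c i * g i x"] L2_sum[of I u c] by simp
qed

lemma H1_sum:
  assumes "finite I" "\<And>i. i \<in> I \<Longrightarrow> u i \<in> H1 S"
  shows "(\<lambda>x. \<Sum>i\<in>I. c i * u i x) \<in> H1 S"
proof -
  have "weak_partial S b (\<lambda>x. \<Sum>i\<in>I. c i * u i x) (\<lambda>x. \<Sum>i\<in>I. c i * wpartial S b (u i) x)" if "b \<in> Basis" for b
    using assms that by (intro weak_partial_sum H1_L2 wpartial)
  moreover have "(\<lambda>x. \<Sum>i\<in>I. c i * u i x) \<in> L2 S" using assms(2) by (intro L2_sum H1_L2)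
  ultimately show ?thesis unfolding H1_def by blast
qed

text \<open>Uniqueness allows the chosen derivatives to be replaced by explicit ones, both for
  linear combinations and for the trial functions.\<close>

lemma dirichlet_form_eq:
  assumes gu: "\<And>b. b \<in> Basis \<Longrightarrow> weak_partial S b u (gu b)" and u: "u \<in> L2 S"
    and gv: "\<And>b. b \<in> Basis \<Longrightarrow> weak_partial S b v (gv b)" and v: "v \<in> L2 S"
  shows "dirichlet_form S u v = (LINT x|lebesgue_on S. (\<Sum>b\<in>Basis. gu b x * cnj (gv b x)))"
proof -
  have H: "u \<in> H1 S" "v \<in> H1 S" using assms by (auto simp: H1_def)
  have L: "b \<in> Basis \<Longrightarrow> gu b \<in> L2 S" "b \<in> Basis \<Longrightarrow> gv b \<in> L2 S" for b
    using gu gv by (auto simp: weak_partial_def)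
  have i: "integrable (lebesgue_on S) (\<lambda>x. \<Sum>b\<in>Basis. s b x * cnj (t b x))"
    if "\<And>b. b \<in> Basis \<Longrightarrow> s b \<in> L2 S" "\<And>b. b \<in> Basis \<Longrightarrow> t b \<in> L2 S" for s t :: "'a \<Rightarrow> 'a \<Rightarrow> complex"
    using that by (intro Bochner_Integration.integrable_sum product_integrable L2_cnj) auto
  have "AE x in lebesgue_on S. \<forall>b\<in>Basis. wpartial S b u x = gu b x \<and> wpartial S b v x = gv b x"
  proof (intro AE_finite_allI AE_conjI)
    fix b :: 'a assume b: "b \<in> Basis"
    show "AE x in lebesgue_on S. wpartial S b u x = gu b x"
      by (rule weak_partial_unique[OF wpartial[OF H(1) b] gu[OF b]])
    show "AE x in lebesgue_on S. wpartial S b v x = gv b x"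
      by (rule weak_partial_unique[OF wpartial[OF H(2) b] gv[OF b]])
  qed simp
  then show ?thesis
    unfolding dirichlet_form_def
    by (intro integral_cong_AE borel_measurable_integrable i wpartial_L2 H L)
      (auto elim!: eventually_mono)
qed

lemma dirichlet_form_lincomb_left:
  assumes u: "u \<in> H1 S" and v: "v \<in> H1 S" and w: "w \<in> H1 S"
  shows "dirichlet_form S (\<lambda>x. a * u x + c * v x) w = a * dirichlet_form S u w + c * dirichlet_form S v w"
proof -
  have i: "integrable (lebesgue_on S) (\<lambda>x. \<Sum>b\<in>Basis. wpartial S b s x * cnj (wpartial S b t x))"
    if "s \<in> H1 S" "t \<in> H1 S" for s t
    using that by (intro Bochner_Integration.integrable_sum product_integrable L2_cnj wpartial_L2) auto
  have "dirichlet_form S (\<lambda>x. a * u x + c * v x) w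
      = (LINT x|lebesgue_on S. (\<Sum>b\<in>Basis. (a * wpartial S b u x + c * wpartial S b v x) * cnj (wpartial S b w x)))"
    by (intro dirichlet_form_eq weak_partial_lincomb wpartial H1_L2 L2_lincomb assms)
  also have "\<dots> = (LINT x|lebesgue_on S. a * (\<Sum>b\<in>Basis. wpartial S b u x * cnj (wpartial S b w x))
        + c * (\<Sum>b\<in>Basis. wpartial S b v x * cnj (wpartial S b w x)))"
    by (intro Bochner_Integration.integral_cong) (auto simp: sum_distrib_left sum.distrib algebra_simps)
  also have "\<dots> = a * dirichlet_form S u w + c * dirichlet_form S v w"
    using i[OF u w] i[OF v w] by (simp add: dirichlet_form_def)
  finally show ?thesis .
qed

lemma dirichlet_form_cnj: "dirichlet_form S u v = cnj (dirichlet_form S v u)"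
proof -
  have "cnj (dirichlet_form S v u)
      = (LINT x|lebesgue_on S. cnj (\<Sum>b\<in>Basis. wpartial S b v x * cnj (wpartial S b u x)))"
    unfolding dirichlet_form_def by (rule Bochner_Integration.integral_cnj[symmetric])
  then show ?thesis by (simp add: dirichlet_form_def mult_ac)
qed

abbreviation en :: "('a \<Rightarrow> complex) \<Rightarrow> ('a \<Rightarrow> complex) \<Rightarrow> real" where
  "en u v \<equiv> Re (dirichlet_form S u v)"

lemma en_self_eq:
  assumes "\<And>b. b \<in> Basis \<Longrightarrow> weak_partial S b u (g b)" "u \<in> L2 S"
  shows "en u u = (LINT x|lebesgue_on S. (\<Sum>b\<in>Basis. (cmod (g b x))\<^sup>2))"
proof -
  have "dirichlet_form S u u = (LINT x|lebesgue_on S. complex_of_real (\<Sum>b\<in>Basis. (cmod (g b x))\<^sup>2))"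
  proof -
    have "dirichlet_form S u u = (LINT x|lebesgue_on S. (\<Sum>b\<in>Basis. g b x * cnj (g b x)))"
      by (rule dirichlet_form_eq) (use assms in auto)
    also have "\<dots> = (LINT x|lebesgue_on S. complex_of_real (\<Sum>b\<in>Basis. (cmod (g b x))\<^sup>2))"
      by (intro Bochner_Integration.integral_cong) (auto simp: complex_norm_square simp del: of_real_power)
    finally show ?thesis .
  qed
  then show ?thesis by (simp only: integral_complex_of_real Re_complex_of_real)
qed

lemma H1_subspace: "subspace (H1 S)"
  unfolding subspace_def
  using H1_zero H1_lincomb[of _ _ 1 1] H1_lincomb[of u u "complex_of_real c" 0 for u c]
  by (simp add: fun_add_eq fun_scaleR_eq zero_fun_def)

lemma psd_H1: "psd_form (H1 S) en"
proof
  show "en (u + v) w = en u w + en v w" if "u \<in> H1 S" "v \<in> H1 S" "w \<in> H1 S" for u v w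
    unfolding fun_add_eq dirichlet_form_lincomb_left[OF that] by simp
  show "en (c *\<^sub>R u) w = c * en u w" if "u \<in> H1 S" "w \<in> H1 S" for u w c
    unfolding fun_scaleR_eq dirichlet_form_lincomb_left[OF that(1,1,2)] by simp
  show "en u v = en v u" for u v by (subst dirichlet_form_cnj) simp
  show "0 \<le> en u u" if "u \<in> H1 S" for u
  proof -
    have "en u u = (LINT x|lebesgue_on S. (\<Sum>b\<in>Basis. (cmod (wpartial S b u x))\<^sup>2))"
      by (rule en_self_eq) (use wpartial[OF that] H1_L2[OF that] in auto)
    then show ?thesis by (simp add: integral_nonneg_AE sum_nonneg)
  qed
qed (simp add: H1_subspace)

section \<open>The Neumann operator as an instance of the abstract theory\<close>

abbreviation \<A> :: "(('a \<Rightarrow> complex) \<times> ('a \<Rightarrow> complex)) set" where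
  "\<A> \<equiv> neumann_operator S \<rho>"

lemma operator_null:
  assumes uw: "(u, w) \<in> \<A>" and w': "w' \<in> L2 S" "AE x in lebesgue_on S. w' x = w x"
  shows "(u, w') \<in> \<A>"
proof -
  have "winner S \<rho> w' v = winner S \<rho> w v" if "v \<in> H1 S" for v
    using uw w' H1_L2[OF that] by (intro winner_cong_AE) (auto simp: neumann_operator_def)
  then show ?thesis using uw w' by (auto simp: neumann_operator_def)
qed

lemma L2_diff_AE:
  assumes "u \<in> L2 S" "v \<in> L2 S" shows "ip (u - v) (u - v) = 0 \<longleftrightarrow> (AE x in lebesgue_on S. u x = v x)"
  using ip_null_iff[of "u - v"] L2_lincomb[OF assms, of 1 "-1"] by (simp add: fun_diff_eq)

text \<open>For completeness, the lower bound \<open>c1\<close> of the weight turns weighted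
  increments into plain ones, and the upper bound \<open>c2\<close> turns plain convergence back
  into weighted convergence.\<close>

sublocale form_operator "L2 S" "H1 S" ip en \<A>
proof -
  interpret H: psd_form "L2 S" ip by (rule psd_L2)
  interpret V: psd_form "H1 S" en by (rule psd_H1)
  show "form_operator (L2 S) (H1 S) ip en \<A>"
  proof
    show "subspace \<A>"
      unfolding subspace_def
    proof (intro conjI ballI allI)
      show "0 \<in> \<A>"
        using dirichlet_form_lincomb_left[OF H1_zero H1_zero, of _ 0 0]
        by (auto simp: neumann_operator_def zero_prod_def H1_zero L2_zero winner_def zero_fun_def)
      show "p + q \<in> \<A>" if "p \<in> \<A>" "q \<in> \<A>" for p q
        using that H1_lincomb[of "fst p" "fst q" 1 1] L2_lincomb[of "snd p" "snd q" 1 1]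
          dirichlet_form_lincomb_left[of "fst p" "fst q" _ 1 1]
          winner_lincomb_left[of "snd p" "snd q" _ 1 1] H1_L2
        by (auto simp: neumann_operator_def fun_add_eq)
      show "c *\<^sub>R p \<in> \<A>" if "p \<in> \<A>" for c p
        using that H1_lincomb[of "fst p" "fst p" "complex_of_real c" 0]
          L2_lincomb[of "snd p" "snd p" "complex_of_real c" 0]
          dirichlet_form_lincomb_left[of "fst p" "fst p" _ "complex_of_real c" 0]
          winner_lincomb_left[of "snd p" "snd p" _ "complex_of_real c" 0] H1_L2
        by (auto simp: neumann_operator_def fun_scaleR_eq)
    qed
    show "(u, w') \<in> \<A>" if "(u, w) \<in> \<A>" "w' \<in> L2 S" "ip (w' - w) (w' - w) = 0" for u w w'
      using operator_null[OF that(1,2)] L2_diff_AE[OF that(2), of w] that(1,3)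
      by (auto simp: neumann_operator_def)
    show "\<exists>g\<in>L2 S. (\<lambda>n. ip (f n - g) (f n - g)) \<longlonglongrightarrow> 0"
      if f: "\<And>n. f n \<in> L2 S" and C: "\<And>n. ip (f (Suc n) - f n) (f (Suc n) - f n) \<le> C / 4 ^ n" for f C
    proof -
      have fd: "(\<lambda>x. f n x - f m x) \<in> L2 S" for n m
        using L2_lincomb[OF f[of n] f[of m], of 1 "-1"] by simp
      have bd: "(LINT x|lebesgue_on S. (cmod (f (Suc n) x - f n x))\<^sup>2) \<le> (C / c1) / 4 ^ n" for n
      proof -
        have "c1 * (LINT x|lebesgue_on S. (cmod (f (Suc n) x - f n x))\<^sup>2)
            = (LINT x|lebesgue_on S. (cmod (f (Suc n) x - f n x))\<^sup>2 * c1)" by (simp add: mult.commute)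
        also have "\<dots> \<le> (LINT x|lebesgue_on S. (cmod (f (Suc n) x - f n x))\<^sup>2 * \<rho> x)"
          using L2_integrable[OF fd[of "Suc n" n]] weighted_sq_integrable[OF fd[of "Suc n" n]] weight_bounds(2)
          by (intro integral_mono) (auto intro: mult_left_mono)
        also have "\<dots> \<le> C / 4 ^ n" using C[of n] by (simp add: ip_self)
        finally show ?thesis using weight_bounds(1) by (simp add: field_simps)
      qed
      obtain g where g: "g \<in> borel_measurable (lebesgue_on S)" "integrable (lebesgue_on S) (\<lambda>x. (cmod (g x))\<^sup>2)"
        "(\<lambda>n. LINT x|lebesgue_on S. (cmod (f n x - g x))\<^sup>2) \<longlonglongrightarrow> 0"
        using square_integrable_complete[of f, OF L2_measurable[OF f] L2_integrable[OF f] bd] by auto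
      have gL: "g \<in> L2 S" using g by (simp add: L2_def)
      have fg: "(\<lambda>x. f n x - g x) \<in> L2 S" for n using L2_lincomb[OF f[of n] gL, of 1 "-1"] by simp
      have "(\<lambda>n. ip (f n - g) (f n - g)) \<longlonglongrightarrow> 0"
      proof (rule tendsto_sandwich[OF _ _ tendsto_const])
        show "\<forall>\<^sub>F n in sequentially. ip (f n - g) (f n - g) \<le> c2 * (LINT x|lebesgue_on S. (cmod (f n x - g x))\<^sup>2)"
        proof (rule always_eventually, rule allI)
          fix n
          have "ip (f n - g) (f n - g) = (LINT x|lebesgue_on S. (cmod (f n x - g x))\<^sup>2 * \<rho> x)" by (simp add: ip_self)
          also have "\<dots> \<le> (LINT x|lebesgue_on S. (cmod (f n x - g x))\<^sup>2 * c2)"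
            using L2_integrable[OF fg[of n]] weighted_sq_integrable[OF fg[of n]] weight_bounds(3)
            by (intro integral_mono) (auto intro: mult_left_mono)
          finally show "ip (f n - g) (f n - g) \<le> c2 * (LINT x|lebesgue_on S. (cmod (f n x - g x))\<^sup>2)"
            by (simp add: mult.commute)
        qed
        show "(\<lambda>n. c2 * (LINT x|lebesgue_on S. (cmod (f n x - g x))\<^sup>2)) \<longlonglongrightarrow> 0"
          using tendsto_mult_left[OF g(3), of c2] by simp
      qed (simp add: ip_nonneg)
      then show ?thesis using gL by blast
    qed
  qed (auto simp: neumann_operator_def H1_L2)
qed

text \<open>The resolvent equation is given only almost everywhere; changing the image on a null set
  makes it exact.\<close>

lemma real_resolvent:
  assumes "complex_of_real z \<in> resolvent_set S \<rho> \<A>"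
  shows "z \<in> resolvent"
  unfolding resolvent_def
proof (intro CollectI conjI ballI)
  fix f assume f: "f \<in> L2 S"
  obtain u w where uw: "(u, w) \<in> \<A>" "AE x in lebesgue_on S. w x - complex_of_real z * u x = f x"
    using assms f by (auto simp: resolvent_set_def)
  have "z *\<^sub>R u + f \<in> L2 S" using A_dom[OF uw(1)] f by simp
  then have "(u, z *\<^sub>R u + f) \<in> \<A>"
    by (rule operator_null[OF uw(1)])
      (use uw(2) in \<open>auto elim!: eventually_mono simp: scaleR_conv_of_real algebra_simps\<close>)
  then show "\<exists>u. (u, z *\<^sub>R u + f) \<in> \<A>" by blast
next
  have "(\<lambda>x. w x - complex_of_real z * u x) = w - z *\<^sub>R u" for u w :: "'a \<Rightarrow> complex"
    by (simp add: fun_eq_iff scaleR_conv_of_real)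
  then show "\<exists>C. \<forall>u w. (u, w) \<in> \<A> \<longrightarrow> H.nrm u \<le> C * H.nrm (w - z *\<^sub>R u)"
    using assms by (auto simp: resolvent_set_def wnorm_def)
qed

lemma eigenspace_iff: "u \<in> eigenspace S \<A> (complex_of_real z) \<longleftrightarrow> (u, z *\<^sub>R u) \<in> \<A>"
proof
  assume "u \<in> eigenspace S \<A> (complex_of_real z)"
  then obtain w where w: "(u, w) \<in> \<A>" "AE x in lebesgue_on S. w x = complex_of_real z * u x"
    by (auto simp: eigenspace_def)
  have "z *\<^sub>R u \<in> L2 S" using A_dom[OF w(1)] by simp
  then show "(u, z *\<^sub>R u) \<in> \<A>"
    by (rule operator_null[OF w(1)]) (use w(2) in \<open>auto elim!: eventually_mono simp: scaleR_conv_of_real\<close>)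
qed (auto simp: eigenspace_def scaleR_conv_of_real intro!: exI[of _ "z *\<^sub>R u"])

lemma discrete_isolated:
  assumes "purely_discrete S \<rho> \<A>" "\<mu> \<notin> resolvent"
  shows "\<exists>t>0. \<forall>z. z \<noteq> \<mu> \<longrightarrow> \<bar>z - \<mu>\<bar> < t \<longrightarrow> z \<in> resolvent"
proof -
  have "complex_of_real \<mu> \<in> op_spectrum S \<rho> \<A>"
    using assms(2) real_resolvent by (auto simp: op_spectrum_def)
  then have "\<not> complex_of_real \<mu> islimpt op_spectrum S \<rho> \<A>"
    using assms(1) by (auto simp: purely_discrete_def)
  then obtain t where t: "t > 0" "\<And>y. y \<in> op_spectrum S \<rho> \<A> \<Longrightarrow> y \<noteq> complex_of_real \<mu> \<Longrightarrow> \<not> dist y (complex_of_real \<mu>) < t"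
    unfolding islimpt_approachable by blast
  have "z \<in> resolvent" if "z \<noteq> \<mu>" "\<bar>z - \<mu>\<bar> < t" for z
  proof -
    have "dist (complex_of_real z) (complex_of_real \<mu>) < t"
      using that by (simp add: dist_real_def)
    then have "complex_of_real z \<notin> op_spectrum S \<rho> \<A>" using t(2) that(1) by force
    then show ?thesis by (intro real_resolvent) (simp add: op_spectrum_def)
  qed
  then show ?thesis using t(1) by auto
qed

text \<open>The form is nonnegative on an eigenvector, and linear independence of a basis of the
  eigenspace keeps that eigenvector from being null.\<close>

lemma eigenvalue_nonneg:
  assumes ev: "eigenvalue_sequence S \<A> ev"
  shows "0 \<le> ev k"
proof -
  define z where "z = complex_of_real (ev k)"
  define m where "m = card {j. complex_of_real (ev j) = z}"
  have "finite {j. complex_of_real (ev j) = z}" and hd: "has_dim S (eigenspace S \<A> z) m"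
    using ev by (auto simp: eigenvalue_sequence_def m_def)
  \<comment> \<open>The index \<open>k\<close> itself belongs to the set counted by
    \<open>m\<close>, so the eigenspace has positive dimension.\<close>
  then have m: "m > 0" unfolding m_def by (subst card_gt_0_iff) (auto simp: z_def)
  obtain e where e: "\<And>i. i < m \<Longrightarrow> e i \<in> eigenspace S \<A> z"
    "\<And>c. (AE x in lebesgue_on S. (\<Sum>i<m. c i * e i x) = 0) \<Longrightarrow> \<forall>i<m. c i = 0"
    using hd unfolding has_dim_def by blast
  have A: "(e 0, ev k *\<^sub>R e 0) \<in> \<A>" using e(1)[OF m] by (simp add: z_def eigenspace_iff)
  have L: "e 0 \<in> L2 S" "e 0 \<in> H1 S" using A A_dom A_dom_H by auto
  have "\<not> (AE x in lebesgue_on S. e 0 x = 0)"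
  proof
    assume "AE x in lebesgue_on S. e 0 x = 0"
    moreover have "(\<Sum>i<m. (if i = 0 then 1 else 0) * e i x) = e 0 x" for x
      using m by (simp add: if_distrib[of "\<lambda>t. t * _"] sum.delta cong: if_cong)
    ultimately show False using e(2)[of "\<lambda>i. if i = 0 then 1 else 0"] m by auto
  qed
  then have "0 < ip (e 0) (e 0)" using ip_null_iff[OF L(1)] ip_nonneg[of "e 0"] by linarith
  moreover have "en (e 0) (e 0) = ev k * ip (e 0) (e 0)" using A_form[OF A L(2)] L by (simp add: H.expand)
  moreover have "0 \<le> en (e 0) (e 0)" by (rule V.nonneg[OF L(2)])
  ultimately show ?thesis by (simp add: zero_le_mult_iff)
qed

text \<open>The half of the min-max principle that bounds eigenvalues from above: with fewer
  orthogonality conditions than trial functions, some combination lies in the complement of the low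
  eigenvectors, where the Rayleigh quotient is large.\<close>

theorem eigenvalue_le_Rayleigh:
  assumes disc: "purely_discrete S \<rho> \<A>" and ev: "eigenvalue_sequence S \<A> ev"
    and I: "finite I" "k < card I" and u: "\<And>i. i \<in> I \<Longrightarrow> u i \<in> H1 S"
    and quot: "\<And>c. \<exists>i\<in>I. c i \<noteq> 0 \<Longrightarrow> 0 < ip (\<lambda>x. \<Sum>i\<in>I. c i * u i x) (\<lambda>x. \<Sum>i\<in>I. c i * u i x)"
      "\<And>c. en (\<lambda>x. \<Sum>i\<in>I. c i * u i x) (\<lambda>x. \<Sum>i\<in>I. c i * u i x)
        \<le> \<delta> * ip (\<lambda>x. \<Sum>i\<in>I. c i * u i x) (\<lambda>x. \<Sum>i\<in>I. c i * u i x)"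
  shows "ev k \<le> \<delta>"
proof (rule ccontr)
  assume "\<not> ev k \<le> \<delta>"
  \<comment> \<open>Strictly between \<open>\<delta>\<close> and \<open>ev k\<close>: being larger
    than \<open>\<delta>\<close> it contradicts \<open>quot\<close>, and being smaller than
    \<open>ev k\<close> it leaves at most \<open>k\<close> indices with eigenvalue up to
    \<open>\<delta>'\<close>.\<close>
  define \<delta>' where "\<delta>' = (\<delta> + ev k) / 2"
  have d: "\<delta> < \<delta>'" "\<delta>' < ev k" using \<open>\<not> ev k \<le> \<delta>\<close> by (auto simp: \<delta>'_def)
  have mono: "mono ev" using ev by (simp add: eigenvalue_sequence_def)
  define J where "J = {j. ev j \<le> \<delta>'}"
  have J: "J \<subseteq> {..<k}"
    unfolding J_def using mono d(2) by (auto simp: not_le[symmetric] dest!: monoD[OF mono])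
  then have Jf: "finite J" and Jc: "card J \<le> k"
    using card_mono[OF _ J] by (auto intro: finite_subset)
  define m where "m z = card {j. ev j = z}" for z
  have "has_dim S (eigenspace S \<A> (complex_of_real z)) (m z)" for z
    using ev by (auto simp: eigenvalue_sequence_def m_def dest: spec[of _ "complex_of_real z"])
  then have "\<forall>z. \<exists>e. (\<forall>i<m z. e i \<in> eigenspace S \<A> (complex_of_real z)) \<and>
     (\<forall>u\<in>eigenspace S \<A> (complex_of_real z). \<exists>c. AE x in lebesgue_on S. u x = (\<Sum>i<m z. c i * e i x))"
    unfolding has_dim_def by blast
  from choice[OF this] obtain e where "\<forall>z. (\<forall>i<m z. e z i \<in> eigenspace S \<A> (complex_of_real z)) \<and>
     (\<forall>u\<in>eigenspace S \<A> (complex_of_real z). \<exists>c. AE x in lebesgue_on S. u x = (\<Sum>i<m z. c i * e z i x))"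
    by blast
  then have e: "\<And>z i. i < m z \<Longrightarrow> e z i \<in> eigenspace S \<A> (complex_of_real z)"
    "\<And>z u. u \<in> eigenspace S \<A> (complex_of_real z) \<Longrightarrow> \<exists>c. AE x in lebesgue_on S. u x = (\<Sum>i<m z. c i * e z i x)"
    by blast+
  have eL: "e z i \<in> L2 S" if "i < m z" for z i
    using e(1)[OF that] A_dom_H eigenspace_iff by blast
  \<comment> \<open>\<open>P\<close> labels one basis vector for every eigenvalue up to
    \<open>\<delta>'\<close>, counted with multiplicity, so \<open>card P = card J\<close>.\<close>
  define P where "P = (SIGMA z:ev ` J. {..<m z})"
  have finP: "finite P" unfolding P_def using Jf by auto
  have "card P = (\<Sum>z\<in>ev ` J. m z)" unfolding P_def using Jf by simp
  also have "\<dots> = (\<Sum>z\<in>ev ` J. card {j \<in> J. ev j = z})"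
    by (intro sum.cong) (auto simp: m_def J_def intro!: arg_cong[of _ _ card])
  also have "\<dots> = card J" using sum.image_gen[OF Jf, of "\<lambda>_. 1::nat" ev] by simp
  finally have "card P < card I" using Jc I(2) by simp
  then obtain c where c: "\<exists>i\<in>I. c i \<noteq> 0"
    "\<And>p. p \<in> P \<Longrightarrow> (\<Sum>i\<in>I. c i * winner S \<rho> (u i) (e (fst p) (snd p))) = 0"
    using homogeneous_system[OF finP I(1), of "\<lambda>p i. winner S \<rho> (u i) (e (fst p) (snd p))"] by blast
  define U where "U = (\<lambda>x. \<Sum>i\<in>I. c i * u i x)"
  have uL: "i \<in> I \<Longrightarrow> u i \<in> L2 S" for i using u H1_L2 by blast
  have UL: "U \<in> L2 S" unfolding U_def using uL by (rule L2_sum)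
  have UH: "U \<in> H1 S"
    unfolding U_def using I(1) u by (rule H1_sum)
  have orth: "winner S \<rho> U (e z i) = 0" if "z \<le> \<delta>'" "i < m z" for z i
  proof -
    have "{j. ev j = z} \<noteq> {}" using that(2) by (intro notI) (simp add: m_def)
    then have "z \<in> ev ` J" using that(1) by (auto simp: J_def)
    then have "(z, i) \<in> P" using that(2) by (simp add: P_def)
    from c(2)[OF this] show ?thesis
      unfolding U_def using winner_sum_left[OF I(1) uL eL[OF that(2)]] by simp
  qed
  have "U \<in> eigen_orth \<delta>'"
    unfolding eigen_orth_def
  proof (intro CollectI conjI allI impI UL)
    fix z f assume z: "z \<le> \<delta>'" and f: "(f, z *\<^sub>R f) \<in> \<A>"
    then obtain b where b: "AE x in lebesgue_on S. f x = (\<Sum>i<m z. b i * e z i x)"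
      using e(2) eigenspace_iff by blast
    \<comment> \<open>The full complex product with each basis vector vanishes, hence so does the
      one with any complex combination of them.\<close>
    have "winner S \<rho> U f = winner S \<rho> U (\<lambda>x. \<Sum>i<m z. b i * e z i x)"
      using b f by (intro winner_cong_AE UL L2_sum eL) auto
    also have "\<dots> = (\<Sum>i<m z. cnj (b i) * winner S \<rho> U (e z i))"
      by (rule winner_sum_right) (auto simp: eL UL)
    also have "\<dots> = 0" using orth[OF z] by (intro sum.neutral) auto
    finally show "ip U f = 0" by simp
  qed
  then have "\<delta>' * ip U U \<le> en U U"
    using UH discrete_isolated[OF disc] by (intro form_ge_on_eigen_orth) auto
  moreover have "en U U \<le> \<delta> * ip U U" "0 < ip U U" using quot(1)[OF c(1)] quot(2)[of c] by (auto simp: U_def)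
  ultimately show False using d(1) mult_strict_right_mono[of \<delta> \<delta>' "ip U U"] by linarith
qed

end

section \<open>Weak derivatives of cut-off Lipschitz functions\<close>

lemma integral_lborel_translate:
  fixes f :: "'a::euclidean_space \<Rightarrow> real"
  assumes [measurable]: "f \<in> borel_measurable borel"
  shows "(LINT x|lborel. f (x + c)) = (LINT x|lborel. f x)"
proof -
  have "(LINT x|lborel. f x) = (LINT x|distr lborel borel ((+) c). f x)" by (simp add: lborel_distr_plus)
  also have "\<dots> = (LINT x|lborel. f (c + x))" by (rule integral_distr) auto
  finally show ?thesis by (simp add: add.commute)
qed

text \<open>Translation invariance makes the integral of every difference quotient vanish.\<close>

lemma integral_directional_derivative_zero:
  fixes \<psi> D :: "'a::euclidean_space \<Rightarrow> real"
  assumes lip: "\<And>x y. \<bar>\<psi> x - \<psi> y\<bar> \<le> L * norm (x - y)" and supp: "\<And>x. \<psi> x \<noteq> 0 \<Longrightarrow> norm x \<le> M"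
    and D: "D \<in> borel_measurable borel"
    and deriv: "AE x in lborel. ((\<lambda>t. (\<psi> (x + t *\<^sub>R b) - \<psi> x) / t) \<longlongrightarrow> D x) (at 0)"
  shows "(LINT x|lborel. D x) = 0"
proof -
  have L0: "0 \<le> L"
  proof -
    obtain e :: 'a where "e \<in> Basis" using nonempty_Basis by blast
    then show ?thesis using lip[of e 0] by simp
  qed
  have cont: "continuous_on UNIV \<psi>"
    by (rule lipschitz_on_continuous_on[of L]) (auto simp: lipschitz_on_def dist_norm L0 lip)
  then have meas [measurable]: "\<psi> \<in> borel_measurable borel" by (rule borel_measurable_continuous_onI)
  have int: "integrable lborel \<psi>"
  proof -
    have "integrable lborel (\<lambda>x. indicator (cball 0 M) x *\<^sub>R \<psi> x)"
      by (rule borel_integrable_compact) (auto intro: continuous_on_subset[OF cont])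
    moreover have e: "indicator (cball 0 M) x *\<^sub>R \<psi> x = \<psi> x" for x
      using supp[of x] by (auto simp: indicator_def)
    ultimately show ?thesis by (simp only: e)
  qed
  define t where "t n = 1 / real (Suc n)" for n
  have t: "0 < t n" "t n \<le> 1" for n by (auto simp: t_def)
  have t0: "t \<longlonglongrightarrow> 0" unfolding t_def by (rule LIMSEQ_Suc[OF lim_const_over_n])
  define Q where "Q n x = (\<psi> (x + t n *\<^sub>R b) - \<psi> x) / t n" for n x
  have Q_zero: "(LINT x|lborel. Q n x) = 0" for n
  proof -
    have i: "integrable lborel (\<lambda>x. \<psi> (x + t n *\<^sub>R b))"
    proof -
      have "integrable (distr lborel borel ((+) (t n *\<^sub>R b))) \<psi>" using int by (simp add: lborel_distr_plus)
      then have "integrable lborel (\<lambda>x. \<psi> (t n *\<^sub>R b + x))" by (subst (asm) integrable_distr_eq) auto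
      then show ?thesis by (simp add: add.commute)
    qed
    show ?thesis
      using int i integral_lborel_translate[OF meas, of "t n *\<^sub>R b"] by (simp add: Q_def)
  qed
  have "(\<lambda>n. LINT x|lborel. Q n x) \<longlonglongrightarrow> (LINT x|lborel. D x)"
  \<comment> \<open>The quotients are at most \<open>L * norm b\<close>, and because
    \<open>t n \<le> 1\<close> they vanish outside the ball enlarged by
    \<open>norm b\<close>.\<close>
  proof (rule integral_dominated_convergence[where w = "\<lambda>x. L * norm b * indicator (cball 0 (M + norm b)) x"])
    show "integrable lborel (\<lambda>x. L * norm b * indicator (cball (0::'a) (M + norm b)) x)"
      by (intro integrable_mult_right integrable_real_indicator)
        (use emeasure_bounded_finite[OF bounded_cball, of "0::'a" "M + norm b"] in auto)
    show "AE x in lborel. (\<lambda>n. Q n x) \<longlonglongrightarrow> D x"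
      using deriv
    proof eventually_elim
      case (elim x)
      have "filterlim t (at 0) sequentially"
        using t t0 by (intro filterlim_atI) (auto simp: less_imp_neq[symmetric])
      from filterlim_compose[OF elim this] show ?case by (simp add: Q_def)
    qed
    show "AE x in lborel. norm (Q n x) \<le> L * norm b * indicator (cball 0 (M + norm b)) x" for n
    proof (rule AE_I2)
      fix x
      have "\<bar>\<psi> (x + t n *\<^sub>R b) - \<psi> x\<bar> \<le> L * (t n * norm b)"
        using lip[of "x + t n *\<^sub>R b" x] t[of n] by simp
      then have "norm (Q n x) \<le> L * norm b" using t[of n] by (simp add: Q_def field_simps)
      moreover have "Q n x = 0" if x: "x \<notin> cball 0 (M + norm b)"
      proof -
        have n: "M + norm b < norm x" using x by simp
        have "norm x \<le> norm (x + t n *\<^sub>R b) + norm (t n *\<^sub>R b)"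
          using norm_triangle_ineq4[of "x + t n *\<^sub>R b" "t n *\<^sub>R b"] by simp
        moreover have "norm (t n *\<^sub>R b) \<le> norm b" using t[of n] by (simp add: mult_left_le_one_le)
        ultimately have "M < norm (x + t n *\<^sub>R b)" using n by linarith
        then have "\<psi> (x + t n *\<^sub>R b) = 0" using supp[of "x + t n *\<^sub>R b"] by force
        moreover have "\<psi> x = 0" using supp[of x] n norm_ge_zero[of b] by force
        ultimately show ?thesis by (simp add: Q_def)
      qed
      ultimately show "norm (Q n x) \<le> L * norm b * indicator (cball 0 (M + norm b)) x"
        by (cases "x \<in> cball 0 (M + norm b)") auto
    qed
  qed (use D in \<open>auto simp: Q_def\<close>)
  then show ?thesis by (simp add: Q_zero LIMSEQ_const_iff)
qed

text \<open>The partial derivatives are continuous with compact support, hence bounded, and the mean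
  value inequality applies.\<close>

lemma test_function_Lipschitz:
  fixes \<phi> :: "'a::euclidean_space \<Rightarrow> real"
  assumes p: "\<phi> \<in> test_functions S"
  obtains L B M where "0 \<le> L" "\<And>x y. \<bar>\<phi> x - \<phi> y\<bar> \<le> L * norm (x - y)"
    "\<And>x. \<bar>\<phi> x\<bar> \<le> B" "\<And>x. \<phi> x \<noteq> 0 \<Longrightarrow> norm x \<le> M"
proof -
  define K where "K = closure {x. \<phi> x \<noteq> 0}"
  have K: "compact K" using p by (simp add: test_functions_def K_def)
  note out = outside_support[of _ \<phi>, folded K_def]
  have C: "C_k 1 \<phi>" "C_k 0 \<phi>" using p by (simp_all only: test_functions_def mem_Collect_eq)
  have diff: "\<phi> differentiable (at x)" for x using C(1) by simp
  have cont: "continuous_on UNIV (partial b \<phi>)" if "b \<in> Basis" for b using C(1) that by simp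
  have bound: "\<exists>B. \<forall>x. \<bar>f x\<bar> \<le> B" if f: "continuous_on UNIV f" "\<And>x. x \<notin> K \<Longrightarrow> f x = 0" for f :: "'a \<Rightarrow> real"
  proof -
    have "bounded (f ` K)"
      by (intro compact_imp_bounded compact_continuous_image continuous_on_subset[OF f(1)] K) auto
    then obtain B where "\<forall>x\<in>K. norm (f x) \<le> B" unfolding bounded_iff by auto
    then have "\<bar>f x\<bar> \<le> max B 0" for x using f(2)[of x] by (cases "x \<in> K") auto
    then show ?thesis by blast
  qed
  have "\<forall>b\<in>Basis. \<exists>B. \<forall>x. \<bar>partial b \<phi> x\<bar> \<le> B" using bound[OF cont out(2)] by blast
  then obtain B where B: "\<And>b x. b \<in> Basis \<Longrightarrow> \<bar>partial b \<phi> x\<bar> \<le> B b" using bchoice[of Basis] by metis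
  define L where "L = (\<Sum>b\<in>Basis. B b)"
  have L: "0 \<le> L" unfolding L_def using B by (intro sum_nonneg) (meson abs_ge_zero order_trans)
  have "\<bar>\<phi> x - \<phi> y\<bar> \<le> L * norm (x - y)" for x y
  proof -
    have "norm (\<phi> x - \<phi> y) \<le> L * norm (x - y)"
    proof (rule differentiable_bound[of UNIV \<phi> "\<lambda>x. frechet_derivative \<phi> (at x)"])
      show "(\<phi> has_derivative frechet_derivative \<phi> (at x)) (at x within UNIV)" for x
        using partial_has_derivative[OF diff] by simp
      show "onorm (frechet_derivative \<phi> (at x)) \<le> L" for x
      proof (rule onorm_bound[OF L])
        fix h
        interpret l: linear "frechet_derivative \<phi> (at x)" by (rule linear_frechet_derivative[OF diff])
        have "frechet_derivative \<phi> (at x) h = frechet_derivative \<phi> (at x) (\<Sum>b\<in>Basis. (h \<bullet> b) *\<^sub>R b)"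
          by (simp add: euclidean_representation)
        also have "\<dots> = (\<Sum>b\<in>Basis. (h \<bullet> b) * partial b \<phi> x)"
          by (simp add: l.sum l.scale partial_def)
        also have "norm \<dots> \<le> (\<Sum>b\<in>Basis. norm h * B b)"
          using B by (intro sum_norm_le) (auto simp: abs_mult intro!: mult_mono Basis_le_norm)
        finally show "norm (frechet_derivative \<phi> (at x) h) \<le> L * norm h"
          by (simp add: L_def sum_distrib_left mult.commute)
      qed
    qed auto
    then show ?thesis by simp
  qed
  moreover obtain B' where "\<And>x. \<bar>\<phi> x\<bar> \<le> B'" using bound[OF C_k_continuous[OF C(2)] out(1)] by auto
  moreover obtain M where "\<And>x. x \<in> K \<Longrightarrow> norm x \<le> M" using compact_imp_bounded[OF K] by (auto simp: bounded_iff)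
  ultimately show ?thesis using that[of L B' M] L out(1) by blast
qed

text \<open>A segment from inside \<open>C\<close> to outside meets the frontier, where
  \<open>f\<close> vanishes, so the jump of the indicator does not affect the Lipschitz
  constant.\<close>

lemma Lipschitz_cutoff:
  fixes f :: "'a::euclidean_space \<Rightarrow> real"
  assumes lip: "\<And>x y. \<bar>f x - f y\<bar> \<le> L * norm (x - y)" and L: "0 \<le> L"
    and zero: "\<And>x. x \<in> frontier C \<Longrightarrow> f x = 0"
  shows "\<bar>indicator C x * f x - indicator C y * f y\<bar> \<le> L * norm (x - y)"
proof -
  have *: "\<bar>f x\<bar> \<le> L * norm (x - y)" if x: "x \<in> C" and y: "y \<notin> C" for x y
  proof -
    have "closed_segment x y \<inter> frontier C \<noteq> {}"
      using x y by (intro connected_Int_frontier) auto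
    then obtain p where p: "p \<in> closed_segment x y" "p \<in> frontier C" by auto
    have "\<bar>f x\<bar> \<le> L * norm (x - p)" using lip[of x p] zero[OF p(2)] by simp
    also have "\<dots> \<le> L * norm (x - y)"
      using segment_bound(1)[OF p(1)] L by (simp add: mult_left_mono norm_minus_commute)
    finally show ?thesis .
  qed
  show ?thesis
    using lip[of x y] *[of x y] *[of y x] L
    by (cases "x \<in> C"; cases "y \<in> C") (auto simp: norm_minus_commute)
qed

context weighted_domain
begin

lemma bounded_support_L2:
  fixes f :: "'a \<Rightarrow> real"
  assumes f: "f \<in> borel_measurable borel" "\<And>x. \<bar>f x\<bar> \<le> B" and K: "bounded (S \<inter> {x. f x \<noteq> 0})"
  shows "(\<lambda>x. complex_of_real (f x)) \<in> L2 S"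
proof -
  obtain M where M: "\<And>x. x \<in> S \<Longrightarrow> f x \<noteq> 0 \<Longrightarrow> norm x \<le> M" using K by (auto simp: bounded_iff)
  have "f \<in> borel_measurable lborel" using f(1) by simp
  then have fm [measurable]: "f \<in> borel_measurable (lebesgue_on S)"
    by (intro measurable_restrict_space1 measurable_completion)
  have "integrable lborel (\<lambda>x. B\<^sup>2 * indicator (cball (0::'a) M) x :: real)"
    by (intro integrable_mult_right integrable_real_indicator)
      (use emeasure_bounded_finite[OF bounded_cball, of "0::'a" M] in auto)
  then have "integrable lebesgue (\<lambda>x. B\<^sup>2 * indicator (cball (0::'a) M) x :: real)"
    by (subst integrable_completion) auto
  from integrable_mult_indicator[OF S_sets this]
  have i: "integrable (lebesgue_on S) (\<lambda>x. B\<^sup>2 * indicator (cball (0::'a) M) x :: real)"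
    using S_sets by (subst integrable_restrict_space) simp_all
  have "integrable (lebesgue_on S) (\<lambda>x. (cmod (complex_of_real (f x)))\<^sup>2)"
  proof (rule Bochner_Integration.integrable_bound[OF i])
    show "AE x in lebesgue_on S. norm ((cmod (complex_of_real (f x)))\<^sup>2) \<le> norm (B\<^sup>2 * indicator (cball 0 M) x)"
    proof (rule AE_I2)
      fix x assume "x \<in> space (lebesgue_on S)"
      then have x: "x \<in> S" by (simp add: space_restrict_space)
      have "(f x)\<^sup>2 \<le> B\<^sup>2" using f(2)[of x] by (simp add: power2_le_iff_abs_le)
      then show "norm ((cmod (complex_of_real (f x)))\<^sup>2) \<le> norm (B\<^sup>2 * indicator (cball 0 M) x)"
        using M[OF x] by (cases "f x = 0") auto
    qed
  qed measurable
  then show ?thesis by (simp add: L2_def)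
qed

text \<open>A factor that vanishes outside \<open>S\<close> moves the integral to the whole space,
  where translation invariance is available.\<close>

lemma integral_test_function:
  fixes f \<theta> :: "'a \<Rightarrow> real"
  assumes [measurable]: "f \<in> borel_measurable borel" "\<theta> \<in> borel_measurable borel"
    and out: "\<And>x. x \<notin> S \<Longrightarrow> \<theta> x = 0"
  shows "(LINT x|lebesgue_on S. complex_of_real (f x) * complex_of_real (\<theta> x))
    = complex_of_real (LINT x|lborel. f x * \<theta> x)"
proof -
  have "(LINT x|lebesgue_on S. complex_of_real (f x) * complex_of_real (\<theta> x))
      = complex_of_real (LINT x|lebesgue_on S. f x * \<theta> x)"
    by (subst integral_complex_of_real[symmetric]) simp
  also have "(LINT x|lebesgue_on S. f x * \<theta> x) = (LINT x|lebesgue. indicator S x *\<^sub>R (f x * \<theta> x))"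
    using S_sets by (subst integral_restrict_space) auto
  also have "\<dots> = (LINT x|lebesgue. f x * \<theta> x)"
    using out by (intro Bochner_Integration.integral_cong) (auto simp: indicator_def)
  also have "\<dots> = (LINT x|lborel. f x * \<theta> x)" by (rule integral_completion) auto
  finally show ?thesis .
qed

text \<open>The product of the cut-off \<open>w\<close> and a test function \<open>\<phi>\<close> is
  Lipschitz on the whole space: a frontier point of \<open>C\<close> either lies in
  \<open>S\<close>, where \<open>w\<close> vanishes, or outside \<open>S\<close>, where
  \<open>\<phi>\<close> vanishes. The integral of its directional derivative is therefore zero,
  which is integration by parts.\<close>

lemma weak_partial_cutoff:
  fixes w w' :: "'a \<Rightarrow> real"
  assumes C: "open C" "convex C" and b: "b \<in> Basis"
    and lip: "\<And>x y. \<bar>w x - w y\<bar> \<le> L * norm (x - y)" "0 \<le> L" and w: "\<And>x. \<bar>w x\<bar> \<le> 1"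
    and w': "w' \<in> borel_measurable borel" "\<And>x. \<bar>w' x\<bar> \<le> B"
    and deriv: "AE x in lborel. ((\<lambda>t. (w (x + t *\<^sub>R b) - w x) / t) \<longlongrightarrow> w' x) (at 0)"
    and front: "\<And>x. x \<in> frontier C \<Longrightarrow> x \<in> S \<Longrightarrow> w x = 0"
    and bdd: "bounded (S \<inter> C \<inter> {x. w' x \<noteq> 0})"
  shows "weak_partial S b (\<lambda>x. complex_of_real (indicator C x * w x)) (\<lambda>x. complex_of_real (indicator C x * w' x))"
proof -
  have wc: "continuous_on UNIV w"
    by (rule lipschitz_on_continuous_on[of L]) (auto simp: lipschitz_on_def dist_norm lip)
  then have [measurable]: "w \<in> borel_measurable borel" by (rule borel_measurable_continuous_onI)
  have [measurable]: "C \<in> sets borel" using C by simp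
  note [measurable] = w'(1)
  have B0: "0 \<le> B" using w'(2)[of 0] by linarith
  have "(\<lambda>x. complex_of_real (indicator C x * w' x)) \<in> L2 S"
  proof (rule bounded_support_L2[of _ B])
    show "\<bar>indicator C x * w' x\<bar> \<le> B" for x using w'(2)[of x] B0 by (auto simp: indicator_def)
    show "bounded (S \<inter> {x. indicator C x * w' x \<noteq> 0})"
      by (rule bounded_subset[OF bdd]) (auto simp: indicator_def)
  qed measurable
  moreover have "(LINT x|lebesgue_on S. complex_of_real (indicator C x * w x) * complex_of_real (partial b \<phi> x)) =
        - (LINT x|lebesgue_on S. complex_of_real (indicator C x * w' x) * complex_of_real (\<phi> x))"
    if p: "\<phi> \<in> test_functions S" for \<phi>
  proof -
    obtain L' B' M where f: "0 \<le> L'" "\<And>x y. \<bar>\<phi> x - \<phi> y\<bar> \<le> L' * norm (x - y)"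
      "\<And>x. \<bar>\<phi> x\<bar> \<le> B'" "\<And>x. \<phi> x \<noteq> 0 \<Longrightarrow> norm x \<le> M"
      using test_function_Lipschitz[OF p] by metis
    have B'0: "0 \<le> B'" using f(3)[of 0] by linarith
    have C1: "C_k 1 \<phi>" using p by (simp only: test_functions_def mem_Collect_eq)
    have diff: "\<phi> differentiable (at x)" for x using C1 by simp
    have cp: "continuous_on UNIV \<phi>" "continuous_on UNIV (partial b \<phi>)"
      using C_k_continuous[OF C1] C1 b by simp_all
    have [measurable]: "\<phi> \<in> borel_measurable borel" "partial b \<phi> \<in> borel_measurable borel"
      using cp by (auto intro: borel_measurable_continuous_onI)
    define K where "K = closure {x. \<phi> x \<noteq> 0}"
    have K: "compact K" "K \<subseteq> S" using p by (auto simp: test_functions_def K_def)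
    have out: "\<phi> x = 0" and out': "partial b \<phi> x = 0" if "x \<notin> K" for x
      using outside_support[of x \<phi>] that by (auto simp: K_def)
    have int: "integrable lborel (\<lambda>x. g x * \<theta> x)"
      if th: "continuous_on UNIV \<theta>" "\<And>x. x \<notin> K \<Longrightarrow> \<theta> x = 0"
        and g: "g \<in> borel_measurable borel" "\<And>x. \<bar>g x\<bar> \<le> B''" for g \<theta> :: "'a \<Rightarrow> real" and B''
    proof -
      have "integrable lborel (\<lambda>x. indicator K x *\<^sub>R \<theta> x)"
        by (rule borel_integrable_compact[OF K(1)]) (auto intro: continuous_on_subset[OF th(1)])
      moreover have e: "indicator K x *\<^sub>R \<theta> x = \<theta> x" for x using th(2)[of x] by (auto simp: indicator_def)
      ultimately have i: "integrable lborel \<theta>" by (simp only: e)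
      have [measurable]: "\<theta> \<in> borel_measurable borel" using th(1) by (rule borel_measurable_continuous_onI)
      note [measurable] = g(1)
      show ?thesis
      proof (rule Bochner_Integration.integrable_bound[OF integrable_mult_right[OF i, of B'']])
        show "AE x in lborel. norm (g x * \<theta> x) \<le> norm (B'' * \<theta> x)"
          using g(2) by (intro AE_I2) (auto simp: abs_mult intro!: mult_right_mono order_trans[OF g(2)])
      qed measurable
    qed
    \<comment> \<open>The product rule away from the frontier of \<open>C\<close>; the indicator
      contributes no term.\<close>
    define D where "D x = indicator C x * w x * partial b \<phi> x + indicator C x * w' x * \<phi> x" for x
    have "(LINT x|lborel. D x) = 0"
    proof (rule integral_directional_derivative_zero[where \<psi> = "\<lambda>x. indicator C x * (w x * \<phi> x)"
          and L = "L' + B' * L" and M = M and b = b])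
      show "\<bar>indicator C x * (w x * \<phi> x) - indicator C y * (w y * \<phi> y)\<bar> \<le> (L' + B' * L) * norm (x - y)" for x y
      proof (rule Lipschitz_cutoff[where f = "\<lambda>x. w x * \<phi> x"])
        fix x y
        have "w x * \<phi> x - w y * \<phi> y = w x * (\<phi> x - \<phi> y) + \<phi> y * (w x - w y)" by (simp add: algebra_simps)
        also have "\<bar>\<dots>\<bar> \<le> \<bar>w x\<bar> * \<bar>\<phi> x - \<phi> y\<bar> + \<bar>\<phi> y\<bar> * \<bar>w x - w y\<bar>"
          using abs_triangle_ineq[of "w x * (\<phi> x - \<phi> y)" "\<phi> y * (w x - w y)"] by (simp add: abs_mult)
        also have "\<dots> \<le> 1 * (L' * norm (x - y)) + B' * (L * norm (x - y))"
          using w f lip B'0 by (intro add_mono mult_mono) auto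
        finally show "\<bar>w x * \<phi> x - w y * \<phi> y\<bar> \<le> (L' + B' * L) * norm (x - y)" by (simp add: algebra_simps)
      next
        fix x assume "x \<in> frontier C"
        then show "w x * \<phi> x = 0" using front[of x] out[of x] K(2) by (cases "x \<in> S") auto
      qed (use f(1) B'0 lip(2) in simp)
      show "D \<in> borel_measurable borel" unfolding D_def by measurable
      \<comment> \<open>The frontier of a convex set is negligible, so only interior and exterior
        points matter, near which the indicator is constant.\<close>
      have "AE x in lborel. x \<notin> frontier C"
        using negligible_convex_frontier[OF C(2)] frontier_closed[of C]
        by (intro AE_not_in) (simp add: negligible_iff_null_sets null_sets_completion_iff)
      then show "AE x in lborel. ((\<lambda>t. (indicator C (x + t *\<^sub>R b) * (w (x + t *\<^sub>R b) * \<phi> (x + t *\<^sub>R b))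
          - indicator C x * (w x * \<phi> x)) / t) \<longlongrightarrow> D x) (at 0)"
        using deriv
      proof eventually_elim
        case (elim x)
        have line: "((\<lambda>t. x + t *\<^sub>R b) \<longlongrightarrow> x) (at 0)" by (auto intro!: tendsto_eq_intros)
        have prod: "((\<lambda>t. (w (x + t *\<^sub>R b) * \<phi> (x + t *\<^sub>R b) - w x * \<phi> x) / t)
            \<longlongrightarrow> w x * partial b \<phi> x + w' x * \<phi> x) (at 0)"
        proof (rule Lim_transform_eventually)
          have "isCont w x" using wc by (simp add: continuous_on_eq_continuous_at)
          then have "((\<lambda>t. w (x + t *\<^sub>R b)) \<longlongrightarrow> w x) (at 0)" using line by (rule isCont_tendsto_compose)
          then show "((\<lambda>t. w (x + t *\<^sub>R b) * ((\<phi> (x + t *\<^sub>R b) - \<phi> x) / t) + ((w (x + t *\<^sub>R b) - w x) / t) * \<phi> x)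
            \<longlongrightarrow> w x * partial b \<phi> x + w' x * \<phi> x) (at 0)"
            by (intro tendsto_intros elim partial_tendsto diff)
        qed (auto simp: diff_divide_distrib algebra_simps intro!: always_eventually)
        show ?case
        proof (cases "x \<in> C")
          case True
          have "\<forall>\<^sub>F t in at 0. x + t *\<^sub>R b \<in> C" using line C(1) True by (rule topological_tendstoD)
          then show ?thesis
            by (intro Lim_transform_eventually[OF prod[THEN tendsto_eq_rhs]])
              (auto simp: D_def True elim!: eventually_mono)
        next
          case False
          then have "x \<in> - closure C" using elim(1) C(1) by (auto simp: frontier_def interior_open)
          then have "\<forall>\<^sub>F t in at 0. x + t *\<^sub>R b \<in> - closure C"
            using line by (intro topological_tendstoD) auto
          then have "\<forall>\<^sub>F t in at 0. 0 = (indicator C (x + t *\<^sub>R b) * (w (x + t *\<^sub>R b) * \<phi> (x + t *\<^sub>R b))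
              - indicator C x * (w x * \<phi> x)) / t"
            by eventually_elim (use False closure_subset[of C] in \<open>auto simp: indicator_def\<close>)
          then show ?thesis using False
            by (intro Lim_transform_eventually[OF tendsto_const[THEN tendsto_eq_rhs]]) (auto simp: D_def)
        qed
      qed
    qed (use f(4) in auto)
    moreover have "(LINT x|lborel. D x)
        = (LINT x|lborel. (indicator C x * w x) * partial b \<phi> x) + (LINT x|lborel. (indicator C x * w' x) * \<phi> x)"
      unfolding D_def
    proof (rule Bochner_Integration.integral_add)
      show "integrable lborel (\<lambda>x. indicator C x * w x * partial b \<phi> x)"
        using w by (intro int[where B'' = 1] cp out') (auto simp: indicator_def)
      show "integrable lborel (\<lambda>x. indicator C x * w' x * \<phi> x)"
        using w'(2) B0 by (intro int[where B'' = B] cp out) (auto simp: indicator_def)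
    qed
    ultimately have e: "(LINT x|lborel. (indicator C x * w x) * partial b \<phi> x) = - (LINT x|lborel. (indicator C x * w' x) * \<phi> x)"
      by linarith
    have "(LINT x|lebesgue_on S. complex_of_real (indicator C x * w x) * complex_of_real (partial b \<phi> x))
        = complex_of_real (LINT x|lborel. (indicator C x * w x) * partial b \<phi> x)"
      using out' K(2) by (intro integral_test_function) auto
    moreover have "(LINT x|lebesgue_on S. complex_of_real (indicator C x * w' x) * complex_of_real (\<phi> x))
        = complex_of_real (LINT x|lborel. (indicator C x * w' x) * \<phi> x)"
      using out K(2) by (intro integral_test_function) auto
    ultimately show ?thesis unfolding e by simp
  qed
  ultimately show ?thesis by (simp add: weak_partial_def)
qed

end

section \<open>Rooms and passages\<close>

lemma norm_fst_le_norm: "norm (fst v) \<le> norm v"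
  by (cases v) (simp add: norm_fst_le)

lemma norm_snd_le_norm: "norm (snd v) \<le> norm v"
  by (cases v) (simp add: norm_snd_le)

text \<open>Other sheets of the boundary must not accumulate at \<open>p\<close>, since indices keep
  a distance from them. The graph direction \<open>e\<close> may be oblique, but it is not
  horizontal. Sliding a nearby boundary point along \<open>e\<close> to height 0 reaches the flat
  part, and locally the boundary meets each line in direction \<open>e\<close> only once.\<close>

lemma lipschitz_boundary_flat:
  fixes \<Omega> :: "((real^'m) \<times> real) set"
  assumes lip: "lipschitz_boundary \<Omega>" and p: "p \<in> interior {x'. (x', 0) \<in> flat_part \<Omega>}"
  shows "\<exists>r>0. ball p r \<subseteq> {x'. (x', 0) \<in> flat_part \<Omega>} \<and> frontier \<Omega> \<inter> ball (p, 0) r \<subseteq> {x. snd x = 0}"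
proof -
  obtain r0 where r0: "r0 > 0" "ball p r0 \<subseteq> {x'. (x', 0) \<in> flat_part \<Omega>}"
    using p by (auto simp: mem_interior)
  have fr: "(x', 0) \<in> frontier \<Omega>" if "x' \<in> ball p r0" for x'
    using r0(2) that by (auto simp: flat_part_def)
  have pf: "(p, 0) \<in> frontier \<Omega>" using fr[of p] r0(1) by simp
  obtain e r L g where e: "norm e = 1" and r: "r > 0" and g: "L-lipschitz_on {y. y \<bullet> e = 0} g"
    and graph: "\<forall>x\<in>ball (p, 0) r. x \<in> \<Omega> \<longleftrightarrow> x \<bullet> e < g (x - (x \<bullet> e) *\<^sub>R e)"
    using lip[unfolded lipschitz_boundary_def, rule_format, OF pf] by metis
  have ee: "e \<bullet> e = 1" using e by (simp add: norm_eq_1)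
  define G where "G x = g (x - (x \<bullet> e) *\<^sub>R e)" for x
  have G_shift: "G (x + s *\<^sub>R e) = G x" for x s
    by (simp add: G_def inner_simps ee algebra_simps)
  have "continuous_on UNIV G"
    unfolding G_def
    by (rule continuous_on_compose2[OF lipschitz_on_continuous_on[OF g]])
      (auto intro!: continuous_intros simp: inner_simps ee)
  then have op: "open {x. x \<bullet> e < G x}" "open {x. G x < x \<bullet> e}"
    by (auto intro!: open_Collect_less continuous_intros)
  have on_graph: "x \<bullet> e = G x" if x: "x \<in> frontier \<Omega>" "x \<in> ball (p, 0) r" for x
  proof (rule ccontr)
    assume "x \<bullet> e \<noteq> G x"
    then consider "x \<bullet> e < G x" | "G x < x \<bullet> e" by linarith
    then show False
    proof cases
      case 1
      have "x \<in> interior \<Omega>"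
        by (rule interiorI[of "{x. x \<bullet> e < G x} \<inter> ball (p, 0) r"])
          (use 1 x graph op in \<open>auto simp: G_def\<close>)
      then show False using x by (simp add: frontier_def)
    next
      case 2
      have "x \<in> interior (- \<Omega>)"
        by (rule interiorI[of "{x. G x < x \<bullet> e} \<inter> ball (p, 0) r"])
          (use 2 x graph op in \<open>auto simp: G_def\<close>)
      then show False using x by (simp add: frontier_closures interior_closure)
    qed
  qed
  \<comment> \<open>For horizontal \<open>e\<close>, the flat part would contain two points on one
    line in direction \<open>e\<close>.\<close>
  have en: "snd e \<noteq> 0"
  proof
    assume e0: "snd e = 0"
    define s where "s = min r r0 / 2"
    have s: "s > 0" "s < r" "s < r0" using r r0 by (auto simp: s_def)
    have eq: "(p + s *\<^sub>R fst e, 0) = (p, 0) + s *\<^sub>R e" using e0 by (simp add: prod_eq_iff)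
    have n: "norm (fst e) = 1" using e e0 by (simp add: norm_prod_def)
    have "(p, 0) + s *\<^sub>R e \<in> frontier \<Omega>"
      using fr[of "p + s *\<^sub>R fst e"] s n by (simp add: eq dist_norm)
    moreover have "(p, 0) + s *\<^sub>R e \<in> ball (p, 0) r" using s e by (simp add: dist_norm)
    ultimately have "((p, 0) + s *\<^sub>R e) \<bullet> e = G ((p, 0) + s *\<^sub>R e)" by (rule on_graph)
    moreover have "(p, 0) \<bullet> e = G (p, 0)" using on_graph[OF pf] r by simp
    ultimately show False using s by (simp add: G_shift inner_simps ee)
  qed
  \<comment> \<open>Sliding moves a point of the small ball by at most
    \<open>r1 / \<bar>snd e\<bar>\<close>; the radius is chosen so that the result stays within
    \<open>min r r0\<close>.\<close>
  define r1 where "r1 = min r r0 / (1 + 1 / \<bar>snd e\<bar>)"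
  have den: "1 + 1 / \<bar>snd e\<bar> > 1" using en by simp
  have d0: "0 < 1 + 1 / \<bar>snd e\<bar>" using den by linarith
  have "min r r0 / X * X = min r r0" if "0 < X" for X using that by simp
  from this[OF d0] have r1: "r1 > 0" "r1 * (1 + 1 / \<bar>snd e\<bar>) = min r r0"
    unfolding r1_def using r r0 d0 by (simp_all add: divide_pos_pos del: divide_eq_eq)
  have r1le: "r1 \<le> min r r0"
    using r1 den by (metis less_eq_real_def mult_le_cancel_left2 not_less)
  have "snd y = 0" if y: "y \<in> frontier \<Omega>" "y \<in> ball (p, 0) r1" for y
  proof -
    define s where "s = - snd y / snd e"
    have y1: "norm (y - (p, 0)) < r1" using y(2) by (simp add: dist_norm norm_minus_commute)
    have "\<bar>snd y\<bar> \<le> norm (y - (p, 0))" using norm_snd_le_norm[of "y - (p, 0)"] by simp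
    then have s: "\<bar>s\<bar> \<le> r1 / \<bar>snd e\<bar>" using y1 en by (simp add: s_def abs_divide divide_right_mono)
    define y' where "y' = y + s *\<^sub>R e"
    have y'0: "snd y' = 0" using en by (simp add: y'_def s_def)
    have "norm (y' - (p, 0)) \<le> norm (y - (p, 0)) + norm (s *\<^sub>R e)"
      using norm_triangle_ineq[of "y - (p, 0)" "s *\<^sub>R e"] by (simp add: y'_def algebra_simps)
    also have "\<dots> < r1 + r1 / \<bar>snd e\<bar>" using y1 s e by simp
    also have "\<dots> = min r r0" using r1(2) by (simp add: algebra_simps)
    finally have d: "norm (y' - (p, 0)) < min r r0" .
    have "norm (fst y' - p) \<le> norm (y' - (p, 0))" using norm_fst_le_norm[of "y' - (p, 0)"] by simp
    then have "(fst y', 0) \<in> frontier \<Omega>" using d by (intro fr) (simp add: dist_norm norm_minus_commute)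
    then have "y' \<in> frontier \<Omega>" using y'0 by (metis prod.collapse)
    moreover have "y' \<in> ball (p, 0) r" using d by (simp add: dist_norm norm_minus_commute)
    ultimately have "y' \<bullet> e = G y'" by (rule on_graph)
    moreover have "y \<bullet> e = G y" using y r1le by (intro on_graph) auto
    ultimately have "s = 0" by (simp add: y'_def G_shift inner_simps ee)
    then show "snd y = 0" using en by (simp add: s_def)
  qed
  moreover have "ball p r1 \<subseteq> {x'. (x', 0) \<in> flat_part \<Omega>}"
    using r1le by (intro order_trans[OF _ r0(2)]) auto
  ultimately show ?thesis using r1(1) by blast
qed

text \<open>\<open>infdist\<close> to the empty set is 0 by convention, which would leave no index
  for positive \<open>\<epsilon>\<close>; so a boundary point off the flat part must be exhibited. A
  vertical segment from a point of \<open>\<Omega>\<close> down past the bound crosses the boundary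
  at negative height.\<close>

lemma frontier_below_nonempty:
  fixes \<Omega> :: "('a::euclidean_space \<times> real) set"
  assumes "bounded \<Omega>" "\<Omega> \<noteq> {}" "\<Omega> \<subseteq> {x. snd x < 0}"
  shows "\<exists>z\<in>frontier \<Omega>. snd z < 0"
proof -
  obtain y where y: "y \<in> \<Omega>" using assms by auto
  obtain M where M: "\<And>x. x \<in> \<Omega> \<Longrightarrow> norm x \<le> M" using assms(1) by (auto simp: bounded_iff)
  define z where "z = (fst y, - M - 1)"
  have M0: "0 \<le> M" using M[OF y] norm_ge_zero order_trans by blast
  have "norm z > M" using norm_snd_le_norm[of z] M0 by (simp add: z_def)
  then have "z \<notin> \<Omega>" using M[of z] by auto
  then have "closed_segment y z \<inter> frontier \<Omega> \<noteq> {}"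
    using y by (intro connected_Int_frontier) auto
  then obtain q where q: "q \<in> closed_segment y z" "q \<in> frontier \<Omega>" by auto
  have "convex {x::'a \<times> real. snd x < 0}"
    using convex_halfspace_lt[of "(0::'a, 1::real)" 0] by (simp add: inner_prod_def)
  moreover have "y \<in> {x. snd x < 0}" "z \<in> {x. snd x < 0}" using y assms(3) M0 by (auto simp: z_def)
  ultimately have "closed_segment y z \<subseteq> {x. snd x < 0}" by (rule closed_segment_subset[rotated 2])
  then show ?thesis using q by auto
qed

text \<open>A row of \<open>k + 1\<close> consecutive lattice points starting next to
  \<open>p\<close> stays well inside the flat ball once \<open>\<epsilon>\<close> is small.\<close>

lemma eventually_many_indices:
  fixes \<Omega> :: "((real^'m) \<times> real) set"
  assumes Om: "bounded \<Omega>" "lipschitz_boundary \<Omega>" "\<Omega> \<subseteq> {x. snd x < 0}"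
    and Gamma: "interior {x'. (x', 0) \<in> flat_part \<Omega>} \<noteq> {}"
  shows "\<forall>\<^sub>F \<epsilon> in at_right 0. \<exists>I\<subseteq>indices \<Omega> \<epsilon>. finite I \<and> k < card I"
proof -
  obtain p where p: "p \<in> interior {x'. (x', 0) \<in> flat_part \<Omega>}" using Gamma by auto
  obtain r where r: "r > 0" "ball p r \<subseteq> {x'. (x', 0) \<in> flat_part \<Omega>}"
    "frontier \<Omega> \<inter> ball (p, 0) r \<subseteq> {x. snd x = 0}"
    using lipschitz_boundary_flat[OF Om(2) p] by auto
  have "(p, 0) \<in> frontier \<Omega>" using subsetD[OF r(2), of p] r(1) by (simp add: flat_part_def)
  then have "\<Omega> \<noteq> {}" by auto
  then obtain z where "z \<in> frontier \<Omega>" "snd z < 0"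
    using frontier_below_nonempty[OF Om(1) _ Om(3)] by blast
  then have z: "z \<in> frontier \<Omega> - flat_part \<Omega>" by (simp add: flat_part_def)
  \<comment> \<open>The ball of radius \<open>r\<close> around \<open>(p, 0)\<close> contains no
    boundary point off the flat part, so points within \<open>r / 2\<close> of \<open>p\<close> keep
    distance \<open>r / 2\<close> from such points.\<close>
  have far: "r / 2 \<le> infdist (x', 0) (frontier \<Omega> - flat_part \<Omega>)" if x': "dist p x' \<le> r / 2" for x'
  proof -
    have "r / 2 \<le> dist (x', 0) a" if a: "a \<in> frontier \<Omega> - flat_part \<Omega>" for a
    proof -
      have "a \<notin> ball (p, 0) r" using a r(3) by (auto simp: flat_part_def)
      then have "r \<le> dist (p, 0) a" by simp
      also have "\<dots> \<le> dist (p, 0) (x', 0::real) + dist (x', 0) a" by (rule dist_triangle)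
      also have "dist (p, 0::real) (x', 0) = dist p x'" by (simp add: dist_prod_def)
      finally show ?thesis using x' by simp
    qed
    then have "r / 2 \<le> (INF a\<in>frontier \<Omega> - flat_part \<Omega>. dist (x', 0) a)"
      by (intro cINF_greatest) (use z in blast)
    then show ?thesis using z by (subst infdist_notempty) blast+
  qed
  define m where "m = real CARD('m)"
  have m: "m > 0" by (simp add: m_def)
  \<comment> \<open>The first bound keeps the row within \<open>r / 2\<close> of \<open>p\<close>,
    as each of the \<open>m\<close> coordinates deviates by at most
    \<open>\<epsilon> * (k + 1)\<close>. The second makes the distance demanded of an index at most
    \<open>r / 2\<close>.\<close>
  define \<epsilon>0 where "\<epsilon>0 = min (r / 2 / (m * real (Suc k))) (r / sqrt (m + 1))"
  have e0: "\<epsilon>0 > 0" using r(1) m by (simp add: \<epsilon>0_def)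
  have "\<exists>I\<subseteq>indices \<Omega> \<epsilon>. finite I \<and> k < card I" if eps: "0 < \<epsilon>" "\<epsilon> < \<epsilon>0" for \<epsilon>
  proof -
    obtain j0 :: 'm where True by simp
    \<comment> \<open>Only the coordinate \<open>j0\<close> varies with \<open>n\<close>, which
      makes the points distinct.\<close>
    define i where "i n = (\<chi> j. \<lfloor>p $ j / \<epsilon>\<rfloor> + (if j = j0 then int n else 0))" for n
    have near: "dist p (lattice_point \<epsilon> (i n)) < r / 2" if n: "n \<le> k" for n
    proof -
      have comp: "\<bar>(p - lattice_point \<epsilon> (i n)) $ j\<bar> \<le> \<epsilon> * real (Suc k)" for j
      proof -
        define a where "a = p $ j / \<epsilon> - of_int \<lfloor>p $ j / \<epsilon>\<rfloor>"
        have a: "0 \<le> a" "a < 1" by (auto simp: a_def) linarith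
        define c where "c = (if j = j0 then real n else 0)"
        have c: "0 \<le> c" "c \<le> real k" using n by (auto simp: c_def)
        have "(p - lattice_point \<epsilon> (i n)) $ j = \<epsilon> * (a - c)"
          using eps(1) by (auto simp: lattice_point_def i_def a_def c_def algebra_simps)
        then have "\<bar>(p - lattice_point \<epsilon> (i n)) $ j\<bar> = \<epsilon> * \<bar>a - c\<bar>" using eps(1) by (simp add: abs_mult)
        also have "\<dots> \<le> \<epsilon> * real (Suc k)" using a c eps(1) by (intro mult_left_mono) auto
        finally show ?thesis .
      qed
      have "norm (p - lattice_point \<epsilon> (i n)) \<le> (\<Sum>j\<in>UNIV. \<bar>(p - lattice_point \<epsilon> (i n)) $ j\<bar>)"
        by (rule norm_le_l1_cart)
      also have "\<dots> \<le> (\<Sum>j\<in>(UNIV::'m set). \<epsilon> * real (Suc k))" by (intro sum_mono comp)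
      also have "\<dots> = \<epsilon> * (m * real (Suc k))" by (simp add: m_def)
      also have "\<dots> < r / 2"
      proof -
        have "\<epsilon> < r / 2 / (m * real (Suc k))" using eps by (simp add: \<epsilon>0_def)
        moreover have "0 < m * real (Suc k)" using m by simp
        ultimately show ?thesis by (simp add: pos_less_divide_eq)
      qed
      finally show ?thesis by (simp add: dist_norm)
    qed
    have "\<epsilon> * sqrt (m + 1) / 2 \<le> r / 2"
    proof -
      have "\<epsilon> < r / sqrt (m + 1)" using eps by (simp add: \<epsilon>0_def)
      then show ?thesis using m by (simp add: pos_less_divide_eq)
    qed
    then have half: "\<epsilon> * sqrt (real (CARD('m) + 1)) / 2 \<le> r / 2" by (simp add: m_def add.commute)
    have ind: "i n \<in> indices \<Omega> \<epsilon>" if n: "n \<le> k" for n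
    proof -
      have "lattice_point \<epsilon> (i n) \<in> ball p r" using near[OF n] r(1) by simp
      then have "(lattice_point \<epsilon> (i n), 0) \<in> flat_part \<Omega>" using r(2) by blast
      moreover have "r / 2 \<le> infdist (lattice_point \<epsilon> (i n), 0) (frontier \<Omega> - flat_part \<Omega>)"
        by (rule far) (use near[OF n] in simp)
      ultimately show ?thesis unfolding indices_def using half by (auto intro: order_trans)
    qed
    have "inj_on i {..k}"
    proof (rule inj_onI)
      fix a b assume "i a = i b"
      then have "i a $ j0 = i b $ j0" by simp
      then show "a = b" by (simp add: i_def)
    qed
    then have "card (i ` {..k}) = Suc k" by (simp add: card_image)
    then show ?thesis using ind by (intro exI[of _ "i ` {..k}"]) auto
  qed
  then show ?thesis
    unfolding eventually_at_right_field using e0 by blast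
qed

section \<open>Cells, rooms and passages over the lattice points\<close>

lemma inner_axis_fst: "(axis j 1, 0) \<bullet> x = fst x $ j" for x :: "(real^'m) \<times> real"
  by (simp add: inner_prod_def inner_axis')

locale rooms_and_passages =
  fixes \<Omega> B :: "((real^'m) \<times> real) set" and D :: "(real^'m) set" and R b d h \<rho>0 \<epsilon> :: real
  assumes Omega: "open \<Omega>" "\<Omega> \<subseteq> {x. snd x < 0}"
    and B: "open B" "bounded B" "B \<noteq> {}"
      "B \<subseteq> {x. (\<forall>j. - (1/2) < fst x $ j \<and> fst x $ j < 1/2) \<and> 0 < snd x}"
    and D: "open D" "D \<subseteq> {x'. norm x' < R}" and R: "R < 1 / 2"
    and pos: "0 < b" "0 < d" "0 < h" "0 < \<rho>0" and le: "d \<le> b" "b \<le> \<epsilon>"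
begin

text \<open>The open cylinder over the \<open>\<epsilon>\<close>-cell of a lattice point. It is
  convex and contains the room and the passage of its index, and distinct columns are disjoint, so
  cutting off at the walls separates the trial functions.\<close>

definition column :: "int^'m \<Rightarrow> ((real^'m) \<times> real) set" where
  "column i = {x. \<forall>j. \<bar>fst x $ j - lattice_point \<epsilon> i $ j\<bar> < \<epsilon> / 2}"

lemma eps_pos: "0 < \<epsilon>" using pos le by linarith

lemma column_eq: "column i = (\<Inter>j. {x. (axis j 1, 0) \<bullet> x < lattice_point \<epsilon> i $ j + \<epsilon> / 2} \<inter>
    {x. (axis j 1, 0) \<bullet> x > lattice_point \<epsilon> i $ j - \<epsilon> / 2})"
proof -
  have "\<bar>s - t\<bar> < e \<longleftrightarrow> s < t + e \<and> s > t - e" for s t e :: real by linarith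
  note * = this
  show ?thesis unfolding inner_axis_fst column_def * by auto
qed

lemma open_column: "open (column i)"
  unfolding column_eq by (intro open_INT open_Int ballI open_halfspace_lt open_halfspace_gt) simp

lemma convex_column: "convex (column i)"
  unfolding column_eq by (intro convex_INT convex_Int convex_halfspace_lt convex_halfspace_gt)

lemma column_disjoint: "i \<noteq> i' \<Longrightarrow> column i \<inter> column i' = {}"
proof (rule ccontr)
  assume ne: "i \<noteq> i'" and "column i \<inter> column i' \<noteq> {}"
  then obtain x where x: "x \<in> column i" "x \<in> column i'" by auto
  obtain j where j: "i $ j \<noteq> i' $ j" using ne by (auto simp: vec_eq_iff)
  have "\<bar>fst x $ j - \<epsilon> * of_int (i $ j)\<bar> < \<epsilon> / 2" "\<bar>fst x $ j - \<epsilon> * of_int (i' $ j)\<bar> < \<epsilon> / 2"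
    using x by (auto simp: column_def lattice_point_def)
  then have "\<bar>\<epsilon> * of_int (i $ j) - \<epsilon> * of_int (i' $ j)\<bar> < \<epsilon> * 1" by linarith
  moreover have "\<bar>\<epsilon> * of_int (i $ j) - \<epsilon> * of_int (i' $ j)\<bar> = \<epsilon> * \<bar>of_int (i $ j - i' $ j)\<bar>"
    using eps_pos by (simp add: abs_mult flip: right_diff_distrib)
  ultimately have "\<bar>of_int (i $ j - i' $ j) :: real\<bar> < 1" using eps_pos by simp
  then show False using j by linarith
qed

abbreviation "rm \<equiv> room B b h \<epsilon>"
abbreviation "ps \<equiv> passage D d h \<epsilon>"
abbreviation "S \<equiv> perturbed_domain \<Omega> B D b d h \<epsilon>"
abbreviation "\<rho> \<equiv> weight \<Omega> B b h \<rho>0 \<epsilon>"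

lemma room_column: "rm i \<subseteq> column i \<inter> {x. h < snd x}"
proof
  fix x assume "x \<in> rm i"
  then have "(1 / b) *\<^sub>R (x - (lattice_point \<epsilon> i, 0) - (0, h)) \<in> B" by (simp add: room_def)
  then have x: "- (1/2) < (1 / b) * (fst x $ j - lattice_point \<epsilon> i $ j)"
    "(1 / b) * (fst x $ j - lattice_point \<epsilon> i $ j) < 1/2" "0 < (1 / b) * (snd x - h)" for j
    using B(4) by auto
  have "\<bar>fst x $ j - lattice_point \<epsilon> i $ j\<bar> < b / 2" for j
  proof -
    have "lattice_point \<epsilon> i $ j - b / 2 < fst x $ j" "fst x $ j < lattice_point \<epsilon> i $ j + b / 2"
      using x(1,2)[of j] pos(1) by (auto simp: field_simps)
    then show ?thesis by linarith
  qed
  then have "\<bar>fst x $ j - lattice_point \<epsilon> i $ j\<bar> < \<epsilon> / 2" for j using le(2) by (smt (verit) divide_right_mono)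
  then show "x \<in> column i \<inter> {x. h < snd x}" using x(3) pos(1) by (simp add: column_def zero_less_divide_iff)
qed

lemma passage_column: "ps i \<subseteq> column i \<inter> {x. 0 \<le> snd x \<and> snd x \<le> h}"
proof
  fix x assume x: "x \<in> ps i"
  define v where "v = fst x - lattice_point \<epsilon> i"
  have "(1 / d) *\<^sub>R v \<in> D" using x by (simp add: passage_def v_def)
  then have "norm ((1 / d) *\<^sub>R v) < R" using D(2) by blast
  moreover have "norm ((1 / d) *\<^sub>R v) = norm v / d" using pos(2) by simp
  ultimately have "norm v / d < 1 / 2" using R by linarith
  then have n: "norm (fst x - lattice_point \<epsilon> i) < d / 2" using pos(2) by (simp add: v_def field_simps)
  have "\<bar>fst x $ j - lattice_point \<epsilon> i $ j\<bar> < \<epsilon> / 2" for j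
    using component_le_norm_cart[of "fst x - lattice_point \<epsilon> i" j] n le by simp
  then show "x \<in> column i \<inter> {x. 0 \<le> snd x \<and> snd x \<le> h}" using x by (simp add: column_def passage_def)
qed

text \<open>At positive height there are only rooms and passages, each confined to its own
  column.\<close>

lemma above_in_column:
  assumes "x \<in> S" "0 < snd x" "x \<in> column i"
  shows "i \<in> indices \<Omega> \<epsilon>" "x \<in> ps i \<or> x \<in> rm i"
proof -
  obtain i' where i': "i' \<in> indices \<Omega> \<epsilon>" "x \<in> ps i' \<or> x \<in> rm i'"
    using assms(1,2) Omega(2) by (auto simp: perturbed_domain_def)
  then have "x \<in> column i'" using i'(2) room_column[of i'] passage_column[of i'] by blast
  then have "i' = i" using assms(3) column_disjoint by auto
  then show "i \<in> indices \<Omega> \<epsilon>" "x \<in> ps i \<or> x \<in> rm i" using i' by auto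
qed

lemma room_image: "rm i = (\<lambda>x. b *\<^sub>R x + (lattice_point \<epsilon> i, h)) ` B"
proof -
  have "b *\<^sub>R ((1 / b) *\<^sub>R (x - (lattice_point \<epsilon> i, 0) - (0, h))) + (lattice_point \<epsilon> i, h) = x" for x
    using pos(1) by (simp add: prod_eq_iff)
  moreover have "(1 / b) *\<^sub>R (b *\<^sub>R x + (lattice_point \<epsilon> i, h) - (lattice_point \<epsilon> i, 0) - (0, h)) = x" for x
    using pos(1) by (simp add: prod_eq_iff)
  ultimately show ?thesis by (force simp: room_def image_iff)
qed

lemma open_room: "open (rm i)"
proof -
  have "rm i = (\<lambda>x. (1 / b) *\<^sub>R (x - (lattice_point \<epsilon> i, 0) - (0, h))) -` B" by (auto simp: room_def)
  then show ?thesis using B(1) by (auto intro!: open_vimage continuous_intros)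
qed

lemma bounded_room: "bounded (rm i)"
proof -
  have "bounded ((+) (lattice_point \<epsilon> i, h) ` ((\<lambda>x. b *\<^sub>R x) ` B))"
    by (intro bounded_translation bounded_scaling B)
  then show ?thesis by (simp add: room_image image_image add.commute)
qed

lemma measure_room: "measure lebesgue (rm i) = b ^ (CARD('m) + 1) * measure lebesgue B"
  unfolding room_image using measure_lebesgue_affine[of b "(lattice_point \<epsilon> i, h)" B] pos(1) by simp

definition base :: "int^'m \<Rightarrow> (real^'m) set" where
  "base i = {x'. (1 / d) *\<^sub>R (x' - lattice_point \<epsilon> i) \<in> D}"

lemma base_image: "base i = (\<lambda>x. d *\<^sub>R x + lattice_point \<epsilon> i) ` D"
proof -
  have "d *\<^sub>R ((1 / d) *\<^sub>R (x - lattice_point \<epsilon> i)) + lattice_point \<epsilon> i = x" for x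
    using pos(2) by simp
  moreover have "(1 / d) *\<^sub>R (d *\<^sub>R x + lattice_point \<epsilon> i - lattice_point \<epsilon> i) = x" for x
    using pos(2) by simp
  ultimately show ?thesis by (force simp: base_def image_iff)
qed

lemma open_base: "open (base i)"
proof -
  have "base i = (\<lambda>x. (1 / d) *\<^sub>R (x - lattice_point \<epsilon> i)) -` D" by (auto simp: base_def)
  then show ?thesis using D(1) by (auto intro!: open_vimage continuous_intros)
qed

lemma passage_eq: "ps i = base i \<times> {0..h}"
  by (auto simp: passage_def base_def)

lemma bounded_passage: "bounded (ps i)"
proof -
  have "bounded D" using D(2) by (auto simp: bounded_iff intro!: exI[of _ R])
  then have "bounded ((+) (lattice_point \<epsilon> i) ` ((\<lambda>x. d *\<^sub>R x) ` D))"
    by (intro bounded_translation bounded_scaling)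
  then have "bounded (base i)" by (simp add: base_image image_image add.commute)
  then show ?thesis unfolding passage_eq by (intro bounded_Times) auto
qed

lemma passage_borel: "ps i \<in> sets borel"
  unfolding passage_eq using open_base by (intro borel_Times) auto

lemma measure_passage: "measure lebesgue (ps i) = d ^ CARD('m) * measure lebesgue D * h"
proof -
  have mb: "measure lebesgue (base i) = d ^ CARD('m) * measure lebesgue D"
    unfolding base_image using measure_lebesgue_affine[of d "lattice_point \<epsilon> i" D] pos(2) by simp
  have "emeasure lborel (ps i) = emeasure (lborel \<Otimes>\<^sub>M lborel) (base i \<times> {0..h})"
    by (simp add: lborel_prod passage_eq)
  also have "\<dots> = emeasure lborel (base i) * emeasure lborel {0..h}"
    using open_base by (intro lborel.emeasure_pair_measure_Times) auto
  finally have "measure lborel (ps i) = measure lborel (base i) * measure lborel {0..h}"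
    by (simp add: measure_def enn2real_mult)
  then show ?thesis using mb pos(3) passage_borel open_base by (simp add: measure_completion)
qed

lemma S_borel: "S \<in> sets borel"
proof -
  have "countable (indices \<Omega> \<epsilon>)" by simp
  then show ?thesis
    unfolding perturbed_domain_def
    using Omega(1) open_room passage_borel by (intro sets.Un sets.countable_UN'') auto
qed

text \<open>Removing the horizontal slices at heights 0 and \<open>h\<close>, where the passages are
  closed, leaves an open set.\<close>

lemma S_interior_conull: "\<exists>U. open U \<and> U \<subseteq> S \<and> negligible (S - U)"
proof -
  define U where "U = \<Omega> \<union> (\<Union>i\<in>indices \<Omega> \<epsilon>. base i \<times> {0<..<h} \<union> rm i)"
  have "open U" unfolding U_def using Omega(1) open_room open_base by (intro open_Un open_UN ballI open_Times) auto
  moreover have "U \<subseteq> S" by (auto simp: U_def perturbed_domain_def passage_eq)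
  moreover have "negligible (S - U)"
  proof (rule negligible_subset)
    show "negligible ({x. ((0, 1)::(real^'m) \<times> real) \<bullet> x = 0} \<union> {x. ((0, 1)::(real^'m) \<times> real) \<bullet> x = h})"
      by (intro negligible_Un negligible_hyperplane) (auto simp: zero_prod_def)
    show "S - U \<subseteq> {x. ((0, 1)::(real^'m) \<times> real) \<bullet> x = 0} \<union> {x. ((0, 1)::(real^'m) \<times> real) \<bullet> x = h}"
      by (auto simp: U_def perturbed_domain_def passage_eq inner_prod_def)
  qed
  ultimately show ?thesis by blast
qed

sublocale weighted_domain S \<rho> "min 1 \<rho>0" "max 1 \<rho>0"
proof
  show "S \<in> sets lebesgue" using S_borel by simp
  have "open (rooms \<Omega> B b h \<epsilon>)" unfolding rooms_def using open_room by auto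
  then have [measurable]: "rooms \<Omega> B b h \<epsilon> \<in> sets borel" by simp
  have "\<rho> \<in> borel_measurable borel" unfolding weight_def[abs_def] by measurable
  then have "\<rho> \<in> borel_measurable lborel" by simp
  then show "\<rho> \<in> borel_measurable (lebesgue_on S)"
    by (intro measurable_restrict_space1 measurable_completion)
qed (use S_interior_conull pos in \<open>auto simp: weight_def\<close>)

section \<open>Trial functions, their mass and their energy\<close>

definition ramp :: "(real^'m) \<times> real \<Rightarrow> real" where
  "ramp x = max 0 (min 1 (snd x / h))"

text \<open>The derivative of \<open>ramp\<close> in direction \<open>v\<close>, set to 0 at the
  kinks, which lie on the two null sets of heights 0 and \<open>h\<close>.\<close>

definition slope :: "(real^'m) \<times> real \<Rightarrow> (real^'m) \<times> real \<Rightarrow> real" where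
  "slope v x = (if 0 < snd x \<and> snd x < h then snd v / h else 0)"

text \<open>A sharp cut-off at the column walls is possible: the walls do not meet the perturbed
  domain at positive height, and the ramp vanishes at all other heights.\<close>

definition trial :: "int^'m \<Rightarrow> (real^'m) \<times> real \<Rightarrow> complex" where
  "trial i x = complex_of_real (indicator (column i) x * ramp x)"

definition trial_partial :: "int^'m \<Rightarrow> (real^'m) \<times> real \<Rightarrow> (real^'m) \<times> real \<Rightarrow> complex" where
  "trial_partial i v x = complex_of_real (indicator (column i) x * slope v x)"

lemma ramp_range: "\<bar>ramp x\<bar> \<le> 1" by (auto simp: ramp_def)

lemma ramp_Lipschitz: "\<bar>ramp x - ramp y\<bar> \<le> (1 / h) * norm (x - y)"
proof -
  have "\<bar>ramp x - ramp y\<bar> \<le> \<bar>snd x / h - snd y / h\<bar>" by (auto simp: ramp_def)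
  also have "\<dots> = (1 / h) * \<bar>snd (x - y)\<bar>" using pos(3) by (simp add: abs_divide flip: diff_divide_distrib)
  also have "\<dots> \<le> (1 / h) * norm (x - y)"
    using norm_snd_le_norm[of "x - y"] pos(3) by (intro mult_left_mono) auto
  finally show ?thesis .
qed

lemma ramp_borel: "ramp \<in> borel_measurable borel"
  unfolding ramp_def[abs_def] using pos(3) by (intro borel_measurable_continuous_onI continuous_intros) auto

lemma slope_borel: "slope v \<in> borel_measurable borel"
proof -
  have [measurable]: "snd \<in> borel_measurable (borel :: ((real^'m) \<times> real) measure)"
    by (intro borel_measurable_continuous_onI continuous_intros)
  show ?thesis unfolding slope_def[abs_def] by measurable
qed

lemma ramp_derivative:
  "AE x in lborel. ((\<lambda>t. (ramp (x + t *\<^sub>R v) - ramp x) / t) \<longlongrightarrow> slope v x) (at 0)"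
proof -
  have hyper: "AE x in lborel. snd (x :: (real^'m) \<times> real) \<noteq> c" for c
  proof -
    have "negligible {x. ((0, 1)::(real^'m) \<times> real) \<bullet> x = c}" by (rule negligible_hyperplane) (auto simp: zero_prod_def)
    moreover have "closed {x. ((0, 1)::(real^'m) \<times> real) \<bullet> x = c}" by (rule closed_hyperplane)
    ultimately have "AE x in lborel. x \<notin> {x. ((0, 1)::(real^'m) \<times> real) \<bullet> x = c}"
      by (intro AE_not_in) (simp add: negligible_iff_null_sets null_sets_completion_iff)
    then show ?thesis by (simp add: inner_prod_def)
  qed
  show ?thesis using hyper[of 0] hyper[of h]
  proof eventually_elim
    case (elim x)
    have line: "((\<lambda>t. snd (x + t *\<^sub>R v)) \<longlongrightarrow> snd x) (at 0)" by (auto intro!: tendsto_eq_intros)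
    consider "snd x < 0" | "0 < snd x" "snd x < h" | "h < snd x" using elim by linarith
    then show ?case
    proof cases
      case 1
      have "\<forall>\<^sub>F t in at 0. snd (x + t *\<^sub>R v) < 0" using line 1 by (rule order_tendstoD)
      then have "\<forall>\<^sub>F t in at 0. 0 = (ramp (x + t *\<^sub>R v) - ramp x) / t"
        by eventually_elim (use 1 pos(3) in \<open>auto simp: ramp_def min_def max_def divide_less_0_iff zero_le_divide_iff field_simps\<close>)
      then show ?thesis using 1
        by (intro Lim_transform_eventually[OF tendsto_const[THEN tendsto_eq_rhs]]) (auto simp: slope_def)
    next
      case 2
      have "\<forall>\<^sub>F t in at 0. 0 < snd (x + t *\<^sub>R v)" "\<forall>\<^sub>F t in at 0. snd (x + t *\<^sub>R v) < h"
        using line 2 by (auto intro: order_tendstoD)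
      moreover have "\<forall>\<^sub>F t in at (0::real). t \<noteq> 0" by (simp add: eventually_at_filter)
      ultimately have "\<forall>\<^sub>F t in at 0. snd v / h = (ramp (x + t *\<^sub>R v) - ramp x) / t"
      proof eventually_elim
        case (elim t)
        have "ramp (x + t *\<^sub>R v) = snd (x + t *\<^sub>R v) / h" "ramp x = snd x / h"
          using elim 2 pos(3) by (auto simp: ramp_def)
        then show ?case using elim pos(3) by (simp add: field_simps)
      qed
      then show ?thesis using 2
        by (intro Lim_transform_eventually[OF tendsto_const[THEN tendsto_eq_rhs]]) (auto simp: slope_def)
    next
      case 3
      have "\<forall>\<^sub>F t in at 0. h < snd (x + t *\<^sub>R v)" using line 3 by (rule order_tendstoD)
      then have "\<forall>\<^sub>F t in at 0. 0 = (ramp (x + t *\<^sub>R v) - ramp x) / t"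
      proof eventually_elim
        case (elim t)
        have "ramp (x + t *\<^sub>R v) = 1" "ramp x = 1" using elim 3 pos(3) by (auto simp: ramp_def min_def)
        then show ?case by simp
      qed
      then show ?thesis using 3
        by (intro Lim_transform_eventually[OF tendsto_const[THEN tendsto_eq_rhs]]) (auto simp: slope_def)
    qed
  qed
qed

lemma column_above_bounded: "bounded (S \<inter> column i \<inter> {x. 0 < snd x})"
proof (rule bounded_subset[of "ps i \<union> rm i"])
  show "S \<inter> column i \<inter> {x. 0 < snd x} \<subseteq> ps i \<union> rm i" using above_in_column(2) by blast
qed (simp add: bounded_room bounded_passage)

lemma ramp_pos_iff: "ramp x \<noteq> 0 \<longleftrightarrow> 0 < snd x"
  using pos(3) by (auto simp: ramp_def max_def min_def field_simps)

lemma trial_weak_partial: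
  assumes v: "v \<in> Basis"
  shows "weak_partial S v (trial i) (trial_partial i v)"
  unfolding trial_def[abs_def] trial_partial_def[abs_def]
proof (rule weak_partial_cutoff[OF open_column convex_column v ramp_Lipschitz])
  show "\<bar>slope v x\<bar> \<le> \<bar>snd v\<bar> / h" for x using pos(3) by (auto simp: slope_def abs_divide)
  \<comment> \<open>At positive height a point of \<open>S\<close> lies in an open column, which
    here differs from column \<open>i\<close> and hence is disjoint from it. An open set disjoint
    from column \<open>i\<close> contains none of its frontier points.\<close>
  show "ramp x = 0" if x: "x \<in> frontier (column i)" "x \<in> S" for x
  proof (rule ccontr)
    assume "ramp x \<noteq> 0"
    then have x0: "0 < snd x" by (simp add: ramp_pos_iff)
    obtain i' where i': "x \<in> column i'"
      using x(2) x0 Omega(2) room_column passage_column by (fastforce simp: perturbed_domain_def)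
    have "x \<notin> column i" using x(1) open_column by (auto simp: frontier_def interior_open)
    then have "column i \<inter> column i' = {}" using i' column_disjoint by metis
    then have "closure (column i) \<inter> column i' = {}" using open_column open_Int_closure_eq_empty by blast
    then show False using i' x(1) by (auto simp: frontier_def)
  qed
  show "bounded (S \<inter> column i \<inter> {x. slope v x \<noteq> 0})"
    by (rule bounded_subset[OF column_above_bounded]) (auto simp: slope_def split: if_splits)
qed (use pos ramp_range slope_borel ramp_derivative in auto)

lemma trial_L2: "trial i \<in> L2 S"
  unfolding trial_def[abs_def]
proof (rule bounded_support_L2[of _ 1])
  have [measurable]: "column i \<in> sets borel" "ramp \<in> borel_measurable borel" using open_column ramp_borel by auto
  show "(\<lambda>x. indicator (column i) x * ramp x) \<in> borel_measurable borel" by measurable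
  show "\<bar>indicator (column i) x * ramp x\<bar> \<le> 1" for x using ramp_range[of x] by (auto simp: indicator_def)
  show "bounded (S \<inter> {x. indicator (column i) x * ramp x \<noteq> 0})"
  proof (rule bounded_subset[OF column_above_bounded[of i]])
    have "x \<in> column i \<and> 0 < snd x" if "indicator (column i) x * ramp x \<noteq> 0" for x
      using that ramp_pos_iff[of x] by (cases "x \<in> column i") auto
    then show "S \<inter> {x. indicator (column i) x * ramp x \<noteq> 0} \<subseteq> S \<inter> column i \<inter> {x. 0 < snd x}" by blast
  qed
qed

lemma trial_H1: "trial i \<in> H1 S"
  unfolding H1_def using trial_L2 trial_weak_partial by blast

lemma sum_column:
  assumes "finite I" "i \<in> I" "x \<in> column i" "\<And>i'. x \<notin> column i' \<Longrightarrow> f i' = 0"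
  shows "(\<Sum>i'\<in>I. f i') = f i"
proof -
  have "f i' = 0" if "i' \<noteq> i" for i' using column_disjoint[OF that] assms(3,4) by auto
  then have "(\<Sum>i'\<in>I - {i}. f i') = 0" by (intro sum.neutral) auto
  then show ?thesis using assms(1,2) by (simp add: sum.remove)
qed

lemma integral_on_S_indicator:
  assumes "A \<in> sets borel" "A \<subseteq> S" "bounded A"
  shows "integrable (lebesgue_on S) (indicator A :: _ \<Rightarrow> real)"
    "(LINT x|lebesgue_on S. indicator A x) = measure lebesgue A"
proof -
  have A: "A \<in> sets lebesgue" using assms(1) by simp
  then have As: "A \<in> sets (lebesgue_on S)" using assms(2) S_sets by (subst sets_restrict_space_iff) auto
  have "emeasure (lebesgue_on S) A = emeasure lborel A"
    using assms S_sets A by (subst emeasure_restrict_space) auto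
  then have "emeasure (lebesgue_on S) A < \<infinity>" using emeasure_bounded_finite[OF assms(3)] by simp
  then show "integrable (lebesgue_on S) (indicator A :: _ \<Rightarrow> real)"
    using As by (intro integrable_real_indicator)
  show "(LINT x|lebesgue_on S. indicator A x) = measure lebesgue A"
    using assms S_sets A As by (simp add: measure_restrict_space space_restrict_space Int_absorb2)
qed

text \<open>Only the rooms are kept: on room \<open>i\<close> the combination equals
  \<open>c i\<close> and the weight is \<open>\<rho>0\<close>, and elsewhere the integrand is
  nonnegative.\<close>

lemma trial_mass:
  assumes I: "finite I" "I \<subseteq> indices \<Omega> \<epsilon>"
  shows "(\<Sum>i\<in>I. (cmod (c i))\<^sup>2) * (\<rho>0 * b ^ (CARD('m) + 1) * measure lebesgue B)
    \<le> ip (\<lambda>x. \<Sum>i\<in>I. c i * trial i x) (\<lambda>x. \<Sum>i\<in>I. c i * trial i x)"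
proof -
  have rm: "rm i \<subseteq> S" "rm i \<subseteq> rooms \<Omega> B b h \<epsilon>" if "i \<in> I" for i
    using I(2) that by (auto simp: perturbed_domain_def rooms_def)
  have int: "integrable (lebesgue_on S) (indicator (rm i) :: _ \<Rightarrow> real)"
    "(LINT x|lebesgue_on S. indicator (rm i) x) = measure lebesgue (rm i)" if "i \<in> I" for i
    using integral_on_S_indicator[of "rm i"] rm(1)[OF that] open_room bounded_room by auto
  have "(\<Sum>i\<in>I. (cmod (c i))\<^sup>2) * (\<rho>0 * b ^ (CARD('m) + 1) * measure lebesgue B)
      = (\<Sum>i\<in>I. (cmod (c i))\<^sup>2 * \<rho>0 * measure lebesgue (rm i))"
    unfolding sum_distrib_right by (intro sum.cong) (auto simp: measure_room)
  also have "\<dots> = (LINT x|lebesgue_on S. (\<Sum>i\<in>I. (cmod (c i))\<^sup>2 * \<rho>0 * indicator (rm i) x))"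
    using int by simp
  also have "\<dots> \<le> (LINT x|lebesgue_on S. (cmod (\<Sum>i\<in>I. c i * trial i x))\<^sup>2 * \<rho> x)"
  proof (rule integral_mono)
    show "integrable (lebesgue_on S) (\<lambda>x. \<Sum>i\<in>I. (cmod (c i))\<^sup>2 * \<rho>0 * indicator (rm i) x)"
      using int by (intro Bochner_Integration.integrable_sum integrable_mult_right) auto
    show "integrable (lebesgue_on S) (\<lambda>x. (cmod (\<Sum>i\<in>I. c i * trial i x))\<^sup>2 * \<rho> x)"
      by (intro weighted_sq_integrable L2_sum trial_L2)
    fix x
    show "(\<Sum>i\<in>I. (cmod (c i))\<^sup>2 * \<rho>0 * indicator (rm i) x) \<le> (cmod (\<Sum>i\<in>I. c i * trial i x))\<^sup>2 * \<rho> x"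
    proof (cases "\<exists>i\<in>I. x \<in> rm i")
      case True
      then obtain i where i: "i \<in> I" "x \<in> rm i" by auto
      have x: "x \<in> column i" "h < snd x" using room_column i by auto
      have out: "indicator (rm i') x = (0::real)" if "x \<notin> column i'" for i'
        using room_column that by (auto simp: indicator_def)
      have "(\<Sum>i\<in>I. (cmod (c i))\<^sup>2 * \<rho>0 * indicator (rm i) x) = (cmod (c i))\<^sup>2 * \<rho>0 * indicator (rm i) x"
        by (rule sum_column[OF I(1) i(1) x(1)]) (simp add: out)
      moreover have "(\<Sum>i\<in>I. c i * trial i x) = c i * trial i x"
        by (rule sum_column[OF I(1) i(1) x(1)]) (simp add: trial_def)
      moreover have "trial i x = 1" using x pos(3) by (simp add: trial_def ramp_def min_def)
      moreover have "\<rho> x = \<rho>0" using rm(2)[OF i(1)] i(2) by (auto simp: weight_def)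
      ultimately show ?thesis using i by simp
    next
      case False
      then have "(\<Sum>i\<in>I. (cmod (c i))\<^sup>2 * \<rho>0 * indicator (rm i) x) = 0" by (intro sum.neutral) auto
      then show ?thesis using weight_pos[of x] by simp
    qed
  qed
  finally show ?thesis by (simp add: ip_self)
qed

text \<open>In passage \<open>i\<close> the squared gradient is the square of
  \<open>cmod (c i) / h\<close>, and the volume contains one factor \<open>h\<close>, so one
  \<open>h\<close> remains in the denominator.\<close>

lemma trial_energy:
  assumes I: "finite I" "I \<subseteq> indices \<Omega> \<epsilon>"
  shows "en (\<lambda>x. \<Sum>i\<in>I. c i * trial i x) (\<lambda>x. \<Sum>i\<in>I. c i * trial i x)
    \<le> (\<Sum>i\<in>I. (cmod (c i))\<^sup>2) * (d ^ CARD('m) * measure lebesgue D / h)"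
proof -
  have ps: "ps i \<subseteq> S" if "i \<in> I" for i
    using I(2) that by (auto simp: perturbed_domain_def)
  have int: "integrable (lebesgue_on S) (indicator (ps i) :: _ \<Rightarrow> real)"
    "(LINT x|lebesgue_on S. indicator (ps i) x) = measure lebesgue (ps i)" if "i \<in> I" for i
    using integral_on_S_indicator[of "ps i"] ps(1)[OF that] passage_borel bounded_passage by auto
  have "en (\<lambda>x. \<Sum>i\<in>I. c i * trial i x) (\<lambda>x. \<Sum>i\<in>I. c i * trial i x)
      = (LINT x|lebesgue_on S. (\<Sum>v\<in>Basis. (cmod (\<Sum>i\<in>I. c i * trial_partial i v x))\<^sup>2))"
    by (intro en_self_eq weak_partial_sum I trial_L2 trial_weak_partial L2_sum)
  also have "\<dots> \<le> (LINT x|lebesgue_on S. (\<Sum>i\<in>I. (cmod (c i))\<^sup>2 / h\<^sup>2 * indicator (ps i) x))"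
  proof (rule integral_mono')
    show "integrable (lebesgue_on S) (\<lambda>x. \<Sum>i\<in>I. (cmod (c i))\<^sup>2 / h\<^sup>2 * indicator (ps i) x)"
      using int by (intro Bochner_Integration.integrable_sum integrable_mult_right) auto
    fix x assume "x \<in> space (lebesgue_on S)"
    then have xS: "x \<in> S" by (simp add: space_restrict_space)
    show nn: "0 \<le> (\<Sum>i\<in>I. (cmod (c i))\<^sup>2 / h\<^sup>2 * indicator (ps i) x)"
      by (intro sum_nonneg) (auto simp: indicator_def)
    show "(\<Sum>v\<in>Basis. (cmod (\<Sum>i\<in>I. c i * trial_partial i v x))\<^sup>2)
        \<le> (\<Sum>i\<in>I. (cmod (c i))\<^sup>2 / h\<^sup>2 * indicator (ps i) x)"
    proof (cases "0 < snd x \<and> snd x < h \<and> (\<exists>i\<in>I. x \<in> column i)")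
      case True
      then obtain i where i: "i \<in> I" "x \<in> column i" and x: "0 < snd x" "snd x < h" by auto
      have "x \<in> ps i" using above_in_column(2)[OF xS x(1) i(2)] room_column[of i] x(2) by auto
      have "(\<Sum>i\<in>I. c i * trial_partial i v x) = c i * (snd v / h)" for v
        using sum_column[OF I(1) i, of "\<lambda>i. c i * trial_partial i v x"] i x
        by (simp add: trial_partial_def slope_def)
      then have "(\<Sum>v\<in>Basis. (cmod (\<Sum>i\<in>I. c i * trial_partial i v x))\<^sup>2)
          = (\<Sum>v\<in>(Basis::((real^'m) \<times> real) set). (cmod (c i))\<^sup>2 / h\<^sup>2 * (snd v)\<^sup>2)"
        by (simp add: norm_mult norm_divide power_mult_distrib power_divide mult_ac)
      also have "\<dots> = (cmod (c i))\<^sup>2 / h\<^sup>2"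
      proof -
        \<comment> \<open>The squared length of the vertical unit vector, expanded in the
          basis.\<close>
        have "(\<Sum>v\<in>(Basis::((real^'m) \<times> real) set). (snd v)\<^sup>2) = 1"
        proof -
          have "((0, 1)::(real^'m) \<times> real) \<bullet> (0, 1) = (\<Sum>v\<in>(Basis::((real^'m) \<times> real) set). (snd v)\<^sup>2)"
            by (subst euclidean_inner) (simp add: inner_prod_def power2_eq_square)
          then show ?thesis by (simp add: inner_prod_def)
        qed
        then show ?thesis unfolding sum_distrib_left[symmetric] by simp
      qed
      also have "\<dots> = (\<Sum>i\<in>I. (cmod (c i))\<^sup>2 / h\<^sup>2 * indicator (ps i) x)"
      proof -
        have "(\<Sum>i\<in>I. (cmod (c i))\<^sup>2 / h\<^sup>2 * indicator (ps i) x) = (cmod (c i))\<^sup>2 / h\<^sup>2 * indicator (ps i) x"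
          by (rule sum_column[OF I(1) i]) (use passage_column in \<open>auto simp: indicator_def\<close>)
        then show ?thesis using \<open>x \<in> ps i\<close> by simp
      qed
      finally show ?thesis by simp
    next
      case False
      then have "trial_partial i v x = 0" if "i \<in> I" for i v
        using that by (auto simp: trial_partial_def slope_def indicator_def)
      then show ?thesis using nn by simp
    qed
  qed
  also have "\<dots> = (\<Sum>i\<in>I. (cmod (c i))\<^sup>2 / h\<^sup>2 * measure lebesgue (ps i))"
    using int by simp
  also have "\<dots> = (\<Sum>i\<in>I. (cmod (c i))\<^sup>2) * (d ^ CARD('m) * measure lebesgue D / h)"
    unfolding sum_distrib_right using pos(3)
    by (intro sum.cong) (auto simp: measure_passage power2_eq_square)
  finally show ?thesis .
qed

lemma eigenvalue_bounds:
  assumes "purely_discrete S \<rho> (neumann_operator S \<rho>)" "eigenvalue_sequence S (neumann_operator S \<rho>) ev"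
    and I: "I \<subseteq> indices \<Omega> \<epsilon>" "finite I" "k < card I"
  shows "0 \<le> ev k" "ev k \<le> q_eps B D b d h \<rho>0"
proof -
  show "0 \<le> ev k" using assms(2) by (rule eigenvalue_nonneg)
  have mB: "0 < measure lebesgue B"
  proof -
    have "B \<in> lmeasurable" using B by (intro bounded_set_imp_lmeasurable) auto
    moreover have "\<not> negligible B" using B open_not_negligible by blast
    ultimately have "measure lebesgue B \<noteq> 0" by (simp add: negligible_iff_measure)
    then show ?thesis using zero_less_measure_iff by blast
  qed
  have mass: "0 < \<rho>0 * b ^ (CARD('m) + 1) * measure lebesgue B" using pos mB by simp
  show "ev k \<le> q_eps B D b d h \<rho>0"
  proof (rule eigenvalue_le_Rayleigh[OF assms(1,2) I(2,3), of trial])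
    fix c
    let ?m = "ip (\<lambda>x. \<Sum>i\<in>I. c i * trial i x) (\<lambda>x. \<Sum>i\<in>I. c i * trial i x)"
    have q: "q_eps B D b d h \<rho>0 * (\<rho>0 * b ^ (CARD('m) + 1) * measure lebesgue B) = d ^ CARD('m) * measure lebesgue D / h"
      using mB pos by (simp add: q_eps_def field_simps)
    have q0: "0 \<le> q_eps B D b d h \<rho>0" using pos by (simp add: q_eps_def)
    have "en (\<lambda>x. \<Sum>i\<in>I. c i * trial i x) (\<lambda>x. \<Sum>i\<in>I. c i * trial i x)
        \<le> (\<Sum>i\<in>I. (cmod (c i))\<^sup>2) * (q_eps B D b d h \<rho>0 * (\<rho>0 * b ^ (CARD('m) + 1) * measure lebesgue B))"
      unfolding q by (rule trial_energy[OF I(2,1)])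
    also have "\<dots> = q_eps B D b d h \<rho>0 * ((\<Sum>i\<in>I. (cmod (c i))\<^sup>2) * (\<rho>0 * b ^ (CARD('m) + 1) * measure lebesgue B))"
      by (simp add: mult_ac)
    also have "\<dots> \<le> q_eps B D b d h \<rho>0 * ?m" by (intro mult_left_mono trial_mass I q0)
    finally show "en (\<lambda>x. \<Sum>i\<in>I. c i * trial i x) (\<lambda>x. \<Sum>i\<in>I. c i * trial i x) \<le> q_eps B D b d h \<rho>0 * ?m" .
    assume "\<exists>i\<in>I. c i \<noteq> 0"
    then obtain i where i: "i \<in> I" "c i \<noteq> 0" by auto
    have "0 < (cmod (c i))\<^sup>2" using i by simp
    also have "\<dots> \<le> (\<Sum>i\<in>I. (cmod (c i))\<^sup>2)" using I(2) i by (intro member_le_sum) auto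
    finally have "0 < (\<Sum>i\<in>I. (cmod (c i))\<^sup>2) * (\<rho>0 * b ^ (CARD('m) + 1) * measure lebesgue B)"
      using mass by simp
    then show "0 < ?m" using trial_mass[OF I(2,1), of c] by linarith
  qed (rule trial_H1)
qed

end

section \<open>Convergence of the eigenvalues\<close>

theorem corollary2p1:
  fixes \<Omega> B :: "((real^'m) \<times> real) set"
    and D :: "(real^'m) set"
    and R :: real
    and b d h \<rho>0 :: "real \<Rightarrow> real"
    and q :: ennreal
    and r :: real
    and S :: "real \<Rightarrow> ((real^'m) \<times> real) set"
    and \<rho> :: "real \<Rightarrow> (real^'m) \<times> real \<Rightarrow> real"
    and A :: "real \<Rightarrow> (((real^'m) \<times> real \<Rightarrow> complex) \<times> ((real^'m) \<times> real \<Rightarrow> complex)) set"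
    and ev :: "real \<Rightarrow> nat \<Rightarrow> real"
  assumes Omega: "domain \<Omega>" "bounded \<Omega>" "lipschitz_boundary \<Omega>" "\<Omega> \<subseteq> {x. snd x < 0}"
    and Gamma: "interior {x'. (x', 0) \<in> flat_part \<Omega>} \<noteq> {}"
    and B: "domain B" "bounded B" "lipschitz_boundary B"
      "B \<subseteq> {x. (\<forall>j. - (1/2) < fst x $ j \<and> fst x $ j < 1/2) \<and> 0 < snd x}"
    and R: "0 < R" "R < 1/2" "{x. norm (fst x) < R \<and> snd x = 0} \<subseteq> frontier B"
    and D: "domain D" "bounded D" "lipschitz_boundary D" "0 \<in> D" "D \<subseteq> {x'. norm x' < R}"
    and pos: "\<forall>\<^sub>F \<epsilon> in at_right 0. 0 < b \<epsilon> \<and> 0 < d \<epsilon> \<and> 0 < h \<epsilon> \<and> 0 < \<rho>0 \<epsilon>"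
    and le: "\<forall>\<^sub>F \<epsilon> in at_right 0. d \<epsilon> \<le> b \<epsilon> \<and> b \<epsilon> \<le> \<epsilon>"
    and h_lim: "(h \<longlongrightarrow> 0) (at_right 0)"
    and D_lim: "((\<lambda>\<epsilon>. \<epsilon> ^ CARD('m) * bold_D (CARD('m) + 1) (d \<epsilon>)) \<longlongrightarrow> 0) (at_right 0)"
    and q_lim: "((\<lambda>\<epsilon>. ennreal (q_eps B D (b \<epsilon>) (d \<epsilon>) (h \<epsilon>) (\<rho>0 \<epsilon>))) \<longlongrightarrow> q) (at_right 0)"
    and r_lim: "((\<lambda>\<epsilon>. r_eps B (b \<epsilon>) (\<rho>0 \<epsilon>) \<epsilon>) \<longlongrightarrow> r) (at_right 0)" "0 \<le> r"
    and S_eq: "\<And>\<epsilon>. S \<epsilon> = perturbed_domain \<Omega> B D (b \<epsilon>) (d \<epsilon>) (h \<epsilon>) \<epsilon>"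
    and rho_eq: "\<And>\<epsilon>. \<rho> \<epsilon> = weight \<Omega> B (b \<epsilon>) (h \<epsilon>) (\<rho>0 \<epsilon>) \<epsilon>"
    and A_eq: "\<And>\<epsilon>. A \<epsilon> = neumann_operator (S \<epsilon>) (\<rho> \<epsilon>)"
    and discrete: "\<forall>\<^sub>F \<epsilon> in at_right 0. purely_discrete (S \<epsilon>) (\<rho> \<epsilon>) (A \<epsilon>)"
    and ev: "\<forall>\<^sub>F \<epsilon> in at_right 0. eigenvalue_sequence (S \<epsilon>) (A \<epsilon>) (ev \<epsilon>)"
    and q_zero: "q = 0"
  shows "\<forall>k. ((\<lambda>\<epsilon>. ev \<epsilon> k) \<longlongrightarrow> 0) (at_right 0)"
proof
  fix k
  let ?q = "\<lambda>\<epsilon>. q_eps B D (b \<epsilon>) (d \<epsilon>) (h \<epsilon>) (\<rho>0 \<epsilon>)"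
  \<comment> \<open>An empty set has empty frontier, so the flat piece in the frontier of
    \<open>B\<close> shows that \<open>B\<close> is nonempty.\<close>
  have "(0, 0) \<in> frontier B" using R(1,3) by auto
  then have B0: "B \<noteq> {}" by auto
  have bounds: "\<forall>\<^sub>F \<epsilon> in at_right 0. 0 \<le> ev \<epsilon> k \<and> ev \<epsilon> k \<le> ?q \<epsilon>"
    using pos le discrete ev eventually_many_indices[OF Omega(2-4) Gamma, of k]
  proof eventually_elim
    case (elim \<epsilon>)
    interpret rooms_and_passages \<Omega> B D R "b \<epsilon>" "d \<epsilon>" "h \<epsilon>" "\<rho>0 \<epsilon>" \<epsilon>
      using Omega B B0 R D elim by unfold_locales (auto simp: domain_def)
    obtain I where "I \<subseteq> indices \<Omega> \<epsilon>" "finite I" "k < card I" using elim by auto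
    then show ?case
      using eigenvalue_bounds[of "ev \<epsilon>" I k] elim by (simp add: S_eq rho_eq A_eq)
  qed
  \<comment> \<open>\<open>ennreal\<close> sends negative reals to 0, so convergence transfers back
    to the reals only with nonnegativity, which is read off from \<open>bounds\<close>.\<close>
  have "\<forall>\<^sub>F \<epsilon> in at_right 0. 0 \<le> ?q \<epsilon>"
    using bounds by eventually_elim linarith
  moreover have "((\<lambda>\<epsilon>. ennreal (?q \<epsilon>)) \<longlongrightarrow> ennreal 0) (at_right 0)" using q_lim q_zero by simp
  ultimately have q0: "(?q \<longlongrightarrow> 0) (at_right 0)" by (subst (asm) tendsto_ennreal_iff) auto
  show "((\<lambda>\<epsilon>. ev \<epsilon> k) \<longlongrightarrow> 0) (at_right 0)"
    by (rule tendsto_sandwich[OF _ _ tendsto_const q0]) (use bounds in \<open>auto elim!: eventually_mono\<close>)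
qed

end
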